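(* Fix a constant $t$. There is a polynomial-time algorithm that, given an instance $\mathcal{I}=(P,d,t)$ of NUkC with $t$ radii classes which is $2$-perturbation-resilient, computes its optimal clustering (and optimal dilation). The same holds for instances that are $(3,\epsilon)$-perturbation-resilient and in which every cluster of every optimal clustering has more than $\epsilon n+1$ points, where $n=|P|$.
   Context: NUkC with $t$ radii classes: given a finite set $P$ of $n$ points with a metric $d$, distinct radii $r_1>r_2>\dots>r_t\ge 0$ and non-negative integers $k_1,\dots,k_t$ with $\sum_i k_i=k$, find the minimum dilation $\alpha$ such that one can choose, for each $i$, $k_i$ balls $B(p,\alpha r_i)=\{q\in P: d(p,q)\le \alpha r_i\}$ centered at points $p\in P$ whose union is $P$ (such a choice is a feasible placement with dilation $\alpha$; one with minimum dilation is optimal). A (feasible) clustering is a partition $\{C_1,\dots,C_k\}$ of $P$ such that there is a feasible placement with each $C_i$ contained in a ball of the placement (the clustering is induced by the placement); an optimal clustering is one induced by an optimal placement. A metric $d_1$ on $P$ is a $\psi$-perturbation of $d$ if $d(p,q)/\psi\le d_1(p,q)\le d(p,q)$ for all $p,q$. The instance $(P,d,t)$ is $\psi$-perturbation-resilient ($\psi$-PR) if for every metric $\psi$-perturbation $d_1$ of $d$, the instance $(P,d_1,t)$ (same radii and multiplicities) has a unique optimal clustering and it is identical to the unique optimal clustering of $(P,d,t)$. Two clusterings $\{C_1,\dots,C_k\}$ and $\{C'_1,\dots,C'_k\}$ are $\epsilon$-close if $\min_f\sum_{i=1}^k|C_i\setminus C'_{f(i)}|\le \epsilon n$ over permutations $f$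 of $\{1,\dots,k\}$. The instance is $(\psi,\epsilon)$-PR if for every metric $\psi$-perturbation $d_1$ of $d$, every optimal clustering of $(P,d_1,t)$ is $\epsilon$-close to every optimal clustering of $(P,d,t)$. *)

theory Defs
  imports "HOL-Analysis.Analysis" "HOL-Library.Disjoint_Sets"
    "HOL-Computational_Algebra.Polynomial"
begin

section \<open>Non-uniform k-center\<close>

text \<open>
  An instance is a finite point set \<open>P\<close>, a metric \<open>d\<close> on \<open>P\<close>, the list \<open>rs\<close> of the \<open>t\<close> radii
  and the list \<open>ks\<close> of the \<open>t\<close> multiplicities.  A placement is a function \<open>A\<close> on the indices
  \<open>i < t\<close>, where \<open>A i\<close> is the set of centers of the balls of the \<open>i\<close>-th class.
\<close>

definition nball :: "'a set \<Rightarrow> ('a \<Rightarrow> 'a \<Rightarrow> real) \<Rightarrow> 'a \<Rightarrow> real \<Rightarrow> 'a set" where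
  "nball P d p \<rho> = {q \<in> P. d p q \<le> \<rho>}"

text \<open>
  Dilations are nonnegative.  Without this a class of radius \<open>0\<close> alone could
  be dilated by arbitrarily negative factors, and no minimum would exist.
\<close>

definition feasible_placement ::
  "'a set \<Rightarrow> ('a \<Rightarrow> 'a \<Rightarrow> real) \<Rightarrow> real list \<Rightarrow> nat list \<Rightarrow> real \<Rightarrow> (nat \<Rightarrow> 'a set) \<Rightarrow> bool" where
  "feasible_placement P d rs ks \<alpha> A \<longleftrightarrow>
     0 \<le> \<alpha> \<and>
     (\<forall>i < length rs. A i \<subseteq> P \<and> card (A i) = ks ! i) \<and>
     (\<Union>i < length rs. \<Union>p \<in> A i. nball P d p (\<alpha> * rs ! i)) = P"

definition optimal_placement ::
  "'a set \<Rightarrow> ('a \<Rightarrow> 'a \<Rightarrow> real) \<Rightarrow> real list \<Rightarrow> nat list \<Rightarrow> real \<Rightarrow> (nat \<Rightarrow> 'a set) \<Rightarrow> bool" where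
  "optimal_placement P d rs ks \<alpha> A \<longleftrightarrow>
     feasible_placement P d rs ks \<alpha> A \<and>
     (\<forall>\<alpha>' A'. feasible_placement P d rs ks \<alpha>' A' \<longrightarrow> \<alpha> \<le> \<alpha>')"

definition optimal_dilation ::
  "'a set \<Rightarrow> ('a \<Rightarrow> 'a \<Rightarrow> real) \<Rightarrow> real list \<Rightarrow> nat list \<Rightarrow> real \<Rightarrow> bool" where
  "optimal_dilation P d rs ks \<alpha> \<longleftrightarrow> (\<exists>A. optimal_placement P d rs ks \<alpha> A)"

text \<open>
  A clustering is an unlabelled partition into exactly \<open>k = sum_list ks\<close> parts; the parts are
  nonempty by the definition of \<^const>\<open>partition_on\<close>.
\<close>

definition induced_clustering ::
  "'a set \<Rightarrow> ('a \<Rightarrow> 'a \<Rightarrow> real) \<Rightarrow> real list \<Rightarrow> nat list \<Rightarrow> real \<Rightarrow> (nat \<Rightarrow> 'a set) \<Rightarrow> 'a set set \<Rightarrow> bool"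
  where
  "induced_clustering P d rs ks \<alpha> A \<C> \<longleftrightarrow>
     partition_on P \<C> \<and> card \<C> = sum_list ks \<and>
     (\<forall>C \<in> \<C>. \<exists>i < length rs. \<exists>p \<in> A i. C \<subseteq> nball P d p (\<alpha> * rs ! i))"

definition optimal_clustering ::
  "'a set \<Rightarrow> ('a \<Rightarrow> 'a \<Rightarrow> real) \<Rightarrow> real list \<Rightarrow> nat list \<Rightarrow> 'a set set \<Rightarrow> bool" where
  "optimal_clustering P d rs ks \<C> \<longleftrightarrow>
     (\<exists>\<alpha> A. optimal_placement P d rs ks \<alpha> A \<and> induced_clustering P d rs ks \<alpha> A \<C>)"

section \<open>Perturbation resilience\<close>

definition metric_perturbation ::
  "real \<Rightarrow> 'a set \<Rightarrow> ('a \<Rightarrow> 'a \<Rightarrow> real) \<Rightarrow> ('a \<Rightarrow> 'a \<Rightarrow> real) \<Rightarrow> bool" where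
  "metric_perturbation \<psi> P d d1 \<longleftrightarrow>
     Metric_space P d1 \<and> (\<forall>p \<in> P. \<forall>q \<in> P. d p q / \<psi> \<le> d1 p q \<and> d1 p q \<le> d p q)"

definition perturbation_resilient ::
  "real \<Rightarrow> 'a set \<Rightarrow> ('a \<Rightarrow> 'a \<Rightarrow> real) \<Rightarrow> real list \<Rightarrow> nat list \<Rightarrow> bool" where
  "perturbation_resilient \<psi> P d rs ks \<longleftrightarrow>
     (\<exists>\<C>. (\<forall>\<C>'. optimal_clustering P d rs ks \<C>' \<longleftrightarrow> \<C>' = \<C>) \<and>
          (\<forall>d1. metric_perturbation \<psi> P d d1 \<longrightarrow>
             (\<forall>\<C>'. optimal_clustering P d1 rs ks \<C>' \<longleftrightarrow> \<C>' = \<C>)))"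

definition eps_close :: "real \<Rightarrow> 'a set \<Rightarrow> 'a set set \<Rightarrow> 'a set set \<Rightarrow> bool" where
  "eps_close \<epsilon> P \<C> \<C>' \<longleftrightarrow>
     (\<exists>f. bij_betw f \<C> \<C>' \<and> real (\<Sum>C \<in> \<C>. card (C - f C)) \<le> \<epsilon> * real (card P))"

definition eps_perturbation_resilient ::
  "real \<Rightarrow> real \<Rightarrow> 'a set \<Rightarrow> ('a \<Rightarrow> 'a \<Rightarrow> real) \<Rightarrow> real list \<Rightarrow> nat list \<Rightarrow> bool" where
  "eps_perturbation_resilient \<psi> \<epsilon> P d rs ks \<longleftrightarrow>
     (\<forall>d1. metric_perturbation \<psi> P d d1 \<longrightarrow>
        (\<forall>\<C>1 \<C>. optimal_clustering P d1 rs ks \<C>1 \<longrightarrow> optimal_clustering P d rs ks \<C> \<longrightarrow>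
           eps_close \<epsilon> P \<C>1 \<C>))"

section \<open>The model of computation\<close>

text \<open>
  A first-order functional language over binary trees in the style of Jones (Computability and
  Complexity from a Programming Perspective).  A program is a finite list of function bodies,
  each an expression in the single argument \<open>Inp\<close>.  The only operations build a node, take one
  apart and test for a leaf; there is no arithmetic and no equality test on trees.  Every
  evaluated subexpression costs one unit, which can be realised by a constant number of pointer
  operations on a heap with sharing, so polynomial time in this model is polynomial time on
  Turing machines.
\<close>

datatype tree = Leaf | Node tree tree

fun left :: "tree \<Rightarrow> tree" where
  "left Leaf = Leaf"
| "left (Node l r) = l"

fun right :: "tree \<Rightarrow> tree" where
  "right Leaf = Leaf"
| "right (Node l r) = r"

datatype expr =
    Inp
  | Nl
  | Cns expr expr
  | Hd expr
  | Tl expr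
  | Ifn expr expr expr
  | Bind expr expr
  | Call nat expr

text \<open>
  \<open>eval prog e x v n\<close>: in program \<open>prog\<close>, with argument value \<open>x\<close>, expression \<open>e\<close> evaluates to \<open>v\<close>
  in time \<open>n\<close>.  \<open>Ifn\<close> takes its first branch on nodes and its second one on leaves;
  \<open>Bind e b\<close> evaluates \<open>b\<close> with the value of \<open>e\<close> as its argument.
\<close>

inductive eval :: "expr list \<Rightarrow> expr \<Rightarrow> tree \<Rightarrow> tree \<Rightarrow> nat \<Rightarrow> bool" for prog :: "expr list" where
  Inp: "eval prog Inp x x 1"
| Nl: "eval prog Nl x Leaf 1"
| Cns: "eval prog e1 x v1 n1 \<Longrightarrow> eval prog e2 x v2 n2 \<Longrightarrow>
    eval prog (Cns e1 e2) x (Node v1 v2) (n1 + n2 + 1)"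
| Hd: "eval prog e x v n \<Longrightarrow> eval prog (Hd e) x (left v) (n + 1)"
| Tl: "eval prog e x v n \<Longrightarrow> eval prog (Tl e) x (right v) (n + 1)"
| IfNode: "eval prog c x v n1 \<Longrightarrow> v \<noteq> Leaf \<Longrightarrow> eval prog e1 x w n2 \<Longrightarrow>
    eval prog (Ifn c e1 e2) x w (n1 + n2 + 1)"
| IfLeaf: "eval prog c x Leaf n1 \<Longrightarrow> eval prog e2 x w n2 \<Longrightarrow>
    eval prog (Ifn c e1 e2) x w (n1 + n2 + 1)"
| Bind: "eval prog e x v n1 \<Longrightarrow> eval prog b v w n2 \<Longrightarrow>
    eval prog (Bind e b) x w (n1 + n2 + 1)"
| Call: "eval prog e x v n1 \<Longrightarrow> f < length prog \<Longrightarrow> eval prog (prog ! f) v w n2 \<Longrightarrow>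
    eval prog (Call f e) x w (n1 + n2 + 1)"

inductive_cases eval_InpE: "eval prog Inp x v n"
inductive_cases eval_NlE: "eval prog Nl x v n"
inductive_cases eval_CnsE: "eval prog (Cns e1 e2) x v n"
inductive_cases eval_HdE: "eval prog (Hd e) x v n"
inductive_cases eval_TlE: "eval prog (Tl e) x v n"
inductive_cases eval_IfnE: "eval prog (Ifn c e1 e2) x v n"
inductive_cases eval_BindE: "eval prog (Bind e b) x v n"
inductive_cases eval_CallE: "eval prog (Call f e) x v n"

lemma eval_deterministic:
  "eval prog e x v n \<Longrightarrow> eval prog e x v' n' \<Longrightarrow> v' = v \<and> n' = n"
proof (induction arbitrary: v' n' rule: eval.induct)
  case (Inp x)
  then show ?case by (rule eval_InpE) simp
next
  case (Nl x)
  then show ?case by (rule eval_NlE) simp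
next
  case (Cns e1 x v1 n1 e2 v2 n2)
  from Cns.prems show ?case by (rule eval_CnsE) (auto dest!: Cns.IH)
next
  case (Hd e x v n)
  from Hd.prems show ?case by (rule eval_HdE) (auto dest!: Hd.IH)
next
  case (Tl e x v n)
  from Tl.prems show ?case by (rule eval_TlE) (auto dest!: Tl.IH)
next
  case (IfNode c x v n1 e1 w n2 e2)
  from IfNode.prems show ?case
    by (rule eval_IfnE) (auto dest!: IfNode.IH simp: IfNode.hyps)
next
  case (IfLeaf c x n1 e2 w n2 e1)
  from IfLeaf.prems show ?case
    by (rule eval_IfnE) (auto dest!: IfLeaf.IH)
next
  case (Bind e x v n1 b w n2)
  from Bind.prems show ?case by (rule eval_BindE) (auto dest!: Bind.IH)
next
  case (Call e x v n1 f w n2)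
  from Call.prems show ?case by (rule eval_CallE) (auto dest!: Call.IH)
qed

text \<open>The first function of a program is its entry point.\<close>

definition runs :: "expr list \<Rightarrow> tree \<Rightarrow> tree \<Rightarrow> nat \<Rightarrow> bool" where
  "runs prog inp out n \<longleftrightarrow> eval prog (Call 0 Inp) inp out n"

section \<open>Encodings\<close>

text \<open>Natural numbers are written in binary, least significant bit first.\<close>

fun enc_nat :: "nat \<Rightarrow> tree" where
  "enc_nat n =
     (if n = 0 then Leaf
      else Node (if odd n then Node Leaf Leaf else Leaf) (enc_nat (n div 2)))"

declare enc_nat.simps [simp del]

fun enc_list :: "('a \<Rightarrow> tree) \<Rightarrow> 'a list \<Rightarrow> tree" where
  "enc_list f [] = Leaf"
| "enc_list f (x # xs) = Node (f x) (enc_list f xs)"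

text \<open>Used for nonnegative rationals only, as a fraction in lowest terms.\<close>

definition enc_rat :: "rat \<Rightarrow> tree" where
  "enc_rat q = Node (enc_nat (nat (fst (quotient_of q)))) (enc_nat (nat (snd (quotient_of q))))"

text \<open>
  Inputs to an algorithm: points are numbered \<open>0, \<dots>, n - 1\<close>, and distances and radii are rational.
\<close>

record instance_data =
  npoints :: nat
  distance :: "nat \<Rightarrow> nat \<Rightarrow> rat"
  radii :: "rat list"
  mults :: "nat list"

definition pts :: "instance_data \<Rightarrow> nat set" where
  "pts I = {..<npoints I}"

definition dst :: "instance_data \<Rightarrow> nat \<Rightarrow> nat \<Rightarrow> real" where
  "dst I p q = of_rat (distance I p q)"

definition rds :: "instance_data \<Rightarrow> real list" where
  "rds I = map of_rat (radii I)"

definition nukc_instance :: "nat \<Rightarrow> instance_data \<Rightarrow> bool" where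
  "nukc_instance t I \<longleftrightarrow>
     Metric_space (pts I) (dst I) \<and>
     length (radii I) = t \<and> length (mults I) = t \<and>
     sorted_wrt (>) (radii I) \<and> (\<forall>r \<in> set (radii I). 0 \<le> r)"

definition enc_instance :: "instance_data \<Rightarrow> tree" where
  "enc_instance I =
     Node
       (enc_list (\<lambda>p. enc_list (\<lambda>q. enc_rat (distance I p q)) [0..<npoints I]) [0..<npoints I])
       (Node (enc_list enc_rat (radii I)) (enc_list enc_nat (mults I)))"

text \<open>
  An output consists of the optimal dilation as a fraction \<open>a / b\<close>, not necessarily in lowest terms,
  and the list of the clusters of an optimal clustering, in any order.
\<close>

definition is_solution :: "instance_data \<Rightarrow> tree \<Rightarrow> bool" where
  "is_solution I out \<longleftrightarrow>
     (\<exists>a b css.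
        out = Node (Node (enc_nat a) (enc_nat b)) (enc_list (enc_list enc_nat) css) \<and>
        b > 0 \<and> optimal_dilation (pts I) (dst I) (rds I) (mults I) (real a / real b) \<and>
        distinct (map set css) \<and> (\<forall>cs \<in> set css. distinct cs) \<and>
        optimal_clustering (pts I) (dst I) (rds I) (mults I) (set ` set css))"

text \<open>
  Polynomial-time solvability, for instances with \<open>t\<close> radii classes, under the promise that the
  instance lies in \<open>S\<close>: the algorithm halts in polynomial time on all instances, and its output
  is correct on those in \<open>S\<close>.
\<close>

definition poly_time_solvable :: "nat \<Rightarrow> instance_data set \<Rightarrow> bool" where
  "poly_time_solvable t S \<longleftrightarrow>
     (\<exists>(prog :: expr list) (p :: nat poly). \<forall>I. nukc_instance t I \<longrightarrow>
        (\<exists>out n. runs prog (enc_instance I) out n \<and> n \<le> poly p (size (enc_instance I)) \<and>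
                 (I \<in> S \<longrightarrow> is_solution I out)))"

end

theory Submission
  imports Defs
begin

text \<open>
  Let \<open>\<alpha>\<close> be the optimal dilation. In a resilient instance some optimal clustering can be labelled
  by radius classes so that a cluster of class \<open>i\<close> lies in a ball of radius \<open>\<alpha> r\<^sub>i\<close> and is at distance
  more than \<open>\<alpha> r\<^sub>i\<close> from all other points; so it is a connected component of the graph in which
  points at distance at most \<open>\<alpha> r\<^sub>i\<close> are adjacent. Indeed, take a violation \<open>d x y \<le> \<alpha> r\<^sub>i\<close>
  with \<open>r\<^sub>i\<close> largest, over all labellings. In the case of factor \<open>2\<close>, shorten the distance from the
  center of the cluster of \<open>x\<close> to \<open>y\<close> to \<open>\<alpha> r\<^sub>i\<close>, so that \<open>y\<close> may change its cluster; in the case of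
  factor \<open>3\<close>, shorten the distances of \<open>x\<close> to all points of the two clusters, so that they merge and
  the free ball can cover a singleton cluster. As the violation is a largest one, the optimal
  dilation does not change, which contradicts resilience.

  The components of all classes form a laminar family, and a dynamic program over this tree,
  whose states are the numbers of clusters used in each class, decides whether the components
  contain a clustering of dilation \<open>\<alpha>\<close>. There are at most \<open>(n + 1)\<^sup>t\<close> states. The algorithm runs
  it for all candidates \<open>d p q / r\<^sub>i\<close> for \<open>\<alpha>\<close> and takes the least successful one. Since every
  solution found is feasible, it is optimal as soon as \<open>\<alpha>\<close> itself is successful.

  Its running time is bounded by closure properties of the functions that are computable in
  polynomial time with respect to given encodings of their arguments and values.
\<close>

section \<open>Polynomial-time functions\<close>

text \<open>An induced clustering may have two clusters in the same ball, so it need not determine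
  classes for its clusters. A first use of resilience excludes this: clusters that share a ball can
  be regrouped freely, which gives a second optimal clustering (if some cluster has two points), or
  one with a singleton cluster. Only then can placements be replaced by labellings. Shortened
  distances might lower the optimal dilation, and then every ball changes its meaning. The choice of
  a largest violating radius \<rho> is made for this obstacle: a path through a shortened edge has
  length at least \<rho>, too long for the balls of that radius and below at a smaller dilation,
  while clusters of larger radius are too well separated for such a path to start in them. Labels
  may still be permuted at a smaller dilation; this is why violations are compared over all
  labellings and not for a fixed one. On the side of complexity, a tree with shared subtrees can be
  exponentially larger than the time spent on it, so each closure property carries a bound on the
  size of the value besides the one on the time.\<close>

fun shift :: "nat \<Rightarrow> expr \<Rightarrow> expr" where
  "shift k Inp = Inp"
| "shift k Nl = Nl"
| "shift k (Cns a b) = Cns (shift k a) (shift k b)"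
| "shift k (Hd a) = Hd (shift k a)"
| "shift k (Tl a) = Tl (shift k a)"
| "shift k (Ifn a b c) = Ifn (shift k a) (shift k b) (shift k c)"
| "shift k (Bind a b) = Bind (shift k a) (shift k b)"
| "shift k (Call f a) = Call (k + f) (shift k a)"

lemmas eval_rules = eval.intros[simplified]

text \<open>Calls address functions by absolute position, so code can stand behind a prefix only
  after all its call targets have been moved by the length of the prefix.\<close>

lemma eval_shift:
  "eval prog e x v n \<Longrightarrow> eval (pre @ map (shift (length pre)) prog) (shift (length pre) e) x v n"
proof (induction rule: eval.induct)
  case (Call e x v n1 f w n2)
  then have "(pre @ map (shift (length pre)) prog) ! (length pre + f) = shift (length pre) (prog ! f)"
    by (simp add: nth_append)
  with Call show ?case by (auto intro!: eval_rules)
qed (auto intro: eval_rules)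

lemma eval_append: "eval prog e x v n \<Longrightarrow> eval (prog @ post) e x v n"
proof (induction rule: eval.induct)
  case (Call e x v n1 f w n2)
  then have "(prog @ post) ! f = prog ! f" by (simp add: nth_append)
  with Call show ?case by (auto intro!: eval_rules)
qed (auto intro: eval_rules)

lemma poly_nat_mono: "x \<le> y \<Longrightarrow> poly p x \<le> poly (p :: nat poly) y"
  by (induction p) (auto intro!: add_mono mult_mono)

text \<open>The size of the value does not follow from the time: a repeated
  \<open>Bind (Cns Inp Inp)\<close> doubles a tree at constant cost per step. Encodings of argument
  and value are parameters, so that functions on mathematical objects can be composed without
  mentioning trees.\<close>

definition computes ::
  "expr list \<Rightarrow> expr \<Rightarrow> nat poly \<Rightarrow> 'x set \<Rightarrow> ('x \<Rightarrow> tree) \<Rightarrow> ('a \<Rightarrow> tree) \<Rightarrow> ('x \<Rightarrow> 'a) \<Rightarrow> bool"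
  where
  "computes prog ex p D e a f \<longleftrightarrow>
     (\<forall>x\<in>D. size (a (f x)) \<le> poly p (size (e x)) \<and>
        (\<exists>n\<le>poly p (size (e x)). eval prog ex (e x) (a (f x)) n))"

definition ptime :: "'x set \<Rightarrow> ('x \<Rightarrow> tree) \<Rightarrow> ('a \<Rightarrow> tree) \<Rightarrow> ('x \<Rightarrow> 'a) \<Rightarrow> bool" where
  "ptime D e a f \<longleftrightarrow> (\<exists>prog ex p. computes prog ex p D e a f)"

lemma ptimeI: "computes prog ex p D e a f \<Longrightarrow> ptime D e a f"
  by (auto simp: ptime_def)

lemma computes_append: "computes P ex p D e a f \<Longrightarrow> computes (P @ Q) ex p D e a f"
  unfolding computes_def by (meson eval_append)

text \<open>Relocates the code of a function behind an arbitrary \<open>P\<close>. With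
  \<open>computes_append\<close> this brings several functions into one program, which is the
  pattern of all combinators below.\<close>

lemma computes_link:
  assumes "ptime D e a f"
  obtains Q ex p where "computes (P @ Q) ex p D e a f"
proof -
  from assms obtain Q ex p where "computes Q ex p D e a f"
    by (auto simp: ptime_def)
  then have "computes (P @ map (shift (length P)) Q) (shift (length P) ex) p D e a f"
    unfolding computes_def by (meson eval_shift)
  then show ?thesis by (rule that)
qed

definition ebool :: "bool \<Rightarrow> tree" where
  "ebool b = (if b then Node Leaf Leaf else Leaf)"

definition epair :: "('a \<Rightarrow> tree) \<Rightarrow> ('b \<Rightarrow> tree) \<Rightarrow> 'a \<times> 'b \<Rightarrow> tree" where
  "epair a b p = Node (a (fst p)) (b (snd p))"

lemma epair_simp [simp]: "epair a b (x, y) = Node (a x) (b y)"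
  by (simp add: epair_def)

lemma size_epair [simp]: "size (epair a b p) = size (a (fst p)) + size (b (snd p)) + 1"
  by (simp add: epair_def)

lemma ptime_subset: "ptime E e a f \<Longrightarrow> D \<subseteq> E \<Longrightarrow> ptime D e a f"
  unfolding ptime_def computes_def by blast

lemma ptime_UNIV: "ptime UNIV e a f \<Longrightarrow> ptime D e a f"
  by (rule ptime_subset) auto

lemma ptime_cong:
  "ptime D e a f \<Longrightarrow> (\<And>x. x \<in> D \<Longrightarrow> e' x = e x) \<Longrightarrow> (\<And>x. x \<in> D \<Longrightarrow> b (g x) = a (f x)) \<Longrightarrow> ptime D e' b g"
  unfolding ptime_def computes_def by simp

lemma ptime_id: "ptime D e e (\<lambda>x. x)"
  by (rule ptimeI[of "[]" Inp "[:1, 1:]"]) (auto simp: computes_def intro!: exI[of _ 1] eval_rules)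

fun tree_expr :: "tree \<Rightarrow> expr" where
  "tree_expr Leaf = Nl"
| "tree_expr (Node l r) = Cns (tree_expr l) (tree_expr r)"

text \<open>The cost has to be independent of the argument to serve as a constant
  polynomial.\<close>

lemma eval_tree_expr_uniform: "\<exists>n. \<forall>x prog. eval prog (tree_expr c) x c n"
proof (induction c)
  case (Node l r)
  then obtain n1 n2 where "\<forall>x prog. eval prog (tree_expr l) x l n1" "\<forall>x prog. eval prog (tree_expr r) x r n2"
    by blast
  then show ?case by (intro exI[of _ "n1 + n2 + 1"]) (auto intro: eval_rules)
qed (auto intro: eval_rules)

lemma ptime_const: "ptime D e a (\<lambda>x. c)"
proof -
  obtain n where n: "\<And>x prog. eval prog (tree_expr (a c)) x (a c) n"
    using eval_tree_expr_uniform by blast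
  show ?thesis
    by (rule ptimeI[of "[]" "tree_expr (a c)" "[:n + size (a c):]"])
      (auto simp: computes_def intro!: exI[of _ n] n)
qed

lemma ptime_unop:
  assumes "ptime D e a f"
    and "\<And>prog ex x v n. eval prog ex x v n \<Longrightarrow> eval prog (op ex) x (F v) (n + 1)"
    and "\<And>v. size (F v) \<le> size v"
    and "\<And>x. x \<in> D \<Longrightarrow> b (g x) = F (a (f x))"
  shows "ptime D e b g"
proof -
  obtain P ex p where c: "computes P ex p D e a f" using assms(1) by (auto simp: ptime_def)
  show ?thesis
  proof (rule ptimeI[of P "op ex" "p + 1"], unfold computes_def, intro ballI conjI)
    fix x assume x: "x \<in> D"
    with c show "size (b (g x)) \<le> poly (p + 1) (size (e x))"
      using assms(3)[of "a (f x)"] assms(4)[OF x] by (fastforce simp: computes_def)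
    from c x obtain n where "n \<le> poly p (size (e x))" "eval P ex (e x) (a (f x)) n"
      by (auto simp: computes_def)
    then show "\<exists>n\<le>poly (p + 1) (size (e x)). eval P (op ex) (e x) (b (g x)) n"
      using assms(2) assms(4)[OF x] by (intro exI[of _ "n + 1"]) auto
  qed
qed

lemma size_left: "size (left v) \<le> size v" and size_right: "size (right v) \<le> size v"
  by (cases v; simp)+

lemma ptime_left:
  "ptime D e a f \<Longrightarrow> (\<And>x. x \<in> D \<Longrightarrow> b (g x) = left (a (f x))) \<Longrightarrow> ptime D e b g"
  by (rule ptime_unop[where op = Hd and F = left and a = a and f = f]) (auto intro: eval_rules size_left)

lemma ptime_right:
  "ptime D e a f \<Longrightarrow> (\<And>x. x \<in> D \<Longrightarrow> b (g x) = right (a (f x))) \<Longrightarrow> ptime D e b g"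
  by (rule ptime_unop[where op = Tl and F = right and a = a and f = f]) (auto intro: eval_rules size_right)

lemma ptime_fst: "ptime D e (epair a b) f \<Longrightarrow> ptime D e a (\<lambda>x. fst (f x))"
  by (erule ptime_left) (simp add: epair_def)

lemma ptime_snd: "ptime D e (epair a b) f \<Longrightarrow> ptime D e b (\<lambda>x. snd (f x))"
  by (erule ptime_right) (simp add: epair_def)

lemma ptime_node:
  assumes "ptime D e a f" "ptime D e b g" "\<And>x. x \<in> D \<Longrightarrow> c (h x) = Node (a (f x)) (b (g x))"
  shows "ptime D e c h"
proof -
  obtain P e1 p where "computes P e1 p D e a f" using assms(1) by (auto simp: ptime_def)
  moreover obtain Q e2 q where 2: "computes (P @ Q) e2 q D e b g"
    using assms(2) by (rule computes_link)
  ultimately have 1: "computes (P @ Q) e1 p D e a f" by (simp add: computes_append)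
  show ?thesis
  proof (rule ptimeI[of "P @ Q" "Cns e1 e2" "p + q + 1"], unfold computes_def, intro ballI conjI)
    fix x assume x: "x \<in> D"
    then show "size (c (h x)) \<le> poly (p + q + 1) (size (e x))"
      using 1 2 assms(3)[OF x] by (fastforce simp: computes_def)
    obtain n where n: "n \<le> poly p (size (e x))" "eval (P @ Q) e1 (e x) (a (f x)) n"
      using 1 x by (auto simp: computes_def)
    obtain m where m: "m \<le> poly q (size (e x))" "eval (P @ Q) e2 (e x) (b (g x)) m"
      using 2 x by (auto simp: computes_def)
    show "\<exists>n\<le>poly (p + q + 1) (size (e x)). eval (P @ Q) (Cns e1 e2) (e x) (c (h x)) n"
      using n m assms(3)[OF x] by (intro exI[of _ "n + m + 1"]) (auto intro: eval_rules)
  qed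
qed

lemma ptime_pair:
  "ptime D e a f \<Longrightarrow> ptime D e b g \<Longrightarrow> ptime D e (epair a b) (\<lambda>x. (f x, g x))"
  by (rule ptime_node[where a = a and f = f and b = b and g = g]) auto

lemma ptime_comp:
  assumes "ptime D e a f" "ptime E a b g" "\<And>x. x \<in> D \<Longrightarrow> f x \<in> E"
  shows "ptime D e b (\<lambda>x. g (f x))"
proof -
  obtain P e1 p where "computes P e1 p D e a f" using assms(1) by (auto simp: ptime_def)
  moreover obtain Q e2 q where 2: "computes (P @ Q) e2 q E a b g"
    using assms(2) by (rule computes_link)
  ultimately have 1: "computes (P @ Q) e1 p D e a f" by (simp add: computes_append)
  let ?r = "pcompose q p"
  show ?thesis
  proof (rule ptimeI[of "P @ Q" "Bind e1 e2" "p + ?r + 1"], unfold computes_def, intro ballI conjI)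
    fix x assume x: "x \<in> D"
    have le: "poly q (size (a (f x))) \<le> poly ?r (size (e x))"
      using 1 x by (auto simp: computes_def poly_pcompose intro: poly_nat_mono)
    have "size (b (g (f x))) \<le> poly q (size (a (f x)))"
      using 2 assms(3)[OF x] by (auto simp: computes_def)
    with le show "size (b (g (f x))) \<le> poly (p + ?r + 1) (size (e x))" by simp
    obtain n where n: "n \<le> poly p (size (e x))" "eval (P @ Q) e1 (e x) (a (f x)) n"
      using 1 x by (auto simp: computes_def)
    obtain m where m: "m \<le> poly q (size (a (f x)))" "eval (P @ Q) e2 (a (f x)) (b (g (f x))) m"
      using 2 assms(3)[OF x] by (auto simp: computes_def)
    show "\<exists>n\<le>poly (p + ?r + 1) (size (e x)). eval (P @ Q) (Bind e1 e2) (e x) (b (g (f x))) n"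
      using n m le by (intro exI[of _ "n + m + 1"]) (auto intro: eval_rules)
  qed
qed

text \<open>Each branch is required only on the arguments that reach it. This is what lets partial
  operations such as \<open>hd\<close> be used behind a test.\<close>

lemma ptime_if:
  assumes "ptime D e ebool B" "ptime {x \<in> D. B x} e a f" "ptime {x \<in> D. \<not> B x} e a g"
  shows "ptime D e a (\<lambda>x. if B x then f x else g x)"
proof -
  obtain P1 e1 p1 where "computes P1 e1 p1 D e ebool B" using assms(1) by (auto simp: ptime_def)
  moreover obtain P2 e2 p2 where "computes (P1 @ P2) e2 p2 {x \<in> D. B x} e a f"
    using assms(2) by (rule computes_link)
  moreover obtain P3 e3 p3 where 3: "computes ((P1 @ P2) @ P3) e3 p3 {x \<in> D. \<not> B x} e a g"
    using assms(3) by (rule computes_link)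
  ultimately have 1: "computes ((P1 @ P2) @ P3) e1 p1 D e ebool B"
    and 2: "computes ((P1 @ P2) @ P3) e2 p2 {x \<in> D. B x} e a f"
    by (simp_all add: computes_append del: append_assoc)
  let ?P = "(P1 @ P2) @ P3"
  show ?thesis
  proof (rule ptimeI[of ?P "Ifn e1 e2 e3" "p1 + p2 + p3 + 1"], unfold computes_def, intro ballI)
    fix x assume x: "x \<in> D"
    obtain n where n: "n \<le> poly p1 (size (e x))" "eval ?P e1 (e x) (ebool (B x)) n"
      using 1 x unfolding computes_def by blast
    show "size (a (if B x then f x else g x)) \<le> poly (p1 + p2 + p3 + 1) (size (e x)) \<and>
      (\<exists>n\<le>poly (p1 + p2 + p3 + 1) (size (e x)).
         eval ?P (Ifn e1 e2 e3) (e x) (a (if B x then f x else g x)) n)"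
    proof (cases "B x")
      case True
      with 2 x obtain m where m: "size (a (f x)) \<le> poly p2 (size (e x))"
        "m \<le> poly p2 (size (e x))" "eval ?P e2 (e x) (a (f x)) m"
        unfolding computes_def by blast
      have "eval ?P (Ifn e1 e2 e3) (e x) (a (f x)) (n + m + 1)"
        using n m True by (intro eval.IfNode[where v = "ebool True"]) (auto simp: ebool_def)
      then show ?thesis using n m True by (auto intro!: exI[of _ "n + m + 1"])
    next
      case False
      with 3 x obtain m where m: "size (a (g x)) \<le> poly p3 (size (e x))"
        "m \<le> poly p3 (size (e x))" "eval ?P e3 (e x) (a (g x)) m"
        unfolding computes_def by blast
      have "eval ?P (Ifn e1 e2 e3) (e x) (a (g x)) (n + m + 1)"
        using n m False by (intro eval.IfLeaf) (auto simp: ebool_def)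
      then show ?thesis using n m False by (auto intro!: exI[of _ "n + m + 1"])
    qed
  qed
qed

text \<open>Linear recursion: \<open>s\<close> prepares the argument of the recursive call and
  \<open>c\<close> combines its result with the argument. The measure \<mu> bounds the depth. As
  arguments do not grow along \<open>s\<close>, every level costs at most a fixed polynomial in the
  size of the first argument. The bound \<open>q\<close> on the values must be known beforehand,
  since iterating a polynomial growth could give exponential sizes.\<close>

lemma ptime_rec:
  assumes B: "ptime D e ebool B"
    and h: "ptime {x \<in> D. B x} e a h"
    and s: "ptime {x \<in> D. \<not> B x} e e s"
    and c: "ptime {(x, y). x \<in> D \<and> \<not> B x \<and> y = f (s x)} (epair e a) a c"
    and f: "\<And>x. x \<in> D \<Longrightarrow> f x = (if B x then h x else c (x, f (s x)))"
    and step: "\<And>x. x \<in> D \<Longrightarrow> \<not> B x \<Longrightarrow>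
        s x \<in> D \<and> \<mu> (s x) < (\<mu> x :: nat) \<and> size (e (s x)) \<le> size (e x)"
    and mu: "\<And>x. x \<in> D \<Longrightarrow> \<mu> x \<le> poly r (size (e x))"
    and size: "\<And>x. x \<in> D \<Longrightarrow> size (a (f x)) \<le> poly q (size (e x))"
  shows "ptime D e a f"
proof -
  obtain P1 e1 p1 where "computes P1 e1 p1 D e ebool B" using B by (auto simp: ptime_def)
  moreover obtain P2 e2 p2 where "computes (P1 @ P2) e2 p2 {x \<in> D. B x} e a h"
    using h by (rule computes_link)
  moreover obtain P3 e3 p3 where "computes ((P1 @ P2) @ P3) e3 p3 {x \<in> D. \<not> B x} e e s"
    using s by (rule computes_link)
  moreover obtain P4 e4 p4 where "computes (((P1 @ P2) @ P3) @ P4) e4 p4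
      {(x, y). x \<in> D \<and> \<not> B x \<and> y = f (s x)} (epair e a) a c"
    using c by (rule computes_link)
  moreover define Q where "Q = ((P1 @ P2) @ P3) @ P4"
  \<comment> \<open>\<open>body\<close> is stored behind \<open>Q\<close>, at index
    \<open>length Q\<close>, so the call in it is the recursive one; \<open>Bind\<close> passes the
    pair of the argument and the recursive value to \<open>e4\<close>.\<close>
  moreover define body where
    "body = Ifn e1 e2 (Bind (Cns Inp (Call (length Q) e3)) e4)"
  moreover define P where "P = Q @ [body]"
  ultimately have 1: "computes P e1 p1 D e ebool B"
    and 2: "computes P e2 p2 {x \<in> D. B x} e a h"
    and 3: "computes P e3 p3 {x \<in> D. \<not> B x} e e s"
    and 4: "computes P e4 p4 {(x, y). x \<in> D \<and> \<not> B x \<and> y = f (s x)} (epair e a) a c"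
    by (simp_all add: computes_append del: append_assoc)
  have call: "length Q < length P" "P ! length Q = body"
    by (simp_all add: P_def)
  \<comment> \<open>The cost of one level. The input of \<open>e4\<close> is a pair, of size at most
    \<open>N + poly q N + 1\<close>; the constant covers the unit costs of the constructors in
    \<open>body\<close>.\<close>
  define K where "K = p1 + p2 + p3 + pcompose p4 ([:1, 1:] + q) + [:6:]"
  have K: "poly K N = poly p1 N + poly p2 N + poly p3 N + poly p4 (N + poly q N + 1) + 6" for N
    by (simp add: K_def poly_pcompose algebra_simps)
  \<comment> \<open>\<open>N\<close> stays fixed while the argument changes, so that the cost of a
    level is the same number throughout the induction.\<close>
  have main: "x \<in> D \<Longrightarrow> size (e x) \<le> N \<Longrightarrow>
      \<exists>n \<le> (\<mu> x + 1) * poly K N. eval P body (e x) (a (f x)) n" for x N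
  proof (induction "\<mu> x" arbitrary: x rule: less_induct)
    case less
    obtain n where n: "n \<le> poly p1 (size (e x))" "eval P e1 (e x) (ebool (B x)) n"
      using 1 less.prems unfolding computes_def by blast
    have n1: "n \<le> poly p1 N" using n(1) poly_nat_mono[OF less.prems(2), of p1] by simp
    show ?case
    proof (cases "B x")
      case True
      with 2 less.prems obtain m where m: "m \<le> poly p2 (size (e x))" "eval P e2 (e x) (a (h x)) m"
        unfolding computes_def by blast
      have m1: "m \<le> poly p2 N" using m(1) poly_nat_mono[OF less.prems(2), of p2] by simp
      have "eval P body (e x) (a (h x)) (n + m + 1)"
        unfolding body_def using n m True
        by (intro eval.IfNode[where v = "ebool True"]) (auto simp: ebool_def)
      moreover have "n + m + 1 \<le> (\<mu> x + 1) * poly K N" using n1 m1 K[of N] by simp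
      ultimately show ?thesis using f[OF less.prems(1)] True by auto
    next
      case False
      obtain m where m: "m \<le> poly p3 (size (e x))" "eval P e3 (e x) (e (s x)) m"
        using 3 less.prems False unfolding computes_def by blast
      have m1: "m \<le> poly p3 N" using m(1) poly_nat_mono[OF less.prems(2), of p3] by simp
      note st = step[OF less.prems(1) False]
      obtain l where l: "l \<le> (\<mu> (s x) + 1) * poly K N" "eval P body (e (s x)) (a (f (s x))) l"
        using less.hyps[of "s x"] st less.prems by (meson le_trans)
      have rec: "eval P (Call (length Q) e3) (e x) (a (f (s x))) (m + l + 1)"
        by (rule eval.Call[OF m(2) call(1)]) (use l(2) call(2) in simp)
      have arg: "eval P (Cns Inp (Call (length Q) e3)) (e x) (epair e a (x, f (s x))) (1 + (m + l + 1) + 1)"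
        unfolding epair_simp by (rule eval.Cns[OF eval.Inp rec])
      have "(x, f (s x)) \<in> {(x, y). x \<in> D \<and> \<not> B x \<and> y = f (s x)}"
        using less.prems False by simp
      then obtain k where k: "k \<le> poly p4 (size (epair e a (x, f (s x))))"
        "eval P e4 (epair e a (x, f (s x))) (a (c (x, f (s x)))) k"
        using 4 unfolding computes_def by blast
      have "size (a (f (s x))) \<le> poly q (size (e (s x)))" using size st by blast
      also have "\<dots> \<le> poly q N" using st less.prems by (intro poly_nat_mono) simp
      finally have "size (epair e a (x, f (s x))) \<le> N + poly q N + 1"
        using less.prems by simp
      with k have k1: "k \<le> poly p4 (N + poly q N + 1)"
        by (meson le_trans poly_nat_mono)
      have "eval P body (e x) (a (f x)) (n + ((1 + (m + l + 1) + 1) + k + 1) + 1)"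
      proof -
        have "eval P e1 (e x) Leaf n" using n False by (simp add: ebool_def)
        from eval.IfLeaf[OF this eval.Bind[OF arg k(2)]]
        show ?thesis unfolding body_def f[OF less.prems(1)] using False by simp
      qed
      moreover have "n + ((1 + (m + l + 1) + 1) + k + 1) + 1 \<le> (\<mu> (s x) + 1) * poly K N + poly K N"
        using n1 m1 k1 l(1) K[of N] by simp
      moreover have "(\<mu> (s x) + 1) * poly K N + poly K N = (\<mu> (s x) + 2) * poly K N"
        by simp
      moreover have "(\<mu> (s x) + 2) * poly K N \<le> (\<mu> x + 1) * poly K N"
        using st by (intro mult_right_mono) auto
      ultimately show ?thesis
        by (intro exI[of _ "n + ((1 + (m + l + 1) + 1) + k + 1) + 1"] conjI) linarith+
    qed
  qed
  show ?thesis
  proof (rule ptimeI[of P body "(r + 1) * K + q"], unfold computes_def, intro ballI conjI)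
    fix x assume x: "x \<in> D"
    show "size (a (f x)) \<le> poly ((r + 1) * K + q) (size (e x))"
      using size[OF x] by (simp add: trans_le_add2)
    obtain n where n: "n \<le> (\<mu> x + 1) * poly K (size (e x))" "eval P body (e x) (a (f x)) n"
      using main[OF x order.refl] by blast
    have "(\<mu> x + 1) * poly K (size (e x)) \<le> (poly r (size (e x)) + 1) * poly K (size (e x))"
      using mu[OF x] by (intro mult_right_mono) auto
    with n have "n \<le> poly ((r + 1) * K + q) (size (e x))"
      unfolding poly_add poly_mult poly_1 by linarith
    with n show "\<exists>n\<le>poly ((r + 1) * K + q) (size (e x)). eval P body (e x) (a (f x)) n"
      by blast
  qed
qed

lemmas ptime_acc = ptime_fst ptime_snd ptime_id

lemma ptime_not:
  assumes "ptime D e ebool P" shows "ptime D e ebool (\<lambda>x. \<not> P x)"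
proof -
  have "ptime D e ebool (\<lambda>x. if P x then False else True)"
    by (intro ptime_if ptime_const assms)
  then show ?thesis by (rule ptime_cong) auto
qed

lemma ptime_conj:
  assumes "ptime D e ebool P" "ptime {x \<in> D. P x} e ebool Q"
  shows "ptime D e ebool (\<lambda>x. P x \<and> Q x)"
proof -
  have "ptime D e ebool (\<lambda>x. if P x then Q x else False)"
    by (intro ptime_if ptime_const assms)
  then show ?thesis by (rule ptime_cong) auto
qed

lemma ptime_disj:
  assumes "ptime D e ebool P" "ptime {x \<in> D. \<not> P x} e ebool Q"
  shows "ptime D e ebool (\<lambda>x. P x \<or> Q x)"
proof -
  have "ptime D e ebool (\<lambda>x. if P x then True else Q x)"
    by (intro ptime_if ptime_const assms)
  then show ?thesis by (rule ptime_cong) auto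
qed

lemma ptime_size:
  assumes "ptime D e a f"
  obtains p where "\<And>x. x \<in> D \<Longrightarrow> size (a (f x)) \<le> poly p (size (e x))"
  using assms unfolding ptime_def computes_def by blast

lemma ptime_nonleaf:
  assumes "ptime D e a f" "\<And>x. x \<in> D \<Longrightarrow> P x \<longleftrightarrow> a (f x) \<noteq> Leaf"
  shows "ptime D e ebool P"
proof -
  let ?t = "\<lambda>t :: tree. t"
  obtain prog ex p where c: "computes prog ex p D e a f"
    using assms(1) unfolding ptime_def by blast
  show ?thesis
  proof (rule ptimeI[of prog "Ifn ex (Cns Nl Nl) Nl" "p + [:4:]"], unfold computes_def, intro ballI conjI)
    fix x assume x: "x \<in> D"
    then obtain n where n: "n \<le> poly p (size (e x))" "eval prog ex (e x) (a (f x)) n"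
      using c unfolding computes_def by blast
    show "size (ebool (P x)) \<le> poly (p + [:4:]) (size (e x))" by (simp add: ebool_def)
    show "\<exists>n\<le>poly (p + [:4:]) (size (e x)). eval prog (Ifn ex (Cns Nl Nl) Nl) (e x) (ebool (P x)) n"
    proof (cases "P x")
      case True
      have "eval prog (Ifn ex (Cns Nl Nl) Nl) (e x) (Node Leaf Leaf) (n + (1 + 1 + 1) + 1)"
        using n True assms(2)[OF x]
        by (intro eval.IfNode[OF n(2)] eval.Cns eval.Nl) auto
      with n True show ?thesis by (intro exI[of _ "n + (1 + 1 + 1) + 1"]) (auto simp: ebool_def)
    next
      case False
      then have "a (f x) = Leaf" using assms(2)[OF x] by simp
      then have "eval prog (Ifn ex (Cns Nl Nl) Nl) (e x) Leaf (n + 1 + 1)"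
        using n by (intro eval.IfLeaf eval.Nl) auto
      with n False show ?thesis by (intro exI[of _ "n + 1 + 1"]) (auto simp: ebool_def)
    qed
  qed
qed

section \<open>Lists\<close>

lemma ptime_Cons: "ptime D e a f \<Longrightarrow> ptime D e (enc_list a) g \<Longrightarrow> ptime D e (enc_list a) (\<lambda>x. f x # g x)"
  by (rule ptime_node[where a = a and f = f and b = "enc_list a" and g = g]) auto

lemma ptime_tl: "ptime D e (enc_list a) f \<Longrightarrow> ptime D e (enc_list a) (\<lambda>x. tl (f x))"
  by (erule ptime_right) (case_tac "f x"; simp)

lemma ptime_hd:
  "ptime D e (enc_list a) f \<Longrightarrow> (\<And>x. x \<in> D \<Longrightarrow> f x \<noteq> []) \<Longrightarrow> ptime D e a (\<lambda>x. hd (f x))"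
  by (erule ptime_left) (case_tac "f x"; simp)

lemma ptime_null:
  assumes "ptime D e (enc_list a) f" shows "ptime D e ebool (\<lambda>x. f x = [])"
proof -
  have "xs \<noteq> [] \<longleftrightarrow> enc_list a xs \<noteq> Leaf" for xs by (cases xs) auto
  then have "ptime D e ebool (\<lambda>x. f x \<noteq> [])" by (intro ptime_nonleaf[OF assms])
  from ptime_not[OF this] show ?thesis by simp
qed

lemma length_le_size_enc_list: "length l \<le> size (enc_list a l)"
  by (induction l) auto

lemma size_enc_list: "size (enc_list a l) = (\<Sum>y\<leftarrow>l. size (a y) + 1)"
  by (induction l) auto

lemma size_enc_list_append: "size (enc_list a (l @ m)) = size (enc_list a l) + size (enc_list a m)"
  by (simp add: size_enc_list)

lemma size_in_enc_list: "y \<in> set l \<Longrightarrow> size (a y) < size (enc_list a l)"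
  by (induction l) (auto simp: less_Suc_eq_le trans_le_add1 trans_le_add2)

text \<open>Only states that occur, namely the folds over suffixes of the list, need a size bound
  and must lie in the domain \<open>E\<close> of the step function. Hence the step may rely on an
  invariant of its state.\<close>

lemma ptime_foldr:
  assumes l: "ptime D e (enc_list a) l" and i: "ptime D e s i"
    and g: "ptime E (epair a (epair s e)) s (\<lambda>p. g (fst p) (fst (snd p)) (snd (snd p)))"
    and E: "\<And>x y ys zs. x \<in> D \<Longrightarrow> l x = ys @ y # zs \<Longrightarrow>
        (y, foldr (\<lambda>y st. g y st x) zs (i x), x) \<in> E"
    and size: "\<And>x ys zs. x \<in> D \<Longrightarrow> l x = ys @ zs \<Longrightarrow>
        size (s (foldr (\<lambda>y st. g y st x) zs (i x))) \<le> poly q (size (e x))"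
  shows "ptime D e s (\<lambda>x. foldr (\<lambda>y st. g y st x) (l x) (i x))"
proof -
  let ?e = "epair (enc_list a) e"
  define f where "f p = foldr (\<lambda>y st. g y st (snd p)) (fst p) (i (snd p))" for p
  \<comment> \<open>The recursion carries the remaining suffix together with the parameter.\<close>
  define D' where "D' = {p. snd p \<in> D \<and> (\<exists>ys. l (snd p) = ys @ fst p)}"
  have "ptime D' ?e s f"
  proof (rule ptime_rec[where B = "\<lambda>p. fst p = []" and h = "\<lambda>p. i (snd p)"
        and s = "\<lambda>p. (tl (fst p), snd p)" and \<mu> = "\<lambda>p. length (fst p)"
        and c = "\<lambda>q. g (hd (fst (fst q))) (snd q) (snd (fst q))" and q = q and r = "[:0, 1:]"])
    show "ptime D' ?e ebool (\<lambda>p. fst p = [])"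
      by (intro ptime_null; (rule ptime_acc)+)
    show "ptime {p \<in> D'. fst p = []} ?e s (\<lambda>p. i (snd p))"
      by (rule ptime_comp[OF ptime_snd[OF ptime_id] i]) (auto simp: D'_def)
    show "ptime {p \<in> D'. fst p \<noteq> []} ?e ?e (\<lambda>p. (tl (fst p), snd p))"
      by (intro ptime_pair ptime_tl; (rule ptime_acc)+)
    have "ptime {(x, y). x \<in> D' \<and> fst x \<noteq> [] \<and> y = f (tl (fst x), snd x)} (epair ?e s)
        (epair a (epair s e)) (\<lambda>q. (hd (fst (fst q)), snd q, snd (fst q)))"
      by (intro ptime_pair ptime_hd; ((rule ptime_acc)+ | auto))
    then have "ptime {(x, y). x \<in> D' \<and> fst x \<noteq> [] \<and> y = f (tl (fst x), snd x)} (epair ?e s) s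
        (\<lambda>x. (\<lambda>p. g (fst p) (fst (snd p)) (snd (snd p))) ((\<lambda>q. (hd (fst (fst q)), snd q, snd (fst q))) x))"
      by (rule ptime_comp[OF _ g]) (auto simp: D'_def f_def neq_Nil_conv intro: E)
    then show "ptime {(x, y). x \<in> D' \<and> fst x \<noteq> [] \<and> y = f (tl (fst x), snd x)} (epair ?e s) s
        (\<lambda>q. g (hd (fst (fst q))) (snd q) (snd (fst q)))"
      by simp
    fix p assume p: "p \<in> D'"
    show "f p = (if fst p = [] then i (snd p)
        else g (hd (fst (fst (p, f (tl (fst p), snd p))))) (snd (p, f (tl (fst p), snd p)))
          (snd (fst (p, f (tl (fst p), snd p)))))"
      by (cases "fst p") (auto simp: f_def)
    show "length (fst p) \<le> poly [:0, 1:] (size (?e p))"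
      using length_le_size_enc_list[of "fst p" a] by simp
    have "size (s (f p)) \<le> poly q (size (e (snd p)))"
      using p size by (auto simp: D'_def f_def)
    also have "\<dots> \<le> poly q (size (?e p))" by (intro poly_nat_mono) simp
    finally show "size (s (f p)) \<le> poly q (size (?e p))" .
    assume "fst p \<noteq> []"
    with p show "(tl (fst p), snd p) \<in> D' \<and> length (fst (tl (fst p), snd p)) < length (fst p) \<and>
       size (?e (tl (fst p), snd p)) \<le> size (?e p)"
      by (auto simp: D'_def neq_Nil_conv)
  qed
  from ptime_comp[OF ptime_pair[OF l ptime_id] this] show ?thesis
    by (simp add: f_def D'_def)
qed

text \<open>Additive growth per step, by an amount that depends on the parameter alone, sums up to a
  polynomial over the whole list.\<close>

lemma ptime_foldr_growth:
  assumes l: "ptime D e (enc_list a) l" and i: "ptime D e s i"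
    and g: "ptime UNIV (epair a (epair s e)) s (\<lambda>p. g (fst p) (fst (snd p)) (snd (snd p)))"
    and growth: "\<And>x y st. x \<in> D \<Longrightarrow> y \<in> set (l x) \<Longrightarrow> size (s (g y st x)) \<le> size (s st) + poly r (size (e x))"
  shows "ptime D e s (\<lambda>x. foldr (\<lambda>y st. g y st x) (l x) (i x))"
proof -
  obtain p where p: "\<And>x. x \<in> D \<Longrightarrow> size (enc_list a (l x)) \<le> poly p (size (e x))"
    using l by (rule ptime_size) blast
  obtain q where q: "\<And>x. x \<in> D \<Longrightarrow> size (s (i x)) \<le> poly q (size (e x))"
    using i by (rule ptime_size) blast
  have main: "x \<in> D \<Longrightarrow> set zs \<subseteq> set (l x) \<Longrightarrow>
      size (s (foldr (\<lambda>y st. g y st x) zs (i x))) \<le> size (s (i x)) + length zs * poly r (size (e x))" for x zs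
  proof (induction zs)
    case (Cons z zs)
    then show ?case
      using growth[of x z "foldr (\<lambda>y st. g y st x) zs (i x)"] by (simp add: algebra_simps)
  qed simp
  show ?thesis
  proof (rule ptime_foldr[OF l i g, where q = "q + p * r"])
    fix x ys zs assume x: "x \<in> D" and eq: "l x = ys @ zs"
    have "length zs \<le> poly p (size (e x))"
      using p[OF x] length_le_size_enc_list[of "l x" a] eq by simp
    then have "length zs * poly r (size (e x)) \<le> poly p (size (e x)) * poly r (size (e x))"
      by (rule mult_right_mono) simp
    with main[OF x, of zs] q[OF x] eq have "size (s (foldr (\<lambda>y st. g y st x) zs (i x))) \<le> poly q (size (e x)) + poly p (size (e x)) * poly r (size (e x))"
      by (simp only: set_append Un_upper2 simp_thms True_implies_equals; linarith)
    then show "size (s (foldr (\<lambda>y st. g y st x) zs (i x))) \<le> poly (q + p * r) (size (e x))"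
      by simp
  qed simp
qed

lemma ptime_map:
  assumes l: "ptime D e (enc_list a) l"
    and g: "ptime E (epair a e) b (\<lambda>p. g (fst p) (snd p))"
    and E: "\<And>x y. x \<in> D \<Longrightarrow> y \<in> set (l x) \<Longrightarrow> (y, x) \<in> E"
  shows "ptime D e (enc_list b) (\<lambda>x. map (\<lambda>y. g y x) (l x))"
proof -
  obtain p where p: "\<And>x. x \<in> D \<Longrightarrow> size (enc_list a (l x)) \<le> poly p (size (e x))"
    using l by (rule ptime_size) blast
  obtain q where q: "\<And>p. p \<in> E \<Longrightarrow> size (b (g (fst p) (snd p))) \<le> poly q (size (epair a e p))"
    using g by (rule ptime_size) blast
  have foldr_map: "foldr (\<lambda>y st. g y x # st) zs [] = map (\<lambda>y. g y x) zs" for x zs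
    by (induction zs) auto
  have "ptime D e (enc_list b) (\<lambda>x. foldr (\<lambda>y st. g y x # st) (l x) [])"
  proof (rule ptime_foldr[OF l ptime_const, where E = "{(y, st, x). (y, x) \<in> E}"
      and q = "p * (pcompose q (p + [:1, 1:]) + 1)"])
    have g': "ptime {(y, st, x). (y, x) \<in> E} (epair a (epair (enc_list b) e)) b
        (\<lambda>x. (\<lambda>p. g (fst p) (snd p)) ((\<lambda>p. (fst p, snd (snd p))) x))"
      by (rule ptime_comp[OF _ g]) ((intro ptime_pair; (rule ptime_acc)+), auto)
    show "ptime {(y, st, x). (y, x) \<in> E} (epair a (epair (enc_list b) e)) (enc_list b)
        (\<lambda>p. g (fst p) (snd (snd p)) # fst (snd p))"
      by (intro ptime_Cons g'[simplified]; (rule ptime_acc)+)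
    fix x ys zs assume x: "x \<in> D" and eq: "l x = ys @ zs"
    let ?B = "poly (pcompose q (p + [:1, 1:])) (size (e x))"
    have "size (b (g z x)) + 1 \<le> ?B + 1" if "z \<in> set zs" for z
    proof -
      have z: "z \<in> set (l x)" using that eq by simp
      have "size (b (g z x)) \<le> poly q (size (a z) + size (e x) + 1)"
        using q[OF E[OF x z]] by simp
      also have "\<dots> \<le> poly q (poly (p + [:1, 1:]) (size (e x)))"
        using p[OF x] size_in_enc_list[OF z, of a] by (intro poly_nat_mono) simp
      finally show ?thesis by (simp add: poly_pcompose)
    qed
    then have "(\<Sum>z\<leftarrow>zs. size (b (g z x)) + 1) \<le> (\<Sum>z\<leftarrow>zs. ?B + 1)"
      by (rule sum_list_mono)
    also have "\<dots> = length zs * (?B + 1)" by (simp add: sum_list_triv)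
    also have "\<dots> \<le> poly p (size (e x)) * (?B + 1)"
      using p[OF x] length_le_size_enc_list[of "l x" a] eq by (intro mult_right_mono) auto
    finally show "size (enc_list b (foldr (\<lambda>y st. g y x # st) zs [])) \<le>
        poly (p * (pcompose q (p + [:1, 1:]) + 1)) (size (e x))"
      by (simp add: foldr_map size_enc_list o_def)
  qed (use E in auto)
  then show ?thesis by (simp add: foldr_map)
qed

lemma ptime_foldr_bool:
  assumes l: "ptime D e (enc_list a) l"
    and g: "ptime E (epair a (epair ebool e)) ebool (\<lambda>p. g (fst p) (fst (snd p)) (snd (snd p)))"
    and E: "\<And>x y st. x \<in> D \<Longrightarrow> y \<in> set (l x) \<Longrightarrow> (y, st, x) \<in> E"
  shows "ptime D e ebool (\<lambda>x. foldr (\<lambda>y st. g y st x) (l x) b)"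
  by (rule ptime_foldr[OF l ptime_const g, where q = "[:1:]"]) (auto simp: E ebool_def)

lemma ptime_bex:
  assumes l: "ptime D e (enc_list a) l"
    and g: "ptime E (epair a e) ebool (\<lambda>p. g (fst p) (snd p))"
    and E: "\<And>x y. x \<in> D \<Longrightarrow> y \<in> set (l x) \<Longrightarrow> (y, x) \<in> E"
  shows "ptime D e ebool (\<lambda>x. \<exists>y\<in>set (l x). g y x)"
proof -
  have g': "ptime {(y, st, x). (y, x) \<in> E} (epair a (epair ebool e)) ebool
      (\<lambda>x. (\<lambda>p. g (fst p) (snd p)) ((\<lambda>p. (fst p, snd (snd p))) x))"
    by (rule ptime_comp[OF _ g]) ((intro ptime_pair; (rule ptime_acc)+), auto)
  have "ptime {(y, st, x). (y, x) \<in> E} (epair a (epair ebool e)) ebool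
      (\<lambda>p. fst (snd p) \<or> g (fst p) (snd (snd p)))"
    by (intro ptime_disj ptime_subset[OF g'[simplified]]; ((rule ptime_acc)+ | auto))
  then have "ptime D e ebool (\<lambda>x. foldr (\<lambda>y st. st \<or> g y x) (l x) False)"
    by (rule ptime_foldr_bool[OF l]) (auto simp: E)
  moreover have "foldr (\<lambda>y st. st \<or> g y x) zs False \<longleftrightarrow> (\<exists>y\<in>set zs. g y x)" for zs x
    by (induction zs) auto
  ultimately show ?thesis by simp
qed

lemma ptime_ball:
  assumes l: "ptime D e (enc_list a) l"
    and g: "ptime E (epair a e) ebool (\<lambda>p. g (fst p) (snd p))"
    and E: "\<And>x y. x \<in> D \<Longrightarrow> y \<in> set (l x) \<Longrightarrow> (y, x) \<in> E"
  shows "ptime D e ebool (\<lambda>x. \<forall>y\<in>set (l x). g y x)"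
  using ptime_not[OF ptime_bex[OF l ptime_not[OF g] E]] by simp

lemma ptime_filter:
  assumes l: "ptime D e (enc_list a) l"
    and g: "ptime E (epair a e) ebool (\<lambda>p. g (fst p) (snd p))"
    and E: "\<And>x y. x \<in> D \<Longrightarrow> y \<in> set (l x) \<Longrightarrow> (y, x) \<in> E"
  shows "ptime D e (enc_list a) (\<lambda>x. filter (\<lambda>y. g y x) (l x))"
proof -
  obtain p where p: "\<And>x. x \<in> D \<Longrightarrow> size (enc_list a (l x)) \<le> poly p (size (e x))"
    using l by (rule ptime_size) blast
  have foldr_filter: "foldr (\<lambda>y st. if g y x then y # st else st) zs [] = filter (\<lambda>y. g y x) zs" for x zs
    by (induction zs) auto
  have "ptime D e (enc_list a) (\<lambda>x. foldr (\<lambda>y st. if g y x then y # st else st) (l x) [])"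
  proof (rule ptime_foldr[OF l ptime_const, where E = "{(y, st, x). (y, x) \<in> E}" and q = p])
    have g': "ptime {(y, st, x). (y, x) \<in> E} (epair a (epair (enc_list a) e)) ebool
        (\<lambda>x. (\<lambda>p. g (fst p) (snd p)) ((\<lambda>p. (fst p, snd (snd p))) x))"
      by (rule ptime_comp[OF _ g]) ((intro ptime_pair; (rule ptime_acc)+), auto)
    show "ptime {(y, st, x). (y, x) \<in> E} (epair a (epair (enc_list a) e)) (enc_list a)
        (\<lambda>p. if g (fst p) (snd (snd p)) then fst p # fst (snd p) else fst (snd p))"
      by (intro ptime_if ptime_Cons g'[simplified]; (rule ptime_acc)+)
    fix x ys zs assume x: "x \<in> D" and eq: "l x = ys @ zs"
    have "size (enc_list a (filter P zs)) \<le> size (enc_list a zs)" for P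
      by (induction zs) auto
    also have "size (enc_list a zs) \<le> size (enc_list a (l x))"
      by (simp add: eq size_enc_list)
    finally show "size (enc_list a (foldr (\<lambda>y st. if g y x then y # st else st) zs [])) \<le> poly p (size (e x))"
      unfolding foldr_filter by (rule le_trans[OF _ p[OF x]])
  qed (use E in auto)
  then show ?thesis by (simp add: foldr_filter)
qed

lemma ptime_append:
  assumes "ptime D e (enc_list a) f" "ptime D e (enc_list a) g"
  shows "ptime D e (enc_list a) (\<lambda>x. f x @ g x)"
proof -
  obtain p where p: "\<And>x. x \<in> D \<Longrightarrow> size (enc_list a (f x)) \<le> poly p (size (e x))"
    using assms(1) by (rule ptime_size) blast
  obtain q where q: "\<And>x. x \<in> D \<Longrightarrow> size (enc_list a (g x)) \<le> poly q (size (e x))"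
    using assms(2) by (rule ptime_size) blast
  have eq: "foldr (\<lambda>y st. y # st) zs i = zs @ i" for zs :: "'b list" and i
    by (induction zs) auto
  have "ptime D e (enc_list a) (\<lambda>x. foldr (\<lambda>y st. y # st) (f x) (g x))"
  proof (rule ptime_foldr[OF assms, where E = UNIV and q = "p + q" and g = "\<lambda>y st x. y # st"])
    fix x ys zs assume "x \<in> D" "f x = ys @ zs"
    with p[of x] q[of x] show "size (enc_list a (foldr (#) zs (g x))) \<le> poly (p + q) (size (e x))"
      unfolding eq by (simp add: size_enc_list_append)
  qed ((intro ptime_Cons; (rule ptime_acc)+), simp)
  then show ?thesis by (simp add: eq)
qed

lemma ptime_concat:
  assumes "ptime D e (enc_list (enc_list a)) f"
  shows "ptime D e (enc_list a) (\<lambda>x. concat (f x))"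
proof -
  obtain p where p: "\<And>x. x \<in> D \<Longrightarrow> size (enc_list (enc_list a) (f x)) \<le> poly p (size (e x))"
    using assms by (rule ptime_size) blast
  have eq: "foldr (\<lambda>y st. y @ st) zs [] = concat zs" for zs :: "'b list list"
    by (induction zs) auto
  have "ptime D e (enc_list a) (\<lambda>x. foldr (\<lambda>y st. y @ st) (f x) [])"
  proof (rule ptime_foldr_growth[OF assms ptime_const, where r = p and g = "\<lambda>y st x. y @ st"])
    fix x y st assume x: "x \<in> D" and y: "y \<in> set (f x)"
    show "size (enc_list a (y @ st)) \<le> size (enc_list a st) + poly p (size (e x))"
      using p[OF x] size_in_enc_list[OF y, of "enc_list a"] by (simp add: size_enc_list_append)
  qed (intro ptime_append; (rule ptime_acc)+)
  then show ?thesis by (simp add: eq)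
qed

section \<open>Arithmetic\<close>

lemma enc_nat_0 [simp]: "enc_nat 0 = Leaf"
  by (simp add: enc_nat.simps)

lemma enc_nat_pos: "0 < n \<Longrightarrow> enc_nat n = Node (ebool (odd n)) (enc_nat (n div 2))"
  by (subst enc_nat.simps) (simp add: ebool_def)

text \<open>With \<open>size_enc_nat_le\<close>, where a bit costs at most two nodes, this
  translates bounds on numbers into bounds on sizes; the sizes of sums and products are controlled
  in this way.\<close>

lemma less_two_power_size: "n < 2 ^ size (enc_nat n)"
proof (induction n rule: less_induct)
  case (less n)
  show ?case
  proof (cases "n = 0")
    case False
    then have "n div 2 < 2 ^ size (enc_nat (n div 2))" by (intro less) simp
    then have "n < 2 ^ (size (enc_nat (n div 2)) + 1)" by simp
    also have "\<dots> \<le> 2 ^ size (enc_nat n)"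
      using False by (intro power_increasing) (simp_all add: enc_nat_pos)
    finally show ?thesis .
  qed simp
qed

lemma size_enc_nat_le: "n < 2 ^ k \<Longrightarrow> size (enc_nat n) \<le> 2 * k"
proof (induction k arbitrary: n)
  case (Suc k)
  then have "size (enc_nat (n div 2)) \<le> 2 * k" by auto
  then show ?case by (cases "n = 0") (auto simp: enc_nat_pos ebool_def)
qed simp

lemma size_enc_nat_div_2: "size (enc_nat (n div 2)) \<le> size (enc_nat n)"
  by (cases "n = 0") (auto simp: enc_nat_pos)

lemma size_enc_nat_div_2_less: "0 < n \<Longrightarrow> size (enc_nat (n div 2)) < size (enc_nat n)"
  by (simp add: enc_nat_pos)

lemma ptime_zero: "ptime D e enc_nat f \<Longrightarrow> ptime D e ebool (\<lambda>x. f x = 0)"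
proof -
  assume "ptime D e enc_nat f"
  then have "ptime D e ebool (\<lambda>x. f x \<noteq> 0)"
    by (rule ptime_nonleaf) (metis enc_nat_0 enc_nat_pos neq0_conv tree.distinct(1))
  from ptime_not[OF this] show ?thesis by simp
qed

lemma ptime_odd:
  assumes "ptime D e enc_nat f" shows "ptime D e ebool (\<lambda>x. odd (f x))"
  by (rule ptime_left[OF assms]) (case_tac "f x = 0"; simp add: enc_nat_pos ebool_def)

lemma ptime_even: "ptime D e enc_nat f \<Longrightarrow> ptime D e ebool (\<lambda>x. even (f x))"
  using ptime_not[OF ptime_odd] by fastforce

lemma ptime_div_2:
  assumes "ptime D e enc_nat f" shows "ptime D e enc_nat (\<lambda>x. f x div 2)"
  by (rule ptime_right[OF assms]) (case_tac "f x = 0"; simp add: enc_nat_pos)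

lemma ptime_double_plus:
  assumes f: "ptime D e enc_nat f" and b: "ptime D e ebool b"
  shows "ptime D e enc_nat (\<lambda>x. 2 * f x + of_bool (b x))"
proof -
  have "ptime D e enc_nat (\<lambda>x. if f x = 0 \<and> \<not> b x then 0 else 2 * f x + of_bool (b x))"
  proof (intro ptime_if ptime_conj ptime_zero ptime_not ptime_const f ptime_subset[OF b])
    show "ptime {x \<in> D. \<not> (f x = 0 \<and> \<not> b x)} e enc_nat (\<lambda>x. 2 * f x + of_bool (b x))"
      by (rule ptime_node[OF ptime_subset[OF b] ptime_subset[OF f]])
        (auto simp: enc_nat_pos)
  qed auto
  then show ?thesis by (rule ptime_cong) auto
qed

lemma nat_bitE:
  obtains k b where "(n :: nat) = 2 * k + of_bool b"
  by (cases "even n") (metis evenE oddE add_0_right of_bool_eq)+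

text \<open>A full adder: the last bit is the exclusive or of three bits, and the carry is their
  majority.\<close>

lemma odd_majority:
  "(a + b + of_bool c :: nat) = 2 * (a div 2 + b div 2 + of_bool (odd a \<and> odd b \<or> c \<and> (odd a \<or> odd b)))
     + of_bool (odd a \<longleftrightarrow> (odd b \<longleftrightarrow> c))"
  by (rule nat_bitE[of a], rule nat_bitE[of b]) auto

lemma two_powers_le: "2 ^ a + 2 ^ b \<le> (2 :: nat) ^ (a + b + 1)"
proof -
  have "2 ^ a \<le> 2 ^ a * (2 :: nat) ^ b" "2 ^ b \<le> 2 ^ a * (2 :: nat) ^ b"
    by simp_all
  then show ?thesis unfolding power_add power_one_right by linarith
qed

lemma ptime_add:
  assumes "ptime D e enc_nat f" "ptime D e enc_nat g"
  shows "ptime D e enc_nat (\<lambda>x. f x + g x)"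
proof -
  let ?e = "epair enc_nat (epair enc_nat ebool)"
  define B where "B = (\<lambda>p :: nat \<times> nat \<times> bool. fst p = 0 \<and> fst (snd p) = 0)"
  define s where "s = (\<lambda>p :: nat \<times> nat \<times> bool. (fst p div 2, fst (snd p) div 2,
    odd (fst p) \<and> odd (fst (snd p)) \<or> snd (snd p) \<and> (odd (fst p) \<or> odd (fst (snd p)))))"
  define c where "c = (\<lambda>q :: (nat \<times> nat \<times> bool) \<times> nat. 2 * snd q +
    of_bool (if odd (fst (fst q)) then if odd (fst (snd (fst q))) then snd (snd (fst q)) else \<not> snd (snd (fst q))
      else if odd (fst (snd (fst q))) then \<not> snd (snd (fst q)) else snd (snd (fst q))))"
  have "ptime UNIV ?e enc_nat (\<lambda>p. fst p + fst (snd p) + of_bool (snd (snd p)))"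
  proof (rule ptime_rec[where B = B and s = s and c = c and h = "\<lambda>p. of_bool (snd (snd p))"
        and \<mu> = "\<lambda>p. size (enc_nat (fst p)) + size (enc_nat (fst (snd p)))"
        and q = "[:2, 2:]" and r = "[:0, 1:]"])
    show "ptime UNIV ?e ebool B"
      unfolding B_def by (intro ptime_conj ptime_zero; (rule ptime_acc)+)
    have "ptime D ?e enc_nat (\<lambda>p. if snd (snd p) then 1 else 0)" for D
      by (intro ptime_if ptime_const; (rule ptime_acc)+)
    then show "ptime {p \<in> UNIV. B p} ?e enc_nat (\<lambda>p. of_bool (snd (snd p)))"
      by (rule ptime_cong) auto
    show "ptime {p \<in> UNIV. \<not> B p} ?e ?e s"
      unfolding s_def
      by (intro ptime_pair ptime_div_2 ptime_disj ptime_conj ptime_odd; (rule ptime_acc)+)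
    have "ptime UNIV (epair ?e enc_nat) enc_nat c"
      unfolding c_def
      by (intro ptime_double_plus ptime_if ptime_not ptime_odd; (rule ptime_acc)+)
    then show "ptime {(p, y). p \<in> UNIV \<and> \<not> B p \<and> y = fst (s p) + fst (snd (s p)) + of_bool (snd (snd (s p)))}
        (epair ?e enc_nat) enc_nat c"
      by (rule ptime_UNIV)
    fix p :: "nat \<times> nat \<times> bool"
    obtain a b d where p: "p = (a, b, d)" by (cases p)
    have "a + b + of_bool d < 2 ^ size (enc_nat a) + 2 ^ size (enc_nat b)"
      using less_two_power_size[of a] less_two_power_size[of b] by (cases d) auto
    also note two_powers_le
    finally show "size (enc_nat (fst p + fst (snd p) + of_bool (snd (snd p)))) \<le> poly [:2, 2:] (size (?e p))"
      using size_enc_nat_le[of "a + b + of_bool d"] by (fastforce simp: p)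
    show "fst p + fst (snd p) + of_bool (snd (snd p)) = (if B p then of_bool (snd (snd p))
       else c (p, fst (s p) + fst (snd (s p)) + of_bool (snd (snd (s p)))))"
      using odd_majority[of a b d] by (auto simp: p B_def s_def c_def simp del: dvd_add_times_triv_right_iff)
    show "size (enc_nat (fst p)) + size (enc_nat (fst (snd p))) \<le> poly [:0, 1:] (size (?e p))"
      by simp
    assume "\<not> B p"
    then have "size (enc_nat (a div 2)) + size (enc_nat (b div 2)) < size (enc_nat a) + size (enc_nat b)"
      using size_enc_nat_div_2[of a] size_enc_nat_div_2[of b]
        size_enc_nat_div_2_less[of a] size_enc_nat_div_2_less[of b]
      by (auto simp: B_def p)
    then show "s p \<in> UNIV \<and>
      size (enc_nat (fst (s p))) + size (enc_nat (fst (snd (s p)))) < size (enc_nat (fst p)) + size (enc_nat (fst (snd p))) \<and>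
      size (?e (s p)) \<le> size (?e p)"
      by (auto simp: p s_def ebool_def)
  qed
  from ptime_comp[OF ptime_pair[OF assms(1) ptime_pair[OF assms(2) ptime_const[of _ _ _ False]]] this]
  show ?thesis by simp
qed

text \<open>Halves one factor and doubles the product of the rest. The summand
  \<open>of_bool False\<close> makes the doubling an instance of
  \<open>ptime_double_plus\<close>.\<close>

lemma ptime_mult:
  assumes "ptime D e enc_nat f" "ptime D e enc_nat g"
  shows "ptime D e enc_nat (\<lambda>x. f x * g x)"
proof -
  let ?e = "epair enc_nat enc_nat"
  have "ptime UNIV ?e enc_nat (\<lambda>p. fst p * snd p)"
  proof (rule ptime_rec[where B = "\<lambda>p. fst p = 0" and s = "\<lambda>p. (fst p div 2, snd p)"
        and c = "\<lambda>q. 2 * snd q + of_bool False + (if odd (fst (fst q)) then snd (fst q) else 0)"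
        and h = "\<lambda>p. 0" and \<mu> = "\<lambda>p. size (enc_nat (fst p))" and q = "[:0, 2:]" and r = "[:0, 1:]"])
    have "ptime UNIV (epair ?e enc_nat) enc_nat
        (\<lambda>q. 2 * snd q + of_bool False + (if odd (fst (fst q)) then snd (fst q) else 0))"
      by (intro ptime_add ptime_double_plus ptime_if ptime_odd ptime_const; (rule ptime_acc)+)
    then show "ptime {(p, y). p \<in> UNIV \<and> fst p \<noteq> 0 \<and> y = fst (fst p div 2, snd p) * snd (fst p div 2, snd p)}
        (epair ?e enc_nat) enc_nat
        (\<lambda>q. 2 * snd q + of_bool False + (if odd (fst (fst q)) then snd (fst q) else 0))"
      by (rule ptime_UNIV)
    fix p :: "nat \<times> nat"
    obtain a b where p: "p = (a, b)" by (cases p)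
    have "a * b < 2 ^ size (enc_nat a) * 2 ^ size (enc_nat b)"
      using less_two_power_size[of a] less_two_power_size[of b] by (intro mult_strict_mono) auto
    then show "size (enc_nat (fst p * snd p)) \<le> poly [:0, 2:] (size (?e p))"
      by (auto simp: p power_add[symmetric] dest: size_enc_nat_le)
    have "a * b = 2 * (a div 2 * b) + (if odd a then b else 0)"
    proof (cases "odd a")
      case True
      then obtain k where "a = 2 * k + 1" by (rule oddE)
      then show ?thesis by (simp add: algebra_simps)
    qed simp
    then show "fst p * snd p = (if fst p = 0 then 0 else
        2 * snd (p, fst (fst p div 2, snd p) * snd (fst p div 2, snd p)) + of_bool False +
        (if odd (fst (fst (p, fst (fst p div 2, snd p) * snd (fst p div 2, snd p))))
         then snd (fst (p, fst (fst p div 2, snd p) * snd (fst p div 2, snd p))) else 0))"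
      by (simp add: p)
    show "ptime UNIV ?e ebool (\<lambda>p. fst p = 0)"
      by (intro ptime_zero; (rule ptime_acc)+)
    show "ptime {p \<in> UNIV. fst p = 0} ?e enc_nat (\<lambda>p. 0)"
      by (rule ptime_const)
    show "ptime {p \<in> UNIV. fst p \<noteq> 0} ?e ?e (\<lambda>p. (fst p div 2, snd p))"
      by (intro ptime_pair ptime_div_2; (rule ptime_acc)+)
  qed (use size_enc_nat_div_2 size_enc_nat_div_2_less in auto)
  from ptime_comp[OF ptime_pair[OF assms] this] show ?thesis by simp
qed

text \<open>If the last bit of \<open>a\<close> exceeds that of \<open>b\<close>, the halves must
  satisfy a strict inequality. Stating it as a negated comparison with exchanged arguments leaves a
  single recursive call.\<close>

lemma le_iff_div_2:
  "(a :: nat) \<le> b \<longleftrightarrow> (if odd a \<and> even b then \<not> b div 2 \<le> a div 2 else a div 2 \<le> b div 2)"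
  by (rule nat_bitE[of a], rule nat_bitE[of b]) (auto split: if_splits)

lemma ptime_le:
  assumes "ptime D e enc_nat f" "ptime D e enc_nat g"
  shows "ptime D e ebool (\<lambda>x. f x \<le> g x)"
proof -
  let ?e = "epair enc_nat enc_nat"
  define swap where "swap p \<longleftrightarrow> odd (fst p) \<and> even (snd p)" for p :: "nat \<times> nat"
  define s where "s = (\<lambda>p :: nat \<times> nat. if swap p then (snd p div 2, fst p div 2) else (fst p div 2, snd p div 2))"
  define c where "c = (\<lambda>q :: (nat \<times> nat) \<times> bool. if swap (fst q) then \<not> snd q else snd q)"
  have swap: "ptime D ?e ebool swap" for D
    unfolding swap_def by (intro ptime_conj ptime_odd ptime_even; (rule ptime_acc)+)
  have swap_fst: "ptime D (epair ?e ebool) ebool (\<lambda>q. swap (fst q))" for D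
    unfolding swap_def by (intro ptime_conj ptime_odd ptime_even; (rule ptime_acc)+)
  have "ptime UNIV ?e ebool (\<lambda>p. fst p \<le> snd p)"
  proof (rule ptime_rec[where B = "\<lambda>p. fst p = 0 \<or> snd p = 0" and s = s and c = c and h = "\<lambda>p. fst p = 0"
        and \<mu> = "\<lambda>p. size (enc_nat (fst p)) + size (enc_nat (snd p))" and q = "[:1:]" and r = "[:0, 1:]"])
    show "ptime UNIV ?e ebool (\<lambda>p. fst p = 0 \<or> snd p = 0)"
      by (intro ptime_disj ptime_zero; (rule ptime_acc)+)
    show "ptime {p \<in> UNIV. fst p = 0 \<or> snd p = 0} ?e ebool (\<lambda>p. fst p = 0)"
      by (intro ptime_zero; (rule ptime_acc)+)
    show "ptime {p \<in> UNIV. \<not> (fst p = 0 \<or> snd p = 0)} ?e ?e s"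
      unfolding s_def by (intro ptime_if swap ptime_pair ptime_div_2; (rule ptime_acc)+)
    have "ptime UNIV (epair ?e ebool) ebool c"
      unfolding c_def by (intro ptime_if swap_fst ptime_not; (rule ptime_acc)+)
    then show "ptime {(p, y). p \<in> UNIV \<and> \<not> (fst p = 0 \<or> snd p = 0) \<and> y = (fst (s p) \<le> snd (s p))}
        (epair ?e ebool) ebool c"
      by (rule ptime_UNIV)
    fix p :: "nat \<times> nat"
    show "(fst p \<le> snd p) = (if fst p = 0 \<or> snd p = 0 then fst p = 0 else c (p, fst (s p) \<le> snd (s p)))"
      using le_iff_div_2[of "fst p" "snd p"] by (auto simp: c_def s_def swap_def)
    assume "\<not> (fst p = 0 \<or> snd p = 0)"
    then show "s p \<in> UNIV \<and>
      size (enc_nat (fst (s p))) + size (enc_nat (snd (s p))) < size (enc_nat (fst p)) + size (enc_nat (snd p)) \<and>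
      size (?e (s p)) \<le> size (?e p)"
      using size_enc_nat_div_2_less[of "fst p"] size_enc_nat_div_2_less[of "snd p"] by (simp add: s_def)
  qed (simp_all add: ebool_def)
  from ptime_comp[OF ptime_pair[OF assms] this] show ?thesis by simp
qed

lemma ptime_eq:
  assumes "ptime D e enc_nat f" "ptime D e enc_nat g"
  shows "ptime D e ebool (\<lambda>x. f x = g x)"
proof -
  have "ptime D e ebool (\<lambda>x. f x \<le> g x \<and> g x \<le> f x)"
    by (intro ptime_conj ptime_le assms assms[THEN ptime_subset]) auto
  then show ?thesis by (rule ptime_cong) (auto simp: eq_iff)
qed

text \<open>Point indices and counters are at most the number of points and are kept in unary.\<close>

fun enc_unary :: "nat \<Rightarrow> tree" where
  "enc_unary 0 = Leaf"
| "enc_unary (Suc n) = Node Leaf (enc_unary n)"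

lemma size_enc_unary [simp]: "size (enc_unary n) = n"
  by (induction n) auto

lemma ptime_Suc: "ptime D e enc_unary f \<Longrightarrow> ptime D e enc_unary (\<lambda>x. Suc (f x))"
  by (rule ptime_node[where a = enc_unary and f = "\<lambda>_. 0" and b = enc_unary and g = f]) (auto intro: ptime_const)

lemma ptime_pred: "ptime D e enc_unary f \<Longrightarrow> ptime D e enc_unary (\<lambda>x. f x - 1)"
  by (erule ptime_right) (case_tac "f x"; simp)

lemma ptime_unary_zero:
  assumes "ptime D e enc_unary f" shows "ptime D e ebool (\<lambda>x. f x = 0)"
proof -
  have "n \<noteq> 0 \<longleftrightarrow> enc_unary n \<noteq> Leaf" for n by (cases n) auto
  then have "ptime D e ebool (\<lambda>x. f x \<noteq> 0)" by (intro ptime_nonleaf[OF assms])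
  from ptime_not[OF this] show ?thesis by simp
qed

lemma ptime_unary_to_binary:
  assumes "ptime D e enc_unary f" shows "ptime D e enc_nat f"
proof -
  have "ptime UNIV enc_unary enc_nat (\<lambda>n. n)"
  proof (rule ptime_rec[where B = "\<lambda>n. n = 0" and h = "\<lambda>_. 0" and s = "\<lambda>n. n - 1"
        and c = "\<lambda>q. snd q + 1" and \<mu> = "\<lambda>n. n" and r = "[:0, 1:]" and q = "[:0, 2:]"])
    show "ptime UNIV enc_unary ebool (\<lambda>n. n = 0)" by (intro ptime_unary_zero; rule ptime_id)
    show "ptime {n \<in> UNIV. n \<noteq> 0} enc_unary enc_unary (\<lambda>n. n - 1)" by (intro ptime_pred; rule ptime_id)
    show "ptime {(n, m). n \<in> UNIV \<and> n \<noteq> 0 \<and> m = n - 1} (epair enc_unary enc_nat) enc_nat (\<lambda>q. snd q + 1)"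
      by (intro ptime_add ptime_const; (rule ptime_acc)+)
    show "size (enc_nat n) \<le> poly [:0, 2:] (size (enc_unary n))" for n
      using size_enc_nat_le[OF less_exp, of n] by simp
  qed (auto intro: ptime_const)
  from ptime_comp[OF assms this] show ?thesis by simp
qed

lemma ptime_unary_eq:
  "ptime D e enc_unary f \<Longrightarrow> ptime D e enc_unary g \<Longrightarrow> ptime D e ebool (\<lambda>x. f x = g x)"
  by (intro ptime_eq ptime_unary_to_binary)

lemma ptime_unary_less:
  assumes "ptime D e enc_unary f" "ptime D e enc_unary g"
  shows "ptime D e ebool (\<lambda>x. f x < g x)"
proof -
  have "ptime D e ebool (\<lambda>x. \<not> g x \<le> f x)"
    by (intro ptime_not ptime_le ptime_unary_to_binary assms)
  then show ?thesis by (simp add: not_le)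
qed

lemma ptime_length:
  assumes "ptime D e (enc_list a) f" shows "ptime D e enc_unary (\<lambda>x. length (f x))"
proof -
  have eq: "foldr (\<lambda>y st. Suc st) l 0 = length l" for l :: "'b list"
    by (induction l) auto
  have "ptime D e enc_unary (\<lambda>x. foldr (\<lambda>y st. Suc st) (f x) 0)"
    by (rule ptime_foldr_growth[OF assms ptime_const, where r = 1 and g = "\<lambda>y st x. Suc st"])
      ((intro ptime_Suc; (rule ptime_acc)+), simp)
  then show ?thesis by (simp add: eq)
qed

text \<open>A total lookup, so that the running time bounds need no side conditions on
  indices.\<close>

fun nth_or :: "'a \<Rightarrow> 'a list \<Rightarrow> nat \<Rightarrow> 'a" where
  "nth_or d [] n = d"
| "nth_or d (x # xs) n = (if n = 0 then x else nth_or d xs (n - 1))"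

lemma nth_or_eq: "nth_or d xs n = (if n < length xs then xs ! n else d)"
  by (induction d xs n rule: nth_or.induct) (auto simp: nth_Cons')

lemma ptime_nth_or:
  assumes "ptime D e (enc_list a) f" "ptime D e enc_unary g"
  shows "ptime D e a (\<lambda>x. nth_or d (f x) (g x))"
proof -
  let ?e = "epair (enc_list a) enc_unary"
  have "ptime UNIV ?e a (\<lambda>p. nth_or d (fst p) (snd p))"
  proof (rule ptime_rec[where B = "\<lambda>p. fst p = [] \<or> snd p = 0"
        and h = "\<lambda>p. if fst p = [] then d else hd (fst p)"
        and s = "\<lambda>p. (tl (fst p), snd p - 1)" and c = snd and \<mu> = snd and r = "[:0, 1:]"
        and q = "[:size (a d), 1:]"])
    show "ptime UNIV ?e ebool (\<lambda>p. fst p = [] \<or> snd p = 0)"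
      by (intro ptime_disj ptime_null ptime_unary_zero; (rule ptime_acc)+)
    show "ptime {p \<in> UNIV. fst p = [] \<or> snd p = 0} ?e a (\<lambda>p. if fst p = [] then d else hd (fst p))"
      by (intro ptime_if ptime_null ptime_const ptime_hd; ((rule ptime_acc)+ | simp))
    show "ptime {p \<in> UNIV. \<not> (fst p = [] \<or> snd p = 0)} ?e ?e (\<lambda>p. (tl (fst p), snd p - 1))"
      by (intro ptime_pair ptime_tl ptime_pred; (rule ptime_acc)+)
    show "ptime {(p, y). p \<in> UNIV \<and> \<not> (fst p = [] \<or> snd p = 0) \<and>
        y = nth_or d (fst (tl (fst p), snd p - 1)) (snd (tl (fst p), snd p - 1))} (epair ?e a) a snd"
      by (rule ptime_acc)+
    fix p :: "'b list \<times> nat"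
    show "nth_or d (fst p) (snd p) = (if fst p = [] \<or> snd p = 0 then if fst p = [] then d else hd (fst p)
       else snd (p, nth_or d (fst (tl (fst p), snd p - 1)) (snd (tl (fst p), snd p - 1))))"
      by (cases "fst p") auto
    show "size (a (nth_or d (fst p) (snd p))) \<le> poly [:size (a d), 1:] (size (?e p))"
      using size_in_enc_list[OF nth_mem, of "snd p" "fst p" a] by (auto simp: nth_or_eq)
  qed (auto simp: neq_Nil_conv)
  from ptime_comp[OF ptime_pair[OF assms] this] show ?thesis by simp
qed

fun indices :: "'a list \<Rightarrow> nat list" where
  "indices [] = []"
| "indices (x # xs) = length xs # indices xs"

lemma indices_eq: "indices xs = rev [0..<length xs]"
  by (induction xs) auto

lemma ptime_indices:
  assumes "ptime D e (enc_list a) f" shows "ptime D e (enc_list enc_unary) (\<lambda>x. indices (f x))"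
proof -
  have size_indices: "size (enc_list enc_unary (indices xs)) \<le> length xs * length xs" for xs :: "'b list"
    by (induction xs) (auto simp: algebra_simps)
  have "ptime UNIV (enc_list a) (enc_list enc_unary) indices"
  proof (rule ptime_rec[where B = "\<lambda>l. l = []" and h = "\<lambda>_. []" and s = tl
        and c = "\<lambda>q. length (tl (fst q)) # snd q" and \<mu> = length and r = "[:0, 1:]" and q = "[:0, 0, 1:]"])
    show "ptime UNIV (enc_list a) ebool (\<lambda>l. l = [])" by (intro ptime_null; rule ptime_id)
    show "ptime {l \<in> UNIV. l \<noteq> []} (enc_list a) (enc_list a) tl" by (intro ptime_tl; rule ptime_id)
    show "ptime {(l, y). l \<in> UNIV \<and> l \<noteq> [] \<and> y = indices (tl l)} (epair (enc_list a) (enc_list enc_unary))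
        (enc_list enc_unary) (\<lambda>q. length (tl (fst q)) # snd q)"
      by (intro ptime_Cons ptime_length ptime_tl; (rule ptime_acc)+)
    fix l :: "'b list"
    show "indices l = (if l = [] then [] else length (tl (fst (l, indices (tl l)))) # snd (l, indices (tl l)))"
      by (cases l) auto
    have "length l * length l \<le> size (enc_list a l) * size (enc_list a l)"
      by (intro mult_mono length_le_size_enc_list) auto
    with size_indices[of l] show "size (enc_list enc_unary (indices l)) \<le> poly [:0, 0, 1:] (size (enc_list a l))"
      by simp
  qed (auto intro: ptime_const simp: length_le_size_enc_list neq_Nil_conv)
  from ptime_comp[OF assms this] show ?thesis by simp
qed

lemma ptime_list_eq:
  fixes a :: "'b \<Rightarrow> tree"
  assumes a: "\<And>D f g. ptime D (epair (enc_list a) (enc_list a)) a f \<Longrightarrow>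
      ptime D (epair (enc_list a) (enc_list a)) a g \<Longrightarrow>
      ptime D (epair (enc_list a) (enc_list a)) ebool (\<lambda>x. f x = g x)"
    and "ptime D e (enc_list a) f" "ptime D e (enc_list a) g"
  shows "ptime D e ebool (\<lambda>x. f x = g x)"
proof -
  let ?e = "epair (enc_list a) (enc_list a)"
  let ?B = "\<lambda>p :: 'b list \<times> 'b list. fst p = [] \<or> snd p = [] \<or> hd (fst p) \<noteq> hd (snd p)"
  have hds: "ptime {p \<in> {p \<in> UNIV. fst p \<noteq> []}. snd p \<noteq> []} ?e ebool (\<lambda>p. hd (fst p) \<noteq> hd (snd p))"
    by (intro ptime_not a ptime_hd; ((rule ptime_acc)+ | simp))
  have "ptime UNIV ?e ebool (\<lambda>p. fst p = snd p)"
  proof (rule ptime_rec[where B = ?B and h = "\<lambda>p. fst p = [] \<and> snd p = []" and c = snd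
        and s = "\<lambda>p. (tl (fst p), tl (snd p))" and \<mu> = "\<lambda>p. length (fst p)" and r = "[:0, 1:]" and q = "[:1:]"])
    show "ptime UNIV ?e ebool ?B"
      by (intro ptime_disj ptime_null hds; (rule ptime_acc)+)
    show "ptime {p \<in> UNIV. ?B p} ?e ebool (\<lambda>p. fst p = [] \<and> snd p = [])"
      by (intro ptime_conj ptime_null; (rule ptime_acc)+)
    show "ptime {p \<in> UNIV. \<not> ?B p} ?e ?e (\<lambda>p. (tl (fst p), tl (snd p)))"
      by (intro ptime_pair ptime_tl; (rule ptime_acc)+)
    show "ptime {(p, y). p \<in> UNIV \<and> \<not> ?B p \<and> y = (fst (tl (fst p), tl (snd p)) = snd (tl (fst p), tl (snd p)))}
        (epair ?e ebool) ebool snd"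
      by (rule ptime_acc)+
    fix p :: "'b list \<times> 'b list"
    show "(fst p = snd p) = (if ?B p then fst p = [] \<and> snd p = []
       else snd (p, fst (tl (fst p), tl (snd p)) = snd (tl (fst p), tl (snd p))))"
      by (cases "fst p"; cases "snd p") auto
    show "length (fst p) \<le> poly [:0, 1:] (size (?e p))"
      using length_le_size_enc_list[of "fst p" a] by simp
  qed (auto simp: ebool_def neq_Nil_conv)
  from ptime_comp[OF ptime_pair[OF assms(2,3)] this] show ?thesis by simp
qed

fun increment :: "nat \<Rightarrow> nat list \<Rightarrow> nat list" where
  "increment i [] = []"
| "increment i (x # xs) = (if i = 0 then Suc x # xs else x # increment (i - 1) xs)"

lemma increment_eq: "increment i xs = (if i < length xs then xs[i := Suc (xs ! i)] else xs)"
  by (induction i xs rule: increment.induct) (auto simp: nth_Cons' split: nat.split)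

lemma ptime_increment:
  assumes "ptime D e enc_unary f" "ptime D e (enc_list enc_unary) g"
  shows "ptime D e (enc_list enc_unary) (\<lambda>x. increment (f x) (g x))"
proof -
  let ?e = "epair enc_unary (enc_list enc_unary)"
  let ?B = "\<lambda>p :: nat \<times> nat list. snd p = [] \<or> fst p = 0"
  have "ptime UNIV ?e (enc_list enc_unary) (\<lambda>p. increment (fst p) (snd p))"
  proof (rule ptime_rec[where B = ?B and s = "\<lambda>p. (fst p - 1, tl (snd p))" and c = "\<lambda>q. hd (snd (fst q)) # snd q"
        and h = "\<lambda>p. if snd p = [] then [] else Suc (hd (snd p)) # tl (snd p)" and \<mu> = fst
        and r = "[:0, 1:]" and q = "[:1, 1:]"])
    show "ptime UNIV ?e ebool ?B"
      by (intro ptime_disj ptime_null ptime_unary_zero; (rule ptime_acc)+)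
    show "ptime {p \<in> UNIV. ?B p} ?e (enc_list enc_unary) (\<lambda>p. if snd p = [] then [] else Suc (hd (snd p)) # tl (snd p))"
      by (intro ptime_if ptime_null ptime_const ptime_Cons ptime_Suc ptime_hd ptime_tl; ((rule ptime_acc)+ | simp))
    show "ptime {p \<in> UNIV. \<not> ?B p} ?e ?e (\<lambda>p. (fst p - 1, tl (snd p)))"
      by (intro ptime_pair ptime_pred ptime_tl; (rule ptime_acc)+)
    show "ptime {(p, y). p \<in> UNIV \<and> \<not> ?B p \<and> y = increment (fst (fst p - 1, tl (snd p))) (snd (fst p - 1, tl (snd p)))}
        (epair ?e (enc_list enc_unary)) (enc_list enc_unary) (\<lambda>q. hd (snd (fst q)) # snd q)"
      by (intro ptime_Cons ptime_hd; ((rule ptime_acc)+ | force))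
    fix p :: "nat \<times> nat list"
    show "increment (fst p) (snd p) = (if ?B p then if snd p = [] then [] else Suc (hd (snd p)) # tl (snd p)
        else hd (snd (fst (p, increment (fst (fst p - 1, tl (snd p))) (snd (fst p - 1, tl (snd p)))))) #
          snd (p, increment (fst (fst p - 1, tl (snd p))) (snd (fst p - 1, tl (snd p)))))"
      by (cases "snd p") auto
    have "size (enc_list enc_unary (increment i xs)) \<le> Suc (size (enc_list enc_unary xs))" for i xs
      by (induction i xs rule: increment.induct) auto
    then show "size (enc_list enc_unary (increment (fst p) (snd p))) \<le> poly [:1, 1:] (size (?e p))"
      by (rule le_trans) simp
  qed (auto simp: neq_Nil_conv)
  from ptime_comp[OF ptime_pair[OF assms] this] show ?thesis by simp
qed

section \<open>The algorithm\<close>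

type_synonym frac = "nat \<times> nat"
type_synonym problem = "frac list list \<times> frac list \<times> frac"
type_synonym entry = "nat list \<times> nat list list"

abbreviation "enc_frac \<equiv> epair enc_nat enc_nat"
abbreviation "enc_matrix \<equiv> enc_list (enc_list enc_frac)"
abbreviation "enc_problem \<equiv> epair enc_matrix (epair (enc_list enc_frac) enc_frac)"
abbreviation "enc_points \<equiv> enc_list enc_unary"
abbreviation "enc_entry \<equiv> epair enc_points (enc_list enc_points)"
abbreviation "enc_table \<equiv> enc_list enc_entry"

text \<open>\<open>near (M, rs, \<alpha>) i u v\<close> says that the distance of \<open>u\<close> and \<open>v\<close> is at most \<open>\<alpha>\<close> times the \<open>i\<close>-th radius.\<close>

definition near :: "problem \<Rightarrow> nat \<Rightarrow> nat \<Rightarrow> nat \<Rightarrow> bool" where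
  "near c i u v \<longleftrightarrow>
     fst (nth_or (0, 1) (nth_or [] (fst c) u) v) * (snd (snd (snd c)) * snd (nth_or (0, 1) (fst (snd c)) i)) \<le>
     fst (snd (snd c)) * fst (nth_or (0, 1) (fst (snd c)) i) * snd (nth_or (0, 1) (nth_or [] (fst c) u) v)"

text \<open>Reachability search: the elements of the folded list only count the rounds, one for each
  point, and each round replaces a set by its neighbourhood. As every round filters the same list of
  points, the result is ordered in a way that does not depend on \<open>u\<close>.\<close>

definition component :: "problem \<Rightarrow> nat \<Rightarrow> nat \<Rightarrow> nat list" where
  "component c i u = foldr (\<lambda>_ S. filter (\<lambda>v. \<exists>w\<in>set S. near c i w v) (indices (fst c))) (indices (fst c)) [u]"

definition has_center :: "problem \<Rightarrow> nat \<Rightarrow> nat list \<Rightarrow> bool" where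
  "has_center c i Y \<longleftrightarrow> (\<exists>z\<in>set Y. \<forall>v\<in>set Y. near c i z v)"

text \<open>
  The test on the number of clusters always succeeds when \<open>Y\<close> is disjoint from the clusters of
  the entry; it makes the size bound for tables independent of the correctness proof.
\<close>

definition add_cluster :: "nat \<Rightarrow> nat \<Rightarrow> nat list \<Rightarrow> entry list \<Rightarrow> entry list" where
  "add_cluster n i Y T =
     map (\<lambda>e. (increment i (fst e), Y # snd e)) (filter (\<lambda>e. length (snd e) < n) T)"

text \<open>Keeping one entry per vector of counts keeps tables small. Nothing is lost, as the
  clusters added later are chosen independently of the earlier ones and the final test looks at the
  counts only.\<close>

definition merge :: "entry list \<Rightarrow> entry list \<Rightarrow> entry list" where
  "merge T1 T2 = foldr (\<lambda>e T. if \<exists>e'\<in>set T. fst e' = fst e then T else e # T) T1 T2"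

text \<open>A scan over all points meets a component once for each of its points; it is treated only
  at the head of its list.\<close>

definition is_representative :: "problem \<Rightarrow> nat \<Rightarrow> nat \<Rightarrow> bool" where
  "is_representative c i u \<longleftrightarrow> component c i u \<noteq> [] \<and> hd (component c i u) = u"

text \<open>
  An entry is a partial solution: how many clusters of each class it uses, and the clusters.
  \<open>extend m c i X T\<close> extends the entries of \<open>T\<close> by clusters that partition \<open>X\<close> and belong to the
  classes \<open>i, \<dots>, i + m - 1\<close>, where a cluster of class \<open>j\<close> is a component of the graph \<^term>\<open>near c j\<close>.
  As the radii decrease, a component of one class is a union of components of the next class.
\<close>

fun extend :: "nat \<Rightarrow> problem \<Rightarrow> nat \<Rightarrow> nat list \<Rightarrow> entry list \<Rightarrow> entry list" where
  "extend 0 c i X T = (if X = [] then T else [])"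
| "extend (Suc m) c i X T =
     foldr (\<lambda>u T.
       if is_representative c i u then
         merge
           (if has_center c i (component c i u)
            then add_cluster (length (fst c)) i (component c i u) T else [])
           (extend m c (Suc i) (component c i u) T)
       else T) X T"

lemma extend_Nil: "extend m c i [] T = T"
  by (cases m) auto

lemma extend_Cons:
  "extend (Suc m) c i (u # X) T =
     (if is_representative c i u then
        merge
          (if has_center c i (component c i u)
           then add_cluster (length (fst c)) i (component c i u) (extend (Suc m) c i X T) else [])
          (extend m c (Suc i) (component c i u) (extend (Suc m) c i X T))
      else extend (Suc m) c i X T)"
  by simp

text \<open>Zero is listed explicitly because there may be no quotient at all, for instance if
  \<open>0\<close> is the only radius.\<close>

definition candidates :: "frac list list \<Rightarrow> frac list \<Rightarrow> frac list" where
  "candidates M rs = (0, 1) # concat (map (\<lambda>r. if fst r = 0 then []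
     else map (\<lambda>d. (fst d * snd r, snd d * fst r)) (concat M)) rs)"

definition hits :: "nat \<Rightarrow> problem \<Rightarrow> nat list \<Rightarrow> entry list" where
  "hits t c ks = filter (\<lambda>e. fst e = ks) (extend t c 0 (indices (fst c)) [(replicate t 0, [])])"

definition solutions :: "nat \<Rightarrow> frac list list \<Rightarrow> frac list \<Rightarrow> nat list \<Rightarrow> (frac \<times> nat list list) list" where
  "solutions t M rs ks =
     concat (map (\<lambda>a. map (\<lambda>e. (a, snd e)) (hits t (M, rs, a) ks)) (candidates M rs))"

text \<open>A running minimum of fractions, compared by cross-multiplication. The list of length at
  most one plays the role of an option.\<close>

definition best :: "(frac \<times> 'a) list \<Rightarrow> (frac \<times> 'a) list" where
  "best l = foldr (\<lambda>s b. if b = [] then [s]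
     else if fst (fst s) * snd (fst (hd b)) \<le> fst (fst (hd b)) * snd (fst s) then [s] else b) l []"

text \<open>The algorithm has to halt on every instance, so it returns a dummy value if no candidate
  succeeds.\<close>

definition solve :: "nat \<Rightarrow> frac list list \<Rightarrow> frac list \<Rightarrow> nat list \<Rightarrow> frac \<times> nat list list" where
  "solve t M rs ks = (if best (solutions t M rs ks) = [] then ((0, 1), []) else hd (best (solutions t M rs ks)))"

section \<open>Running time of the algorithm\<close>

lemma ptime_near:
  assumes "ptime D e enc_problem c" "ptime D e enc_unary i" "ptime D e enc_unary u" "ptime D e enc_unary v"
  shows "ptime D e ebool (\<lambda>x. near (c x) (i x) (u x) (v x))"
proof -
  have "ptime D e enc_matrix (\<lambda>x. fst (c x))" "ptime D e (enc_list enc_frac) (\<lambda>x. fst (snd (c x)))"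
    "ptime D e enc_frac (\<lambda>x. snd (snd (c x)))"
    by (rule ptime_fst ptime_snd assms)+
  note c = this this(3)[THEN ptime_fst] this(3)[THEN ptime_snd]
  have "ptime D e enc_frac (\<lambda>x. nth_or (0, 1) (nth_or [] (fst (c x)) (u x)) (v x))"
    "ptime D e enc_frac (\<lambda>x. nth_or (0, 1) (fst (snd (c x))) (i x))"
    by (intro ptime_nth_or c assms)+
  note this[THEN ptime_fst] this[THEN ptime_snd]
  then show ?thesis unfolding near_def by (intro ptime_le ptime_mult c)
qed

lemma ptime_component:
  assumes "ptime D e enc_problem c" "ptime D e enc_unary i" "ptime D e enc_unary u"
  shows "ptime D e enc_points (\<lambda>x. component (c x) (i x) (u x))"
proof -
  let ?e = "epair enc_problem (epair enc_unary enc_unary)"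
  let ?pts = "\<lambda>p :: problem \<times> nat \<times> nat. indices (fst (fst p))"
  have pts: "ptime UNIV ?e enc_points ?pts"
    by (intro ptime_indices; (rule ptime_acc)+)
  obtain p where p: "\<And>x. x \<in> UNIV \<Longrightarrow> size (enc_points (?pts x)) \<le> poly p (size (?e x))"
    using pts by (rule ptime_size) blast
  have "ptime UNIV ?e enc_points (\<lambda>p. foldr
      (\<lambda>y S. filter (\<lambda>v. \<exists>w\<in>set S. near (fst p) (fst (snd p)) w v) (?pts p)) (?pts p) [snd (snd p)])"
  proof (rule ptime_foldr[OF pts _ _ UNIV_I, where q = "p + [:1, 1:]"
        and g = "\<lambda>y S p. filter (\<lambda>v. \<exists>w\<in>set S. near (fst p) (fst (snd p)) w v) (?pts p)"])
    show "ptime UNIV ?e enc_points (\<lambda>p. [snd (snd p)])"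
      by (intro ptime_Cons ptime_const; (rule ptime_acc)+)
    show "ptime UNIV (epair enc_unary (epair enc_points ?e)) enc_points
      (\<lambda>q. filter (\<lambda>v. \<exists>w\<in>set (fst (snd q)). near (fst (snd (snd q))) (fst (snd (snd (snd q)))) w v)
         (?pts (snd (snd q))))"
      by (rule ptime_filter[OF _ _ UNIV_I, where a = enc_unary
            and g = "\<lambda>v q. \<exists>w\<in>set (fst (snd q)). near (fst (snd (snd q))) (fst (snd (snd (snd q)))) w v"],
          (intro ptime_indices; (rule ptime_acc)+),
          rule ptime_bex[OF _ _ UNIV_I, where a = enc_unary
            and g = "\<lambda>w p. near (fst (snd (snd (snd p)))) (fst (snd (snd (snd (snd p))))) w (fst p)"],
          (rule ptime_acc)+, intro ptime_near; (rule ptime_acc)+)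
    fix x ys zs
    \<comment> \<open>Every round filters the full list of points afresh, so states do not
      accumulate; the extra summand is for the initial list \<open>[v]\<close>.\<close>
    have "size (enc_points (foldr (\<lambda>y S. filter (P S) l) zs [v])) \<le> size (enc_points l) + v + 1"
      for l P and v :: nat
    proof (cases zs)
      case (Cons z zs')
      have "size (enc_points (filter Q l)) \<le> size (enc_points l)" for Q
        by (induction l) auto
      from le_trans[OF this] show ?thesis using Cons by simp
    qed simp
    from le_trans[OF this[of _ "?pts x" "snd (snd x)"]]
    show "size (enc_points (foldr (\<lambda>y S. filter (\<lambda>v. \<exists>w\<in>set S. near (fst x) (fst (snd x)) w v) (?pts x)) zs
        [snd (snd x)])) \<le> poly (p + [:1, 1:]) (size (?e x))"
      using p[of x] by simp
  qed
  from ptime_comp[OF ptime_pair[OF assms(1) ptime_pair[OF assms(2,3)]] this]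
  show ?thesis by (simp add: component_def)
qed

lemma ptime_is_representative:
  assumes "ptime D e enc_problem c" "ptime D e enc_unary i" "ptime D e enc_unary u"
  shows "ptime D e ebool (\<lambda>x. is_representative (c x) (i x) (u x))"
proof -
  note k = ptime_component[OF assms]
  show ?thesis
    unfolding is_representative_def
    by (rule ptime_conj[OF ptime_not[OF ptime_null[OF k]]
          ptime_unary_eq[OF ptime_hd[OF ptime_subset[OF k]] ptime_subset[OF assms(3)]]]) auto
qed

lemma ptime_has_center:
  assumes "ptime D e enc_problem c" "ptime D e enc_unary i" "ptime D e enc_points Y"
  shows "ptime D e ebool (\<lambda>x. has_center (c x) (i x) (Y x))"
proof -
  let ?e = "epair enc_problem (epair enc_unary enc_points)"
  have "ptime UNIV ?e ebool (\<lambda>p. \<exists>z\<in>set (snd (snd p)). \<forall>v\<in>set (snd (snd p)). near (fst p) (fst (snd p)) z v)"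
    by (rule ptime_bex[OF _ _ UNIV_I, where a = enc_unary
          and g = "\<lambda>z p. \<forall>v\<in>set (snd (snd p)). near (fst p) (fst (snd p)) z v"],
        (rule ptime_acc)+,
        rule ptime_ball[OF _ _ UNIV_I, where a = enc_unary
          and g = "\<lambda>v p. near (fst (snd p)) (fst (snd (snd p))) (fst p) v"],
        (rule ptime_acc)+, intro ptime_near; (rule ptime_acc)+)
  from ptime_comp[OF ptime_pair[OF assms(1) ptime_pair[OF assms(2,3)]] this]
  show ?thesis by (simp add: has_center_def)
qed

lemma ptime_add_cluster:
  assumes "ptime D e enc_unary n" "ptime D e enc_unary i" "ptime D e enc_points Y" "ptime D e enc_table T"
  shows "ptime D e enc_table (\<lambda>x. add_cluster (n x) (i x) (Y x) (T x))"
proof -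
  let ?e = "epair enc_unary (epair enc_unary (epair enc_points enc_table))"
  have "ptime UNIV ?e enc_table (\<lambda>p. map (\<lambda>e. (increment (fst (snd p)) (fst e), fst (snd (snd p)) # snd e))
      (filter (\<lambda>e. length (snd e) < fst p) (snd (snd (snd p)))))"
    by (rule ptime_map[OF _ _ UNIV_I, where a = enc_entry
          and g = "\<lambda>e p. (increment (fst (snd p)) (fst e), fst (snd (snd p)) # snd e)"],
        rule ptime_filter[OF _ _ UNIV_I, where g = "\<lambda>e p. length (snd e) < fst p"],
        (rule ptime_acc)+, (intro ptime_unary_less ptime_length; (rule ptime_acc)+),
        (intro ptime_pair ptime_increment ptime_Cons; (rule ptime_acc)+))
  from ptime_comp[OF ptime_pair[OF assms(1) ptime_pair[OF assms(2) ptime_pair[OF assms(3,4)]]] this]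
  show ?thesis by (simp add: add_cluster_def)
qed

lemma ptime_points_eq:
  "ptime D e enc_points f \<Longrightarrow> ptime D e enc_points g \<Longrightarrow> ptime D e ebool (\<lambda>x. f x = g x)"
  by (intro ptime_list_eq[where a = enc_unary] ptime_unary_eq)

lemma ptime_merge:
  assumes "ptime D e enc_table T1" "ptime D e enc_table T2"
  shows "ptime D e enc_table (\<lambda>x. merge (T1 x) (T2 x))"
proof -
  let ?e = "epair enc_table enc_table"
  have "ptime UNIV ?e enc_table (\<lambda>p. foldr (\<lambda>e T. if \<exists>e'\<in>set T. fst e' = fst e then T else e # T) (fst p) (snd p))"
  proof (rule ptime_foldr_growth[where a = enc_entry and r = "[:0, 1:]"
        and g = "\<lambda>e T p. if \<exists>e'\<in>set T. fst e' = fst e then T else e # T"])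
    have "ptime UNIV (epair enc_entry (epair enc_table ?e)) ebool (\<lambda>p. \<exists>e'\<in>set (fst (snd p)). fst e' = fst (fst p))"
      by (rule ptime_bex[OF _ _ UNIV_I, where a = enc_entry and g = "\<lambda>e' p. fst e' = fst (fst p)"],
          (rule ptime_acc)+, intro ptime_points_eq; (rule ptime_acc)+)
    then show "ptime UNIV (epair enc_entry (epair enc_table ?e)) enc_table
        (\<lambda>p. if \<exists>e'\<in>set (fst (snd p)). fst e' = fst (fst p) then fst (snd p) else fst p # fst (snd p))"
      by (rule ptime_if) (rule ptime_acc ptime_Cons)+
    fix p :: "entry list \<times> entry list" and y T assume "y \<in> set (fst p)"
    from size_in_enc_list[OF this, of enc_entry]
    show "size (enc_table (if \<exists>e'\<in>set T. fst e' = fst y then T else y # T)) \<le> size (enc_table T) + poly [:0, 1:] (size (?e p))"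
      by auto
  qed (rule ptime_acc)+
  from ptime_comp[OF ptime_pair[OF assms] this] show ?thesis by (simp add: merge_def)
qed

text \<open>Only polynomially many entries with different counts exist, as the number of classes is constant.\<close>

definition bounded_table :: "nat \<Rightarrow> nat \<Rightarrow> entry list \<Rightarrow> bool" where
  "bounded_table t n T \<longleftrightarrow> distinct (map fst T) \<and>
     (\<forall>e\<in>set T. length (fst e) = t \<and> sum_list (fst e) \<le> length (snd e) \<and> length (snd e) \<le> n \<and>
        (\<forall>Y\<in>set (snd e). length Y \<le> n \<and> (\<forall>y\<in>set Y. y < n)))"

text \<open>Merging may drop solutions but no vector of counts; completeness therefore follows the
  counts only.\<close>

lemma merge_keys: "fst ` set (merge T1 T2) = fst ` set T1 \<union> fst ` set T2"
proof (induction T1)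
  case (Cons e T1)
  have step: "merge (e # T1) T2 = (if fst e \<in> fst ` set (merge T1 T2) then merge T1 T2 else e # merge T1 T2)"
  proof -
    have "fst e \<in> fst ` X \<longleftrightarrow> (\<exists>e'\<in>X. fst e' = fst e)" for X :: "entry set"
      unfolding image_iff by metis
    then show ?thesis by (simp add: merge_def)
  qed
  show ?case unfolding step using Cons by auto
qed (simp add: merge_def)

lemma merge_subset: "set (merge T1 T2) \<subseteq> set T1 \<union> set T2"
  unfolding merge_def by (induction T1) auto

lemma distinct_merge: "distinct (map fst T2) \<Longrightarrow> distinct (map fst (merge T1 T2))"
  unfolding merge_def by (induction T1) (auto simp: image_iff)

lemma bounded_table_merge:
  "bounded_table t n T2 \<Longrightarrow> bounded_table t n T1 \<Longrightarrow> bounded_table t n (merge T1 T2)"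
  using merge_subset[of T1 T2] distinct_merge[of T2 T1] unfolding bounded_table_def by blast

lemma length_increment [simp]: "length (increment i xs) = length xs"
  by (induction i xs rule: increment.induct) auto

lemma sum_list_increment_le: "sum_list (increment i xs) \<le> Suc (sum_list xs)"
  by (induction i xs rule: increment.induct) auto

lemma increment_inject: "increment i xs = increment i ys \<longleftrightarrow> xs = ys"
proof (induction i xs arbitrary: ys rule: increment.induct)
  case (1 i ys)
  then show ?case by (cases ys) auto
next
  case (2 i x xs ys)
  then show ?case by (cases ys) auto
qed

text \<open>Distinct keys stay distinct as \<open>increment i\<close> is injective. The condition on
  \<open>Y\<close> is restricted to positive \<open>n\<close> because a component computed from an
  empty matrix still contains its start; for \<open>n = 0\<close> the filter removes every
  entry.\<close>

lemma bounded_table_add_cluster: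
  assumes "bounded_table t n T" "n > 0 \<Longrightarrow> length Y \<le> n \<and> (\<forall>y\<in>set Y. y < n)"
  shows "bounded_table t n (add_cluster n i Y T)"
proof -
  have "distinct (map (increment i) (map fst (filter (\<lambda>e. length (snd e) < n) T)))"
    using assms(1) unfolding bounded_table_def
    by (subst distinct_map) (auto simp: distinct_map_filter inj_on_def increment_inject)
  moreover have "sum_list (increment i v) \<le> Suc m" if "sum_list v \<le> m" for v m
    using sum_list_increment_le[of i v] that by simp
  ultimately show ?thesis
    using assms unfolding bounded_table_def add_cluster_def by (auto simp: o_def)
qed

lemma component_bounded:
  assumes "fst c \<noteq> []"
  shows "length (component c i u) \<le> length (fst c) \<and> (\<forall>y\<in>set (component c i u). y < length (fst c))"
proof -
  obtain P where "component c i u = filter P (indices (fst c))"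
    unfolding component_def using assms by (cases "fst c") auto
  then show ?thesis
    using length_filter_le[of P "indices (fst c)"] by (auto simp: indices_eq)
qed

lemma bounded_table_extend:
  "bounded_table t (length (fst c)) T \<Longrightarrow> bounded_table t (length (fst c)) (extend m c i X T)"
proof (induction m arbitrary: i X T)
  case 0
  then show ?case by (simp add: bounded_table_def)
next
  case (Suc m)
  show ?case
    using Suc.prems
  proof (induction X arbitrary: T)
    case (Cons u X)
    let ?T = "extend (Suc m) c i X T"
    have T: "bounded_table t (length (fst c)) ?T" using Cons by simp
    have "bounded_table t (length (fst c)) (add_cluster (length (fst c)) i (component c i u) ?T)"
      by (rule bounded_table_add_cluster[OF T]) (auto dest: component_bounded)
    moreover have "bounded_table t (length (fst c)) []" by (simp add: bounded_table_def)
    ultimately show ?case using T Suc.IH[OF T]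
      by (auto intro!: bounded_table_merge)
  qed simp
qed

text \<open>The power counts the vectors of length \<open>t\<close> with entries up to
  \<open>n\<close>. The other factor bounds one entry: its counts in unary, and at most
  \<open>n\<close> clusters of at most \<open>n\<close> points below \<open>n\<close>.\<close>

lemma size_bounded_table:
  assumes "bounded_table t n T"
  shows "size (enc_table T) \<le> (n + 1) ^ t * (n + t + n * (n * n + 1) + 2)"
proof -
  have le: "size (enc_entry e) + 1 \<le> n + t + n * (n * n + 1) + 2" if "e \<in> set T" for e
  proof -
    have e: "length (fst e) = t" "sum_list (fst e) \<le> n" "length (snd e) \<le> n"
      "\<And>Y. Y \<in> set (snd e) \<Longrightarrow> length Y \<le> n \<and> (\<forall>y\<in>set Y. y < n)"
      using assms that unfolding bounded_table_def by fastforce+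
    have "size (enc_points Y) = sum_list Y + length Y" for Y
      by (induction Y) auto
    note this[of "fst e"]
    moreover have "size (enc_list enc_points (snd e)) \<le> n * (n * n + 1)"
    proof -
      have "size (enc_points Y) + 1 \<le> n * n + 1" if "Y \<in> set (snd e)" for Y
      proof -
        have "(\<Sum>y\<leftarrow>Y. size (enc_unary y) + 1) \<le> (\<Sum>y\<leftarrow>Y. n)"
          using e(4)[OF that] by (intro sum_list_mono) auto
        also have "\<dots> \<le> n * n" using e(4)[OF that] by (simp add: sum_list_triv)
        finally show ?thesis by (simp add: size_enc_list)
      qed
      then have "(\<Sum>Y\<leftarrow>snd e. size (enc_points Y) + 1) \<le> (\<Sum>Y\<leftarrow>snd e. n * n + 1)"
        by (rule sum_list_mono)
      also have "\<dots> = length (snd e) * (n * n + 1)" by (simp only: sum_list_triv of_nat_id)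
      also have "\<dots> \<le> n * (n * n + 1)" using e(3) by (rule mult_right_mono) simp
      finally show ?thesis unfolding size_enc_list[of enc_points] .
    qed
    ultimately show ?thesis using e(1,2) by simp
  qed
  have "fst ` set T \<subseteq> {v. set v \<subseteq> {0..n} \<and> length v = t}"
  proof
    fix v assume "v \<in> fst ` set T"
    then obtain e where e: "e \<in> set T" "v = fst e" by blast
    then have "length v = t" "sum_list v \<le> length (snd e)" "length (snd e) \<le> n"
      using assms unfolding bounded_table_def by blast+
    moreover have "x \<le> sum_list v" if "x \<in> set v" for x using member_le_sum_list[of x v] that by simp
    ultimately show "v \<in> {v. set v \<subseteq> {0..n} \<and> length v = t}" by fastforce
  qed
  from card_mono[OF _ this] have "card (fst ` set T) \<le> (n + 1) ^ t"
    by (simp add: finite_lists_length_eq card_lists_length_eq)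
  then have len: "length T \<le> (n + 1) ^ t"
    using assms distinct_card[of "map fst T"] unfolding bounded_table_def by simp
  have "size (enc_table T) \<le> (\<Sum>e\<leftarrow>T. n + t + n * (n * n + 1) + 2)"
    unfolding size_enc_list using le by (intro sum_list_mono) auto
  also have "\<dots> = length T * (n + t + n * (n * n + 1) + 2)" by (simp only: sum_list_triv of_nat_id)
  also have "\<dots> \<le> (n + 1) ^ t * (n + t + n * (n * n + 1) + 2)" using len by (rule mult_right_mono) simp
  finally show ?thesis .
qed

text \<open>Each class wraps one more fold around the program for the remaining classes, so both the
  program and its polynomial depend on \<open>m\<close>; this is possible because the number of
  classes is constant. The restriction to bounded tables supplies the size bounds for the states of
  the folds.\<close>

lemma ptime_extend_aux:
  "ptime {p. bounded_table t (length (fst (fst p))) (snd (snd (snd p)))}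
     (epair enc_problem (epair enc_unary (epair enc_points enc_table))) enc_table
     (\<lambda>p. extend m (fst p) (fst (snd p)) (fst (snd (snd p))) (snd (snd (snd p))))"
proof (induction m)
  case 0
  have "ptime D (epair enc_problem (epair enc_unary (epair enc_points enc_table))) enc_table
      (\<lambda>p. if fst (snd (snd p)) = [] then snd (snd (snd p)) else [])" for D
    by (intro ptime_if ptime_null ptime_const; (rule ptime_acc)+)
  then show ?case by simp
next
  case (Suc m)
  let ?e = "epair enc_problem (epair enc_unary (epair enc_points enc_table))"
  let ?D = "{p. bounded_table t (length (fst (fst p))) (snd (snd (snd p)))} ::
    (problem \<times> nat \<times> nat list \<times> entry list) set"
  let ?c = "\<lambda>q :: nat \<times> entry list \<times> problem \<times> nat \<times> nat list \<times> entry list. fst (snd (snd q))"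
  let ?i = "\<lambda>q :: nat \<times> entry list \<times> problem \<times> nat \<times> nat list \<times> entry list. fst (snd (snd (snd q)))"
  let ?E = "{q. bounded_table t (length (fst (?c q))) (fst (snd q))}"
  let ?e' = "epair enc_unary (epair enc_table ?e)"
  let ?g = "\<lambda>u T p. if is_representative (fst p) (fst (snd p)) u then
         merge
           (if has_center (fst p) (fst (snd p)) (component (fst p) (fst (snd p)) u)
            then add_cluster (length (fst (fst p))) (fst (snd p)) (component (fst p) (fst (snd p)) u) T else [])
           (extend m (fst p) (Suc (fst (snd p))) (component (fst p) (fst (snd p)) u) T)
       else T"
  let ?q = "[:1, 1:] ^ t * ([:t + 2, 1:] + [:0, 1:] * ([:0, 1:] * [:0, 1:] + 1))"
  have q: "poly ?q s = (s + 1) ^ t * (s + t + s * (s * s + 1) + 2)" for s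
    by (simp add: poly_power algebra_simps)
  have c: "ptime E ?e' enc_problem ?c" and i: "ptime E ?e' enc_unary ?i"
    and u: "ptime E ?e' enc_unary fst" and T: "ptime E ?e' enc_table (\<lambda>q. fst (snd q))"
    and n: "ptime E ?e' enc_unary (\<lambda>q. length (fst (?c q)))" for E
    by (rule ptime_length ptime_acc)+
  have comp: "ptime E ?e' enc_points (\<lambda>q. component (?c q) (?i q) (fst q))" for E
    by (intro ptime_component c i u)
  have "ptime ?E ?e' enc_table (\<lambda>q. (\<lambda>p. extend m (fst p) (fst (snd p)) (fst (snd (snd p))) (snd (snd (snd p))))
      (?c q, Suc (?i q), component (?c q) (?i q) (fst q), fst (snd q)))"
    by (rule ptime_comp[OF ptime_pair[OF c ptime_pair[OF ptime_Suc[OF i] ptime_pair[OF comp T]]] Suc.IH]) simp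
  then have rec: "ptime ?E ?e' enc_table (\<lambda>q. extend m (?c q) (Suc (?i q)) (component (?c q) (?i q) (fst q)) (fst (snd q)))"
    by simp
  have "ptime ?D ?e enc_table (\<lambda>p. foldr (\<lambda>u T. ?g u T p) (fst (snd (snd p))) (snd (snd (snd p))))"
  proof (rule ptime_foldr[where E = ?E and a = enc_unary and g = ?g
        and q = ?q])
    show "ptime ?E ?e' enc_table (\<lambda>q. ?g (fst q) (fst (snd q)) (snd (snd q)))"
      by (rule ptime_if[OF ptime_is_representative[OF c i u] ptime_merge[OF
              ptime_if[OF ptime_has_center[OF c i comp] ptime_add_cluster[OF n i comp T] ptime_const]
              ptime_subset[OF rec]] T]) auto
    \<comment> \<open>An intermediate table of the fold is itself a value of \<open>extend\<close>,
      on a suffix of the list of points.\<close>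
    have inv: "bounded_table t (length (fst (fst p))) (foldr (\<lambda>u T. ?g u T p) zs (snd (snd (snd p))))"
      if "p \<in> ?D" for p zs
      using bounded_table_extend[of t "fst p" "snd (snd (snd p))" "Suc m" "fst (snd p)" zs] that by simp
    show "(y, foldr (\<lambda>y st. ?g y st x) zs (snd (snd (snd x))), x) \<in> ?E"
      if "x \<in> ?D" "fst (snd (snd x)) = ys @ y # zs" for x y ys zs
      using inv[OF that(1), of zs] by simp
    fix p ys zs assume p: "p \<in> ?D"
    let ?n = "length (fst (fst p))" and ?s = "size (?e p)"
    have n: "?n \<le> ?s" using length_le_size_enc_list[of "fst (fst p)" "enc_list enc_frac"] by simp
    note size_bounded_table[OF inv[OF p, of zs]]
    also have "(?n + 1) ^ t * (?n + t + ?n * (?n * ?n + 1) + 2) \<le> (?s + 1) ^ t * (?s + t + ?s * (?s * ?s + 1) + 2)"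
      using n by (intro mult_mono add_mono power_mono) auto
    finally show "size (enc_table (foldr (\<lambda>u T. ?g u T p) zs (snd (snd (snd p))))) \<le>
        poly ?q (size (?e p))"
      by (simp only: q)
  qed ((rule ptime_acc)+)
  then show ?case by simp
qed

lemma ptime_hits:
  assumes "ptime D e enc_problem c" "ptime D e (enc_list enc_nat) ks"
  shows "ptime D e enc_table (\<lambda>x. hits t (c x) (ks x))"
proof -
  have pts: "ptime D e enc_points (\<lambda>x. indices (fst (c x)))"
    by (intro ptime_indices ptime_fst) (rule assms)
  have "ptime D e enc_table (\<lambda>x. (\<lambda>p. extend t (fst p) (fst (snd p)) (fst (snd (snd p))) (snd (snd (snd p))))
      (c x, 0, indices (fst (c x)), [(replicate t 0, [])]))"
    by (rule ptime_comp[OF ptime_pair[OF assms(1) ptime_pair[OF ptime_const ptime_pair[OF pts ptime_const]]]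
          ptime_extend_aux[of t]]) (simp add: bounded_table_def sum_list_replicate)
  then have ext: "ptime D e enc_table (\<lambda>x. extend t (c x) 0 (indices (fst (c x))) [(replicate t 0, [])])" by simp
  let ?e = "epair (enc_list enc_nat) enc_table"
  have "ptime UNIV ?e enc_table (\<lambda>p. filter (\<lambda>e. fst e = fst p) (snd p))"
  proof (rule ptime_filter[OF _ _ UNIV_I, where a = enc_entry and g = "\<lambda>e p. fst e = fst p"])
    \<comment> \<open>Mapping the identity changes the encoding: unary counts become binary and
      comparable with the given multiplicities.\<close>
    have "ptime UNIV (epair enc_entry ?e) (enc_list enc_nat) (\<lambda>p. map (\<lambda>k. k) (fst (fst p)))"
      by (rule ptime_map[OF _ _ UNIV_I, where a = enc_unary and g = "\<lambda>k p. k"];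
        (intro ptime_unary_to_binary)?; (rule ptime_acc)+)
    then have k: "ptime UNIV (epair enc_entry ?e) (enc_list enc_nat) (\<lambda>p. fst (fst p))" by simp
    show "ptime UNIV (epair enc_entry ?e) ebool (\<lambda>p. fst (fst p) = fst (snd p))"
      by (rule ptime_list_eq[where a = enc_nat, OF ptime_eq k]) (assumption | rule ptime_acc)+
  qed (rule ptime_acc)+
  from ptime_comp[OF ptime_pair[OF assms(2) ext] this] show ?thesis by (simp add: hits_def)
qed

abbreviation "enc_input \<equiv> epair enc_matrix (epair (enc_list enc_frac) (enc_list enc_nat))"

lemma ptime_candidates:
  "ptime UNIV enc_input (enc_list enc_frac) (\<lambda>x. candidates (fst x) (fst (snd x)))"
proof -
  let ?f = "\<lambda>r d. (fst d * snd r, snd d * fst r) :: frac"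
  have "ptime UNIV (epair enc_frac enc_input) (enc_list enc_frac)
      (\<lambda>p. map (\<lambda>d. ?f (fst p) d) (concat (fst (snd p))))"
    by (rule ptime_map[OF _ _ UNIV_I, where a = enc_frac and g = "\<lambda>d p. ?f (fst p) d"])
      ((intro ptime_concat ptime_pair ptime_mult; (rule ptime_acc)+)+)
  note row = this[THEN ptime_UNIV]
  have "ptime UNIV enc_input (enc_list (enc_list enc_frac))
      (\<lambda>x. map (\<lambda>r. if fst r = 0 then [] else map (\<lambda>d. ?f r d) (concat (fst x))) (fst (snd x)))"
    by (rule ptime_map[OF _ _ UNIV_I, where a = enc_frac
          and g = "\<lambda>r x. if fst r = 0 then [] else map (\<lambda>d. ?f r d) (concat (fst x))"],
        (rule ptime_acc)+, intro ptime_if ptime_zero ptime_const row; (rule ptime_acc)+)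
  then show ?thesis unfolding candidates_def by (intro ptime_Cons ptime_const ptime_concat)
qed

lemma ptime_solutions:
  "ptime UNIV enc_input (enc_list (epair enc_frac (enc_list enc_points)))
     (\<lambda>x. solutions t (fst x) (fst (snd x)) (snd (snd x)))"
proof -
  let ?e = "epair enc_frac enc_input"
  let ?hits = "\<lambda>p. hits t (fst (snd p), fst (snd (snd p)), fst p) (snd (snd (snd p)))"
  have "ptime UNIV ?e enc_table ?hits"
    by (intro ptime_hits ptime_pair; (rule ptime_acc)+)
  then have "ptime UNIV ?e (enc_list (epair enc_frac (enc_list enc_points))) (\<lambda>p. map (\<lambda>e. (fst p, snd e)) (?hits p))"
    by (rule ptime_map[OF _ _ UNIV_I, where g = "\<lambda>e p. (fst p, snd e)"])
      (intro ptime_pair; (rule ptime_acc)+)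
  then have "ptime UNIV enc_input (enc_list (enc_list (epair enc_frac (enc_list enc_points))))
      (\<lambda>x. map (\<lambda>a. map (\<lambda>e. (a, snd e)) (hits t (fst x, fst (snd x), a) (snd (snd x)))) (candidates (fst x) (fst (snd x))))"
    by (intro ptime_map[OF ptime_candidates _ UNIV_I,
          where g = "\<lambda>a x. map (\<lambda>e. (a, snd e)) (hits t (fst x, fst (snd x), a) (snd (snd x)))"])
  then show ?thesis unfolding solutions_def by (rule ptime_concat)
qed

lemma best_subset: "set (best l) \<subseteq> set l" and length_best: "length (best l) \<le> 1"
  unfolding best_def by (induction l) auto

lemma ptime_best:
  assumes "ptime D e (enc_list (epair enc_frac a)) f"
  shows "ptime D e (enc_list (epair enc_frac a)) (\<lambda>x. best (f x))"
proof -
  let ?a = "epair enc_frac a"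
  let ?g = "\<lambda>s b. if b = [] then [s]
     else if fst (fst s) * snd (fst (hd b)) \<le> fst (fst (hd b)) * snd (fst s) then [s] else b"
  obtain p where p: "\<And>x. x \<in> D \<Longrightarrow> size (enc_list ?a (f x)) \<le> poly p (size (e x))"
    using assms by (rule ptime_size) blast
  have "ptime D e (enc_list ?a) (\<lambda>x. foldr (\<lambda>s b. ?g s b) (f x) [])"
  proof (rule ptime_foldr[OF assms ptime_const _ UNIV_I, where q = p and g = "\<lambda>s b x. ?g s b"])
    show "ptime UNIV (epair ?a (epair (enc_list ?a) e)) (enc_list ?a) (\<lambda>q. ?g (fst q) (fst (snd q)))"
    proof -
      let ?e = "epair ?a (epair (enc_list ?a) e)"
      have s: "ptime E ?e ?a fst" and b: "ptime E ?e (enc_list ?a) (\<lambda>q. fst (snd q))" for E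
        by (rule ptime_acc)+
      have h: "ptime {q \<in> UNIV. fst (snd q) \<noteq> []} ?e ?a (\<lambda>q. hd (fst (snd q)))"
        by (rule ptime_hd[OF b]) simp
      show ?thesis
        by (rule ptime_if[OF ptime_null[OF b] ptime_Cons[OF s ptime_const] ptime_if[OF ptime_le[OF
                  ptime_mult[OF s[THEN ptime_fst, THEN ptime_fst] h[THEN ptime_fst, THEN ptime_snd]]
                  ptime_mult[OF h[THEN ptime_fst, THEN ptime_fst] s[THEN ptime_fst, THEN ptime_snd]]]
                ptime_Cons[OF s ptime_const] b]])
    qed
    fix x ys zs assume x: "x \<in> D" "f x = ys @ zs"
    have "size (enc_list ?a (best zs)) \<le> size (enc_list ?a zs)"
    proof (cases "best zs")
      case (Cons s l)
      then have "l = []" "s \<in> set zs" using length_best[of zs] best_subset[of zs] by auto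
      then show ?thesis using Cons size_in_enc_list[of s zs ?a] by simp
    qed simp
    also have "\<dots> \<le> size (enc_list ?a (f x))" by (simp add: x size_enc_list_append)
    also note p[OF x(1)]
    finally show "size (enc_list ?a (foldr (\<lambda>s b. ?g s b) zs [])) \<le> poly p (size (e x))"
      unfolding best_def .
  qed
  then show ?thesis unfolding best_def .
qed

lemma ptime_solve:
  "ptime UNIV enc_input (epair enc_frac (enc_list (enc_list enc_nat))) (\<lambda>x. solve t (fst x) (fst (snd x)) (snd (snd x)))"
proof -
  note b = ptime_best[OF ptime_solutions, THEN ptime_UNIV]
  have 1: "ptime UNIV enc_input (epair enc_frac (enc_list enc_points)) (\<lambda>x. solve t (fst x) (fst (snd x)) (snd (snd x)))"
    unfolding solve_def by (rule ptime_if[OF ptime_null[OF b] ptime_const ptime_hd[OF b]]) simp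
  have "ptime UNIV (epair enc_points (epair enc_frac (enc_list enc_points))) (enc_list enc_nat) (\<lambda>p. map (\<lambda>k. k) (fst p))"
    by (rule ptime_map[OF _ _ UNIV_I, where a = enc_unary and g = "\<lambda>k p. k"];
      (intro ptime_unary_to_binary)?; (rule ptime_acc)+)
  then have "ptime UNIV (epair enc_frac (enc_list enc_points)) (enc_list (enc_list enc_nat)) (\<lambda>p. map (\<lambda>Y. map (\<lambda>k. k) Y) (snd p))"
    by (intro ptime_map[OF _ _ UNIV_I, where a = enc_points and g = "\<lambda>Y p. map (\<lambda>k. k) Y"]) (rule ptime_acc)+
  then have "ptime UNIV (epair enc_frac (enc_list enc_points)) (enc_list (enc_list enc_nat)) snd" by simp
  from ptime_comp[OF 1 ptime_pair[OF ptime_fst[OF ptime_id] this]] show ?thesis by simp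
qed

text \<open>The entry point of a program is function \<open>0\<close>, so the main expression is put
  in front and the rest moves by one.\<close>

lemma ptime_runs:
  assumes "ptime D e a f"
  obtains prog p where "\<And>x. x \<in> D \<Longrightarrow> \<exists>n \<le> poly p (size (e x)). runs prog (e x) (a (f x)) n"
proof -
  obtain Q ex p where c: "computes Q ex p D e a f" using assms unfolding ptime_def by blast
  let ?P = "[shift 1 ex] @ map (shift 1) Q"
  show ?thesis
  proof (rule that[of "p + 2" ?P])
    fix x assume "x \<in> D"
    then obtain n where n: "n \<le> poly p (size (e x))" "eval Q ex (e x) (a (f x)) n"
      using c unfolding computes_def by blast
    have "eval ?P (?P ! 0) (e x) (a (f x)) n"
      using eval_shift[OF n(2), of "[shift 1 ex]"] by simp
    then have "eval ?P (Call 0 Inp) (e x) (a (f x)) (1 + n + 1)"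
      by (intro eval.Call[OF eval.Inp]) auto
    then show "\<exists>n \<le> poly (p + 2) (size (e x)). runs ?P (e x) (a (f x)) n"
      using n(1) unfolding runs_def by (intro exI[of _ "1 + n + 1"]) simp
  qed
qed

section \<open>Clusterings labelled by radius classes\<close>

text \<open>Here clusters are counted by class instead of balls, which makes labels exchangeable.
  Clusters of one class may have the same center; \<open>labelled_placement\<close> repairs this
  with additional centers.\<close>

definition labelled ::
  "'a set \<Rightarrow> ('a \<Rightarrow> 'a \<Rightarrow> real) \<Rightarrow> real list \<Rightarrow> nat list \<Rightarrow> real \<Rightarrow> 'a set set \<Rightarrow> ('a set \<Rightarrow> nat) \<Rightarrow> bool"
  where
  "labelled P d rs ks \<alpha> \<C> j \<longleftrightarrow>
     partition_on P \<C> \<and> (\<forall>C\<in>\<C>. j C < length rs) \<and>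
     (\<forall>i<length rs. card {C \<in> \<C>. j C = i} = ks ! i) \<and>
     (\<forall>C\<in>\<C>. \<exists>c\<in>P. C \<subseteq> nball P d c (\<alpha> * rs ! j C))"

section \<open>Finite partitions and their rearrangement\<close>

lemma card_partition_le:
  assumes "finite P" "partition_on P \<C>" shows "card \<C> \<le> card P"
proof -
  have fin: "finite \<C>" using assms by (rule finite_elements)
  have finC: "finite C" if "C \<in> \<C>" for C
    using partition_onD1[OF assms(2)] that by (intro finite_subset[OF _ assms(1)]) auto
  have "card \<C> = (\<Sum>C\<in>\<C>. 1)" by simp
  also have "\<dots> \<le> (\<Sum>C\<in>\<C>. card C)"
  proof (rule sum_mono)
    fix C assume "C \<in> \<C>"
    then have "C \<noteq> {}" "finite C" using partition_onD3[OF assms(2)] finC by auto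
    then show "1 \<le> card C" by (simp add: Suc_le_eq card_gt_0_iff)
  qed
  also have "\<dots> = card P" using product_partition[OF assms(2)] finC by simp
  finally show ?thesis .
qed

lemma partition_inter: "partition_on P \<C> \<Longrightarrow> C \<in> \<C> \<Longrightarrow> D \<in> \<C> \<Longrightarrow> x \<in> C \<Longrightarrow> x \<in> D \<Longrightarrow> C = D"
  by (metis disjoint_iff disjointD partition_onD2)

lemma partition_large_part:
  assumes "finite P" "partition_on P \<C>" "card \<C> < card P"
  obtains D u v where "D \<in> \<C>" "u \<in> D" "v \<in> D" "u \<noteq> v"
proof -
  have "\<exists>D\<in>\<C>. card D \<noteq> 1"
  proof (rule ccontr)
    assume "\<not> ?thesis"
    then have "(\<Sum>C\<in>\<C>. card C) = card \<C>" by simp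
    moreover have "card P = (\<Sum>C\<in>\<C>. card C)"
      using partition_onD1[OF assms(2)] assms(1)
      by (intro product_partition[OF assms(2)] finite_subset[OF _ assms(1)]) auto
    ultimately show False using assms(3) by simp
  qed
  then obtain D where D: "D \<in> \<C>" "card D \<noteq> 1" by blast
  then have "D \<noteq> {}" using partition_onD3[OF assms(2)] by metis
  then obtain u where "u \<in> D" by blast
  moreover have "D \<noteq> {u}" using D by auto
  ultimately show ?thesis using D(1) that by blast
qed

lemma partition_on_union:
  assumes "A \<inter> B = {}" "partition_on A \<C>" "partition_on B \<D>"
  shows "partition_on (A \<union> B) (\<C> \<union> \<D>)"
proof (rule partition_onI)
  show "\<Union>(\<C> \<union> \<D>) = A \<union> B" using assms(2,3)[THEN partition_onD1] by simp
  show "{} \<notin> \<C> \<union> \<D>" using assms(2,3)[THEN partition_onD3] by simp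
  fix C D assume CD: "C \<in> \<C> \<union> \<D>" "D \<in> \<C> \<union> \<D>" "C \<noteq> D"
  have sub: "X \<in> \<C> \<Longrightarrow> X \<subseteq> A" "X \<in> \<D> \<Longrightarrow> X \<subseteq> B" for X
    using assms(2,3)[THEN partition_onD1] by auto
  consider "C \<in> \<C>" "D \<in> \<C>" | "C \<in> \<D>" "D \<in> \<D>" | "C \<subseteq> A" "D \<subseteq> B" | "C \<subseteq> B" "D \<subseteq> A"
    using CD(1,2) sub by blast
  then show "disjnt C D"
  proof cases
    case 1
    then show ?thesis using disjointD[OF partition_onD2[OF assms(2)]] CD(3) by (simp add: disjnt_def)
  next
    case 2
    then show ?thesis using disjointD[OF partition_onD2[OF assms(3)]] CD(3) by (simp add: disjnt_def)
  qed (use assms(1) in \<open>auto simp: disjnt_def\<close>)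
qed

lemma repartition:
  assumes fin: "finite P" and part: "partition_on P \<C>" and S: "S \<subseteq> \<C>"
    and S': "partition_on (\<Union>S) S'" and card: "card S' = card S"
  shows "partition_on P (\<C> - S \<union> S')" "card (\<C> - S \<union> S') = card \<C>"
proof -
  have "partition_on (\<Union>(\<C> - S)) (\<C> - S)"
    using part by (auto simp: partition_on_def disjoint_def)
  moreover have disj: "\<Union>(\<C> - S) \<inter> \<Union>S = {}"
    using part S by (fastforce simp: partition_on_def disjoint_def)
  moreover have "\<Union>(\<C> - S) \<union> \<Union>S = P"
    using part S by (auto simp: partition_on_def)
  ultimately show "partition_on P (\<C> - S \<union> S')"
    using S' by (metis partition_on_union)
  have finC: "finite \<C>" using fin part by (rule finite_elements)
  have "finite (\<Union>S)" using partition_onD1[OF part] S by (intro finite_subset[OF _ fin]) auto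
  then have "finite S'" using S' by (rule finite_elements)
  moreover have "(\<C> - S) \<inter> S' = {}"
  proof safe
    fix C assume "C \<in> \<C>" "C \<notin> S" "C \<in> S'"
    then have "C \<subseteq> \<Union>(\<C> - S) \<inter> \<Union>S" "C \<noteq> {}"
      using S' part by (auto simp: partition_on_def)
    then show "C \<in> {}" using disj by simp
  qed
  ultimately have "card (\<C> - S \<union> S') = card (\<C> - S) + card S'"
    using finC by (intro card_Un_disjoint) auto
  then show "card (\<C> - S \<union> S') = card \<C>"
    using card finC S by (simp add: card_Diff_subset finite_subset card_mono)
qed

text \<open>As long as there are fewer parts than points, some part has two points and one of them
  can be split off.\<close>

lemma refine_partition:
  assumes "finite P" "partition_on P \<C>" "card \<C> \<le> m" "m \<le> card P"
  shows "\<exists>\<D>. partition_on P \<D> \<and> card \<D> = m \<and> (\<forall>D\<in>\<D>. \<exists>C\<in>\<C>. D \<subseteq> C)"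
  using assms(3,4)
proof (induction m rule: dec_induct)
  case base
  then show ?case using assms(2) by blast
next
  case (step m)
  then obtain \<D> where D: "partition_on P \<D>" "card \<D> = m" "\<forall>D\<in>\<D>. \<exists>C\<in>\<C>. D \<subseteq> C" by auto
  obtain D u v where Duv: "D \<in> \<D>" "u \<in> D" "v \<in> D" "u \<noteq> v"
    using partition_large_part[OF assms(1) D(1)] D(2) step.prems by auto
  let ?D = "\<D> - {D} \<union> {{u}, D - {u}}"
  have finD: "finite \<D>" using assms(1) D(1) by (rule finite_elements)
  have "partition_on P ?D"
  proof -
    have "partition_on (P - D) (\<D> - {D})"
      using D(1) Duv(1) by (fastforce simp: partition_on_def disjoint_def)
    moreover have "partition_on D {{u}, D - {u}}"
      using Duv by (auto simp: partition_on_def disjoint_def)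
    ultimately have "partition_on ((P - D) \<union> D) ?D" by (intro partition_on_union) auto
    moreover have "(P - D) \<union> D = P" using D(1) Duv(1) by (auto simp: partition_on_def)
    ultimately show ?thesis by simp
  qed
  moreover have "card ?D = Suc m"
  proof -
    have "{u} \<notin> \<D>" "D - {u} \<notin> \<D>"
      using partition_inter[OF D(1) _ Duv(1), of "{u}" u] partition_inter[OF D(1) _ Duv(1), of "D - {u}" v] Duv
      by auto
    moreover have "{u} \<noteq> D - {u}" by auto
    ultimately have "card ?D = card (\<D> - {D}) + 2"
      using finD by (subst card_Un_disjoint) auto
    then show ?thesis using finD D(2) Duv(1) by (simp add: card_Diff_singleton) (metis card_gt_0_iff empty_iff Suc_pred)
  qed
  moreover have "\<forall>D\<in>?D. \<exists>C\<in>\<C>. D \<subseteq> C"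
  proof -
    obtain C where "C \<in> \<C>" "D \<subseteq> C" using D(3) Duv(1) by blast
    then have "\<forall>X\<in>{{u}, D - {u}}. \<exists>C\<in>\<C>. X \<subseteq> C" using Duv(2) by blast
    then show ?thesis using D(3) by blast
  qed
  ultimately show ?case by blast
qed

section \<open>Labellings and placements\<close>

locale radius_classes =
  fixes P :: "'a set" and rs :: "real list" and ks :: "nat list"
  assumes finite_points: "finite P"
    and length_ks: "length ks = length rs"
    and decreasing: "sorted_wrt (>) rs"
    and radii_nonneg: "\<forall>r\<in>set rs. 0 \<le> r"
begin

lemma radius_mono: "i \<le> k \<Longrightarrow> k < length rs \<Longrightarrow> rs ! k \<le> rs ! i"
  using decreasing sorted_wrt_nth_less[of "(>)" rs i k] by (cases "i = k") auto

lemma radius_nonneg: "i < length rs \<Longrightarrow> 0 \<le> rs ! i"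
  using radii_nonneg by simp

lemma finite_parts: "partition_on P \<C> \<Longrightarrow> finite \<C>"
  using finite_points by (rule finite_elements)

lemma labelled_card:
  assumes "labelled P d rs ks \<alpha> \<C> j" shows "card \<C> = sum_list ks"
proof -
  have fin: "finite \<C>" using assms finite_parts by (simp add: labelled_def)
  have "\<C> = (\<Union>i<length rs. {C \<in> \<C>. j C = i})" using assms by (auto simp: labelled_def)
  then have "card \<C> = (\<Sum>i<length rs. card {C \<in> \<C>. j C = i})"
    using fin by (subst (1) \<open>\<C> = _\<close>, intro card_UN_disjoint) auto
  also have "\<dots> = (\<Sum>i<length rs. ks ! i)" using assms by (simp add: labelled_def)
  also have "\<dots> = sum_list ks" by (simp add: sum_list_sum_nth length_ks lessThan_atLeast0)
  finally show ?thesis .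
qed

lemma labelled_placement:
  assumes lab: "labelled P d rs ks \<alpha> \<C> j" and "0 \<le> \<alpha>"
    and c: "\<And>C. C \<in> \<C> \<Longrightarrow> c C \<in> P \<and> C \<subseteq> nball P d (c C) (\<alpha> * rs ! j C)"
  obtains A where "feasible_placement P d rs ks \<alpha> A" "induced_clustering P d rs ks \<alpha> A \<C>"
    "\<And>C. C \<in> \<C> \<Longrightarrow> c C \<in> A (j C)"
proof -
  have part: "partition_on P \<C>" and j: "\<And>C. C \<in> \<C> \<Longrightarrow> j C < length rs"
    and count: "\<And>i. i < length rs \<Longrightarrow> card {C \<in> \<C>. j C = i} = ks ! i"
    using lab by (auto simp: labelled_def)
  have fin: "finite \<C>" using part by (rule finite_parts)
  \<comment> \<open>Coinciding centers leave too few of them; arbitrary points fill the set up to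
    \<open>ks ! i\<close>, and there are enough points since the parts are nonempty.\<close>
  have "\<exists>B. c ` {C \<in> \<C>. j C = i} \<subseteq> B \<and> B \<subseteq> P \<and> card B = ks ! i" if "i < length rs" for i
  proof (rule exists_subset_between)
    show "card (c ` {C \<in> \<C>. j C = i}) \<le> ks ! i"
      using card_image_le[of "{C \<in> \<C>. j C = i}" c] fin count[OF that] by simp
    have "card {C \<in> \<C>. j C = i} \<le> card \<C>" using fin by (intro card_mono) auto
    then show "ks ! i \<le> card P"
      using count[OF that] card_partition_le[OF finite_points part] by simp
  qed (use c finite_points in auto)
  then obtain A where A: "\<And>i. i < length rs \<Longrightarrow> c ` {C \<in> \<C>. j C = i} \<subseteq> A i \<and> A i \<subseteq> P \<and> card (A i) = ks ! i"
    by metis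
  then have cA: "c C \<in> A (j C)" if "C \<in> \<C>" for C using j that by blast
  have "P \<subseteq> (\<Union>i<length rs. \<Union>p\<in>A i. nball P d p (\<alpha> * rs ! i))"
  proof
    fix x assume "x \<in> P"
    then obtain C where "C \<in> \<C>" "x \<in> C" using partition_onD1[OF part] by blast
    then show "x \<in> (\<Union>i<length rs. \<Union>p\<in>A i. nball P d p (\<alpha> * rs ! i))"
      using cA c j by blast
  qed
  then have "feasible_placement P d rs ks \<alpha> A"
    using A \<open>0 \<le> \<alpha>\<close> by (auto simp: feasible_placement_def nball_def)
  moreover have "induced_clustering P d rs ks \<alpha> A \<C>"
    using part labelled_card[OF lab] cA c j unfolding induced_clustering_def by blast
  ultimately show ?thesis using cA by (rule that)
qed

lemma labelled_feasible:
  assumes "labelled P d rs ks \<alpha> \<C> j" "0 \<le> \<alpha>"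
  shows "\<exists>A. feasible_placement P d rs ks \<alpha> A \<and> induced_clustering P d rs ks \<alpha> A \<C>"
proof -
  obtain c where "\<And>C. C \<in> \<C> \<Longrightarrow> c C \<in> P \<and> C \<subseteq> nball P d (c C) (\<alpha> * rs ! j C)"
    using assms(1) unfolding labelled_def by metis
  from labelled_placement[OF assms this] show ?thesis by blast
qed

text \<open>The obstruction to choosing a ball of its own for each cluster.\<close>

definition shared_ball where
  "shared_ball d \<alpha> A C C' \<longleftrightarrow> C \<noteq> C' \<and>
     (\<exists>i<length rs. \<exists>p\<in>A i. C \<union> C' \<subseteq> nball P d p (\<alpha> * rs ! i))"

text \<open>Without shared balls, choosing a ball for each cluster is injective. There are
  \<open>sum_list ks\<close> clusters and as many balls, so the choice is a bijection and every
  class is used exactly as often as prescribed.\<close>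

lemma induced_labelled:
  assumes feas: "feasible_placement P d rs ks \<alpha> A" and ind: "induced_clustering P d rs ks \<alpha> A \<C>"
    and inj: "\<And>C C'. C \<in> \<C> \<Longrightarrow> C' \<in> \<C> \<Longrightarrow> \<not> shared_ball d \<alpha> A C C'"
  shows "\<exists>j. labelled P d rs ks \<alpha> \<C> j"
proof -
  have part: "partition_on P \<C>" and card: "card \<C> = sum_list ks"
    using ind by (auto simp: induced_clustering_def)
  have A: "A i \<subseteq> P" "card (A i) = ks ! i" if "i < length rs" for i
    using feas that by (auto simp: feasible_placement_def)
  have "\<forall>C\<in>\<C>. \<exists>b. fst b < length rs \<and> snd b \<in> A (fst b) \<and> C \<subseteq> nball P d (snd b) (\<alpha> * rs ! fst b)"
    using ind by (fastforce simp: induced_clustering_def)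
  then obtain s where s: "\<And>C. C \<in> \<C> \<Longrightarrow> fst (s C) < length rs \<and> snd (s C) \<in> A (fst (s C)) \<and>
      C \<subseteq> nball P d (snd (s C)) (\<alpha> * rs ! fst (s C))"
    by metis
  let ?B = "Sigma {..<length rs} A"
  have finA: "finite (A i)" if "i < length rs" for i
    using A(1)[OF that] finite_points by (rule finite_subset)
  have injs: "inj_on s \<C>"
    using inj s unfolding inj_on_def shared_ball_def by (metis Un_least)
  have "card ?B = (\<Sum>i<length rs. ks ! i)"
    using finA A by (subst card_SigmaI) auto
  also have "\<dots> = sum_list ks" by (simp add: sum_list_sum_nth length_ks lessThan_atLeast0)
  finally have "card (s ` \<C>) = card ?B" using card card_image[OF injs] by simp
  moreover have "s ` \<C> \<subseteq> ?B"
  proof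
    fix b assume "b \<in> s ` \<C>"
    then obtain C where "C \<in> \<C>" "b = s C" by blast
    then show "b \<in> ?B" using s[of C] by (cases "s C") auto
  qed
  moreover have "finite ?B" using finA by auto
  ultimately have surj: "s ` \<C> = ?B" by (intro card_subset_eq)
  have "card {C \<in> \<C>. fst (s C) = i} = ks ! i" if i: "i < length rs" for i
  proof -
    have "s ` {C \<in> \<C>. fst (s C) = i} = {b \<in> s ` \<C>. fst b = i}" by blast
    also have "\<dots> = {i} \<times> A i" using surj i by auto
    finally have "card (s ` {C \<in> \<C>. fst (s C) = i}) = card ({i} \<times> A i)" by simp
    moreover have "inj_on s {C \<in> \<C>. fst (s C) = i}" using injs by (rule inj_on_subset) auto
    ultimately show ?thesis using A(2)[OF i] by (simp add: card_image card_cartesian_product)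
  qed
  then have "labelled P d rs ks \<alpha> \<C> (\<lambda>C. fst (s C))"
    using part s A(1) unfolding labelled_def by blast
  then show ?thesis by (rule exI[of _ "\<lambda>C. fst (s C)"])
qed

lemma induced_repartition:
  assumes ind: "induced_clustering P d rs ks \<alpha> A \<C>" and "S \<subseteq> \<C>" "partition_on (\<Union>S) S'" "card S' = card S"
    and "\<And>C. C \<in> S' \<Longrightarrow> \<exists>i<length rs. \<exists>p\<in>A i. C \<subseteq> nball P d p (\<alpha> * rs ! i)"
  shows "induced_clustering P d rs ks \<alpha> A (\<C> - S \<union> S')"
proof -
  have part: "partition_on P \<C>" "card \<C> = sum_list ks"
    and ball: "\<forall>C\<in>\<C>. \<exists>i<length rs. \<exists>p\<in>A i. C \<subseteq> nball P d p (\<alpha> * rs ! i)"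
    using ind by (auto simp: induced_clustering_def)
  note new = repartition[OF finite_points part(1) assms(2-4)]
  show ?thesis
    unfolding induced_clustering_def
  proof (intro conjI ballI)
    fix C assume "C \<in> \<C> - S \<union> S'"
    then show "\<exists>i<length rs. \<exists>p\<in>A i. C \<subseteq> nball P d p (\<alpha> * rs ! i)"
      using ball assms(5)[of C] by (elim UnE) simp_all
  qed (use new part in simp_all)
qed

text \<open>The union of the two clusters lies in one ball, so any division of it into two nonempty
  parts is admissible.\<close>

lemma shared_ball_singleton:
  assumes ind: "induced_clustering P d rs ks \<alpha> A \<C>" and C: "C \<in> \<C>" "C' \<in> \<C>" "shared_ball d \<alpha> A C C'"
    and w: "w \<in> C \<union> C'"
  shows "\<exists>\<D>. induced_clustering P d rs ks \<alpha> A \<D> \<and> {w} \<in> \<D>"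
proof -
  have part: "partition_on P \<C>" using ind by (simp add: induced_clustering_def)
  have ne: "C \<noteq> C'" "C \<noteq> {}" "C' \<noteq> {}" "C \<inter> C' = {}"
    using C partition_onD3[OF part] partition_inter[OF part C(1,2)] by (auto simp: shared_ball_def)
  have rest: "(C \<union> C') - {w} \<noteq> {}" using ne w by blast
  let ?S' = "{{w}, (C \<union> C') - {w}}"
  have "induced_clustering P d rs ks \<alpha> A (\<C> - {C, C'} \<union> ?S')"
  proof (rule induced_repartition[OF ind])
    show "partition_on (\<Union>{C, C'}) ?S'"
      using w rest by (auto simp: partition_on_def disjoint_def)
    have "{w} \<noteq> (C \<union> C') - {w}" by auto
    then show "card ?S' = card {C, C'}" using ne(1) by simp
    fix X assume "X \<in> ?S'"
    then have "X \<subseteq> C \<union> C'" using w by auto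
    then show "\<exists>i<length rs. \<exists>p\<in>A i. X \<subseteq> nball P d p (\<alpha> * rs ! i)"
      using C(3) unfolding shared_ball_def by (meson subset_trans)
  qed (use C in simp)
  then show ?thesis by blast
qed

text \<open>Some part has at least two points. If it is one of the two clusters, their union is
  divided differently; otherwise the two clusters are united and the part saved is used to split the
  large one. With singletons only, there would be no other partition into that many parts.\<close>

lemma shared_ball_not_unique:
  assumes ind: "induced_clustering P d rs ks \<alpha> A \<C>" and C: "C \<in> \<C>" "C' \<in> \<C>" "shared_ball d \<alpha> A C C'"
    and few: "card \<C> < card P"
  shows "\<exists>\<D>. induced_clustering P d rs ks \<alpha> A \<D> \<and> \<D> \<noteq> \<C>"
proof -
  have part: "partition_on P \<C>" using ind by (simp add: induced_clustering_def)
  obtain D u v where D: "D \<in> \<C>" "u \<in> D" "v \<in> D" "u \<noteq> v"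
    using partition_large_part[OF finite_points part few] .
  have u: "{u} \<notin> \<C>"
    using partition_inter[OF part D(1), of "{u}" u] D by auto
  show ?thesis
  proof (cases "D = C \<or> D = C'")
    case True
    then show ?thesis using shared_ball_singleton[OF ind C, of u] D u by blast
  next
    case False
    have ne: "C \<noteq> C'" "C \<noteq> {}" "C' \<noteq> {}" "C \<inter> C' = {}" "C \<inter> D = {}" "C' \<inter> D = {}"
      using C D(1) False partition_onD3[OF part] partition_inter[OF part C(1,2)]
        partition_inter[OF part C(1) D(1)] partition_inter[OF part C(2) D(1)]
      by (auto simp: shared_ball_def)
    let ?S' = "{C \<union> C', {u}, D - {u}}"
    have "induced_clustering P d rs ks \<alpha> A (\<C> - {C, C', D} \<union> ?S')"
    proof (rule induced_repartition[OF ind])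
      show "partition_on (\<Union>{C, C', D}) ?S'"
        using ne D by (auto simp: partition_on_def disjoint_def)
      obtain c where c: "c \<in> C" "c \<notin> D" using ne by blast
      have "u \<notin> C \<union> C'" "u \<notin> D - {u}" using ne D by auto
      then have "C \<union> C' \<noteq> {u}" "C \<union> C' \<noteq> D - {u}" "{u} \<noteq> D - {u}"
        using c by blast+
      then have "card ?S' = 3" by simp
      moreover have "C \<noteq> D" "C' \<noteq> D" using False by auto
      then have "card {C, C', D} = 3" using ne(1) by simp
      ultimately show "card ?S' = card {C, C', D}" by simp
      fix X assume X: "X \<in> ?S'"
      have "\<exists>i<length rs. \<exists>p\<in>A i. D \<subseteq> nball P d p (\<alpha> * rs ! i)"
        using ind D(1) by (simp add: induced_clustering_def)
      moreover have "X \<subseteq> D \<or> X = C \<union> C'" using X D by auto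
      ultimately show "\<exists>i<length rs. \<exists>p\<in>A i. X \<subseteq> nball P d p (\<alpha> * rs ! i)"
        using C(3) unfolding shared_ball_def by (meson subset_trans)
    qed (use C D in simp)
    then show ?thesis using u by blast
  qed
qed

text \<open>Assigning to each point one ball that covers it gives at most \<open>sum_list ks\<close>
  nonempty parts; these are refined to the exact number.\<close>

lemma feasible_induces:
  assumes feas: "feasible_placement P d rs ks \<alpha> A" and k: "sum_list ks \<le> card P"
  shows "\<exists>\<C>. induced_clustering P d rs ks \<alpha> A \<C>"
proof -
  let ?B = "Sigma {..<length rs} A"
  have A: "A i \<subseteq> P" "card (A i) = ks ! i" if "i < length rs" for i
    using feas that by (auto simp: feasible_placement_def)
  have finA: "finite (A i)" if "i < length rs" for i
    using A(1)[OF that] finite_points by (rule finite_subset)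
  have "\<forall>x\<in>P. \<exists>b\<in>?B. x \<in> nball P d (snd b) (\<alpha> * rs ! fst b)"
    using feas unfolding feasible_placement_def by fastforce
  then obtain b where b: "\<And>x. x \<in> P \<Longrightarrow> b x \<in> ?B \<and> x \<in> nball P d (snd (b x)) (\<alpha> * rs ! fst (b x))"
    by metis
  let ?C = "(\<lambda>\<beta>. {x \<in> P. b x = \<beta>}) ` (b ` P)"
  have "partition_on P ?C" by (auto simp: partition_on_def disjoint_def)
  moreover have "card ?C \<le> sum_list ks"
  proof -
    have "card ?C \<le> card (b ` P)" using finite_points by (intro card_image_le) auto
    also have "\<dots> \<le> card ?B"
    proof (rule card_mono)
      show "finite ?B" using finA by auto
      show "b ` P \<subseteq> ?B" using b by blast
    qed
    also have "card ?B = (\<Sum>i<length rs. ks ! i)" using finA A by (subst card_SigmaI) auto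
    also have "\<dots> = sum_list ks" by (simp add: sum_list_sum_nth length_ks lessThan_atLeast0)
    finally show ?thesis .
  qed
  ultimately obtain \<D> where D: "partition_on P \<D>" "card \<D> = sum_list ks" "\<forall>D\<in>\<D>. \<exists>C\<in>?C. D \<subseteq> C"
    using refine_partition[OF finite_points _ _ k] by blast
  have "\<exists>i<length rs. \<exists>p\<in>A i. D \<subseteq> nball P d p (\<alpha> * rs ! i)" if "D \<in> \<D>" for D
  proof -
    from D(3) that obtain C where C: "C \<in> ?C" "D \<subseteq> C" by (rule bspec[elim_format]) auto
    then obtain x where x: "x \<in> P" "C = {y \<in> P. b y = b x}" by auto
    have "D \<subseteq> nball P d (snd (b x)) (\<alpha> * rs ! fst (b x))"
    proof
      fix y assume "y \<in> D"
      with x(2) C(2) have "y \<in> P" "b y = b x" by auto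
      with b[of y] show "y \<in> nball P d (snd (b x)) (\<alpha> * rs ! fst (b x))" by simp
    qed
    moreover have "fst (b x) < length rs" "snd (b x) \<in> A (fst (b x))"
      using b[OF x(1)] by auto
    ultimately show ?thesis by blast
  qed
  then have "induced_clustering P d rs ks \<alpha> A \<D>" using D by (simp add: induced_clustering_def)
  then show ?thesis ..
qed

section \<open>Optimal dilations\<close>

lemma optimal_dilation_le:
  "optimal_dilation P d rs ks \<alpha> \<Longrightarrow> feasible_placement P d rs ks \<beta> A \<Longrightarrow> \<alpha> \<le> \<beta>"
  by (auto simp: optimal_dilation_def optimal_placement_def)

lemma optimal_dilation_nonneg: "optimal_dilation P d rs ks \<alpha> \<Longrightarrow> 0 \<le> \<alpha>"
  by (auto simp: optimal_dilation_def optimal_placement_def feasible_placement_def)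

lemma optimal_placement_dilation: "optimal_placement P d rs ks \<alpha> A \<Longrightarrow> optimal_dilation P d rs ks \<alpha>"
  by (auto simp: optimal_dilation_def)

lemma feasible_optimal:
  "optimal_dilation P d rs ks \<alpha> \<Longrightarrow> feasible_placement P d rs ks \<alpha> A \<Longrightarrow> optimal_placement P d rs ks \<alpha> A"
  by (auto simp: optimal_dilation_def optimal_placement_def)

text \<open>The dilations at which a ball can gain a point.\<close>

definition critical where
  "critical d = insert 0 {d p q / rs ! i | p q i. p \<in> P \<and> q \<in> P \<and> i < length rs \<and> 0 < rs ! i}"

lemma finite_critical: "finite (critical d)"
proof -
  have "critical d \<subseteq> insert 0 ((\<lambda>((p, q), i). d p q / rs ! i) ` ((P \<times> P) \<times> {..<length rs}))"
    by (force simp: critical_def image_iff)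
  then show ?thesis by (rule finite_subset) (use finite_points in auto)
qed

text \<open>Rounding \<alpha> down to a critical value changes no ball: a point in a ball of
  positive radius has a critical quotient of at most \<alpha>, and balls of radius zero do not
  depend on the dilation. So minima may be sought in a finite set.\<close>

lemma feasible_critical:
  assumes met: "Metric_space P d" and feas: "feasible_placement P d rs ks \<alpha> A"
  obtains \<beta> where "\<beta> \<in> critical d" "\<beta> \<le> \<alpha>" "feasible_placement P d rs ks \<beta> A"
proof -
  interpret Metric_space P d by fact
  let ?K = "{\<kappa> \<in> critical d. \<kappa> \<le> \<alpha>}"
  have \<alpha>: "0 \<le> \<alpha>" using feas by (simp add: feasible_placement_def)
  have fin: "finite ?K" using finite_critical by simp
  have 0: "0 \<in> ?K" using \<alpha> by (simp add: critical_def)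
  define \<beta> where "\<beta> = Max ?K"
  have \<beta>: "\<beta> \<in> ?K" using Max_in[OF fin] 0 unfolding \<beta>_def by blast
  have \<beta>0: "0 \<le> \<beta>" using Max_ge[OF fin 0] by (simp add: \<beta>_def)
  have "nball P d p (\<alpha> * rs ! i) \<subseteq> nball P d p (\<beta> * rs ! i)" if "i < length rs" "p \<in> P" for i p
  proof
    fix q assume "q \<in> nball P d p (\<alpha> * rs ! i)"
    then have q: "q \<in> P" "d p q \<le> \<alpha> * rs ! i" by (auto simp: nball_def)
    show "q \<in> nball P d p (\<beta> * rs ! i)"
    proof (cases "rs ! i = 0")
      case True
      then show ?thesis using q by (simp add: nball_def)
    next
      case False
      then have pos: "0 < rs ! i" using radius_nonneg[OF that(1)] by simp
      then have "d p q / rs ! i \<in> ?K" using q that by (auto simp: critical_def divide_le_eq)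
      then have "d p q / rs ! i \<le> \<beta>" unfolding \<beta>_def using fin by (rule Max_ge[rotated])
      then show ?thesis using q pos by (simp add: nball_def divide_le_eq)
    qed
  qed
  note grow = this
  have "P \<subseteq> (\<Union>i<length rs. \<Union>p\<in>A i. nball P d p (\<beta> * rs ! i))"
  proof
    fix x assume "x \<in> P"
    then have "x \<in> (\<Union>i<length rs. \<Union>p\<in>A i. nball P d p (\<alpha> * rs ! i))"
      using feas by (simp add: feasible_placement_def)
    then obtain i p where ip: "i < length rs" "p \<in> A i" "x \<in> nball P d p (\<alpha> * rs ! i)" by auto
    then have "p \<in> P" using feas by (auto simp: feasible_placement_def)
    with grow ip show "x \<in> (\<Union>i<length rs. \<Union>p\<in>A i. nball P d p (\<beta> * rs ! i))" by blast
  qed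
  then have "feasible_placement P d rs ks \<beta> A"
    using feas \<beta>0 by (auto simp: feasible_placement_def nball_def)
  then show ?thesis using that \<beta> by blast
qed

lemma optimal_dilation_critical:
  assumes "Metric_space P d" "optimal_dilation P d rs ks \<alpha>"
  shows "\<alpha> \<in> critical d"
proof -
  obtain A where "feasible_placement P d rs ks \<alpha> A"
    using assms(2) by (auto simp: optimal_dilation_def optimal_placement_def)
  with assms(1) obtain \<beta> where "\<beta> \<in> critical d" "\<beta> \<le> \<alpha>" "feasible_placement P d rs ks \<beta> A"
    by (rule feasible_critical)
  then show ?thesis using optimal_dilation_le[OF assms(2)] by (metis order_antisym)
qed

lemma optimal_dilation_exists:
  assumes met: "Metric_space P d" and feas: "feasible_placement P d rs ks \<beta> A"
  shows "\<exists>\<alpha>. optimal_dilation P d rs ks \<alpha>"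
proof -
  let ?K = "{\<kappa> \<in> critical d. \<exists>A. feasible_placement P d rs ks \<kappa> A}"
  have fin: "finite ?K" using finite_critical by simp
  obtain \<kappa> where "\<kappa> \<in> critical d" "feasible_placement P d rs ks \<kappa> A"
    using feasible_critical[OF assms] by blast
  then have "\<kappa> \<in> ?K" by auto
  then have "?K \<noteq> {}" by auto
  then have "Min ?K \<in> ?K" using fin by (rule Min_in[rotated])
  then obtain A0 where A0: "feasible_placement P d rs ks (Min ?K) A0" by blast
  have "Min ?K \<le> \<alpha>" if feas': "feasible_placement P d rs ks \<alpha> A'" for \<alpha> A'
  proof -
    obtain \<kappa> where \<kappa>: "\<kappa> \<in> critical d" "\<kappa> \<le> \<alpha>" "feasible_placement P d rs ks \<kappa> A'"
      using feasible_critical[OF met feas'] by blast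
    then have "\<kappa> \<in> ?K" by auto
    then show ?thesis using Min_le[OF fin, of \<kappa>] \<kappa>(2) by simp
  qed
  then show ?thesis using A0 unfolding optimal_dilation_def optimal_placement_def by blast
qed

end

section \<open>Perturbations\<close>

text \<open>
  The metric \<open>perturb d z M \<rho>\<close> shortens the distances of \<open>z\<close> to the points of \<open>M\<close> to \<open>\<rho>\<close> and
  closes under shortest paths, which use at most two shortened edges; \<open>shortcut\<close> is the new
  distance to \<open>z\<close>.
\<close>

definition shortcut :: "('a \<Rightarrow> 'a \<Rightarrow> real) \<Rightarrow> 'a \<Rightarrow> 'a set \<Rightarrow> real \<Rightarrow> 'a \<Rightarrow> real" where
  "shortcut d z M \<rho> u = Min (insert (d u z) ((\<lambda>m. d u m + \<rho>) ` M))"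

definition perturb :: "('a \<Rightarrow> 'a \<Rightarrow> real) \<Rightarrow> 'a \<Rightarrow> 'a set \<Rightarrow> real \<Rightarrow> 'a \<Rightarrow> 'a \<Rightarrow> real" where
  "perturb d z M \<rho> u v = min (d u v) (shortcut d z M \<rho> u + shortcut d z M \<rho> v)"

lemma perturb_le: "perturb d z M \<rho> u v \<le> d u v"
  by (simp add: perturb_def)

locale perturbation = Metric_space P d for P :: "'a set" and d +
  fixes z :: 'a and M :: "'a set" and \<rho> :: real
  assumes finite_M: "finite M" and M_subset: "M \<subseteq> P" and z_in: "z \<in> P" and rho_pos: "0 < \<rho>"
begin

abbreviation "f \<equiv> shortcut d z M \<rho>"
abbreviation "d1 \<equiv> perturb d z M \<rho>"

lemma shortcut_cases: obtains "f u = d u z" | m where "m \<in> M" "f u = d u m + \<rho>"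
proof -
  have "f u \<in> insert (d u z) ((\<lambda>m. d u m + \<rho>) ` M)"
    unfolding shortcut_def using finite_M by (intro Min_in) auto
  then show ?thesis using that by auto
qed

lemma shortcut_le: "f u \<le> d u z" "m \<in> M \<Longrightarrow> f u \<le> d u m + \<rho>"
  unfolding shortcut_def using finite_M by (auto intro!: Min_le)

lemma shortcut_nonneg: "0 \<le> f u"
  using nonneg rho_pos by (rule_tac shortcut_cases[of u]) (auto intro: add_nonneg_nonneg less_imp_le)

lemma shortcut_lipschitz:
  assumes "u \<in> P" "v \<in> P" shows "f u \<le> d u v + f v"
proof (rule shortcut_cases[of v])
  assume "f v = d v z"
  then show ?thesis using shortcut_le(1)[of u] triangle[OF assms z_in] by simp
next
  fix m assume "m \<in> M" "f v = d v m + \<rho>"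
  then show ?thesis using shortcut_le(2)[of m u] triangle[OF assms, of m] M_subset by auto
qed

text \<open>A path through a shortened edge has length at least \<rho>; anything shorter is an old
  distance.\<close>

lemma perturb_short:
  assumes "u \<in> P" "v \<in> P" "d1 u v < \<rho>" shows "d1 u v = d u v"
proof (rule ccontr)
  assume ne: "d1 u v \<noteq> d u v"
  then have sum: "d1 u v = f u + f v" "f u + f v < d u v" by (auto simp: perturb_def min_def split: if_splits)
  have "f w = d w z" if "f w < \<rho>" for w
  proof (rule shortcut_cases[of w])
    fix m assume "f w = d w m + \<rho>"
    then show ?thesis using that nonneg[of w m] by linarith
  qed
  moreover have "f u < \<rho>" "f v < \<rho>"
    using sum assms(3) shortcut_nonneg[of u] shortcut_nonneg[of v] by linarith+
  ultimately show False
    using sum(2) triangle[OF assms(1) z_in assms(2)] commute[of v z] by simp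
qed

text \<open>The shortened edges have both ends outside \<open>D\<close>, and leaving
  \<open>D\<close> already costs more than \<open>R\<close>, so a path from \<open>D\<close> of
  length below \<open>R\<close> cannot reach them.\<close>

lemma perturb_separated:
  assumes D: "D \<subseteq> P" "u \<in> D" "v \<in> P" and sep: "\<And>u v. u \<in> D \<Longrightarrow> v \<in> P - D \<Longrightarrow> R < d u v"
    and out: "z \<notin> D" "M \<inter> D = {}" and less: "d1 u v < R"
  shows "v \<in> D \<and> d1 u v = d u v"
proof -
  have "R < f u"
  proof (rule shortcut_cases[of u])
    fix m assume "m \<in> M" "f u = d u m + \<rho>"
    then show ?thesis using sep[OF D(2), of m] M_subset out rho_pos by force
  qed (use sep[OF D(2)] z_in out in auto)
  then have "d1 u v = d u v" using less shortcut_nonneg[of v] by (auto simp: perturb_def min_def split: if_splits)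
  then show ?thesis using sep[OF D(2), of v] D(3) less by force
qed

lemma perturb_center: "m \<in> M \<Longrightarrow> d1 z m \<le> \<rho>"
  using shortcut_le(1)[of z] shortcut_le(2)[of m m] M_subset z_in by (auto simp: perturb_def min_le_iff_disj)

text \<open>No edge shrinks by more than the factor \<psi>, hence no path does. The fact
  \<open>far\<close> is this statement for paths that end in \<open>z\<close>.\<close>

lemma metric_perturbation_perturb:
  assumes \<psi>: "1 \<le> \<psi>" and near: "\<And>m. m \<in> M \<Longrightarrow> d m z \<le> \<psi> * \<rho>"
  shows "metric_perturbation \<psi> P d d1"
proof -
  have far: "d u z \<le> \<psi> * f u" if "u \<in> P" for u
  proof (rule shortcut_cases[of u])
    assume "f u = d u z"
    then show ?thesis using \<psi> mult_right_mono[OF \<psi> nonneg[of u z]] by simp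
  next
    fix m assume m: "m \<in> M" "f u = d u m + \<rho>"
    have "d u z \<le> d u m + d m z" using triangle[OF that _ z_in] m M_subset by blast
    also have "\<dots> \<le> \<psi> * d u m + \<psi> * \<rho>"
      using near[OF m(1)] mult_right_mono[OF \<psi> nonneg[of u m]] by simp
    finally show ?thesis using m by (simp add: distrib_left)
  qed
  have lower: "d u v / \<psi> \<le> d1 u v" if "u \<in> P" "v \<in> P" for u v
  proof -
    have "d u v \<le> d u z + d v z" using triangle[OF that(1) z_in that(2)] commute[of v z] by simp
    also have "\<dots> \<le> \<psi> * (f u + f v)" using far that by (simp add: distrib_left add_mono)
    finally have "d u v / \<psi> \<le> f u + f v" using \<psi> by (simp add: divide_le_eq mult.commute)
    moreover have "d u v / \<psi> \<le> d u v / 1" using \<psi> by (intro divide_left_mono) auto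
    ultimately show ?thesis by (simp add: perturb_def)
  qed
  have "Metric_space P d1"
  proof
    fix u v w
    show "0 \<le> d1 u v" using shortcut_nonneg by (simp add: perturb_def)
    show "d1 u v = d1 v u" by (simp add: perturb_def commute add.commute)
    {
      assume uv: "u \<in> P" "v \<in> P"
      show "d1 u v = 0 \<longleftrightarrow> u = v"
      proof
        assume "d1 u v = 0"
        then have "d u v \<le> 0" using lower[OF uv] \<psi> by (simp add: divide_le_0_iff)
        then show "u = v" using uv by (metis nonneg order_antisym zero)
      next
        assume "u = v"
        then show "d1 u v = 0" using uv shortcut_nonneg by (simp add: perturb_def)
      qed
      assume w: "w \<in> P"
      show "d1 u w \<le> d1 u v + d1 v w"
        using triangle[OF uv w] shortcut_lipschitz[OF uv] shortcut_lipschitz[OF w uv(2)]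
          shortcut_nonneg[of v] commute[of w v]
        unfolding perturb_def by linarith
    }
  qed
  then show ?thesis unfolding metric_perturbation_def using lower by (simp add: perturb_le)
qed

end

section \<open>Stability of the optimal dilation under a perturbation\<close>

context radius_classes begin

definition violation where
  "violation d \<alpha> \<C> j E F x y \<longleftrightarrow> E \<in> \<C> \<and> F \<in> \<C> \<and> E \<noteq> F \<and> x \<in> E \<and> y \<in> F \<and> d x y \<le> \<alpha> * rs ! j E"

lemma labelled_mono:
  assumes "labelled P d rs ks \<alpha> \<C> j" "\<And>u v. d1 u v \<le> d u v"
  shows "labelled P d1 rs ks \<alpha> \<C> j"
proof -
  have "nball P d c r \<subseteq> nball P d1 c r" for c r
    using assms(2) order_trans by (fastforce simp: nball_def)
  then show ?thesis using assms(1) unfolding labelled_def by (meson subset_trans)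
qed

text \<open>
  Suppose that the perturbed dilation \<open>\<alpha>'\<close> were smaller. Classes below \<open>j E\<close> have separated
  clusters, which the perturbation does not affect; classes from \<open>j E\<close> on have radius less than
  \<open>\<rho>\<close> at \<open>\<alpha>'\<close>, where distances do not change. A labelling \<open>j\<close> that agrees with the perturbed
  one as often as possible agrees with it on all classes below \<open>j E\<close>, since otherwise two labels
  could be exchanged. Hence the perturbed solution is feasible for \<open>d\<close> at \<open>\<alpha>'\<close>.
\<close>

lemma perturbed_dilation:
  assumes met: "Metric_space P d" and opt: "optimal_dilation P d rs ks \<alpha>"
    and lab0: "labelled P d rs ks \<alpha> \<C> j0" and viol: "violation d \<alpha> \<C> j0 E F x y"
    and least: "\<And>j E' F' x' y'. labelled P d rs ks \<alpha> \<C> j \<Longrightarrow> violation d \<alpha> \<C> j E' F' x' y' \<Longrightarrow> j0 E \<le> j E'"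
    and z: "z \<in> P" "e \<in> E" "d z e \<le> \<alpha> * rs ! j0 E" and M: "M \<subseteq> E \<union> F"
    and d1: "d1 = perturb d z M (\<alpha> * rs ! j0 E)"
    and opt': "optimal_dilation P d1 rs ks \<alpha>'" and lab': "labelled P d1 rs ks \<alpha>' \<C>' j'"
    and h: "bij_betw h \<C> \<C>'" "\<And>D. D \<in> \<C> \<Longrightarrow> D \<inter> h D \<noteq> {}"
  shows "\<alpha>' = \<alpha>"
proof (rule ccontr)
  assume "\<alpha>' \<noteq> \<alpha>"
  interpret Metric_space P d by fact
  have \<alpha>: "0 \<le> \<alpha>" and \<alpha>': "0 \<le> \<alpha>'" using opt opt' by (simp_all add: optimal_dilation_nonneg)
  have "\<alpha>' \<le> \<alpha>"
  proof -
    have "labelled P d1 rs ks \<alpha> \<C> j0"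
      unfolding d1 using lab0 by (rule labelled_mono) (rule perturb_le)
    from labelled_feasible[OF this \<alpha>] show ?thesis using optimal_dilation_le[OF opt'] by blast
  qed
  with \<open>\<alpha>' \<noteq> \<alpha>\<close> have less: "\<alpha>' < \<alpha>" by simp
  have part: "partition_on P \<C>" and part': "partition_on P \<C>'"
    using lab0 lab' by (auto simp: labelled_def)
  have fin: "finite \<C>" using part by (rule finite_parts)
  have subP: "D \<subseteq> P" if "D \<in> \<C>" for D using partition_onD1[OF part] that by auto
  have subP': "D \<subseteq> P" if "D \<in> \<C>'" for D using partition_onD1[OF part'] that by auto
  have EF: "E \<in> \<C>" "F \<in> \<C>" "E \<noteq> F" "x \<in> E" "y \<in> F" "d x y \<le> \<alpha> * rs ! j0 E"
    using viol by (auto simp: violation_def)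
  define m where "m = j0 E"
  define \<rho> where "\<rho> = \<alpha> * rs ! m"
  have m: "m < length rs" using lab0 EF by (auto simp: labelled_def m_def)
  have xy: "x \<in> P" "y \<in> P" "x \<noteq> y" using EF subP partition_inter[OF part EF(1,2)] by auto
  have "0 < d x y" using xy by simp
  then have \<rho>: "0 < \<rho>" using EF by (simp add: \<rho>_def m_def)
  then have pos: "0 < rs ! m" using \<alpha> radius_nonneg[OF m] unfolding \<rho>_def by (simp add: zero_less_mult_iff)
  have "E \<union> F \<subseteq> P" using EF subP by blast
  then interpret perturbation P d z M \<rho>
    using M z \<rho> finite_points by unfold_locales (auto intro: finite_subset)
  have d1: "d1 = perturb d z M \<rho>" unfolding d1 \<rho>_def m_def ..
  have separated: "\<alpha> * rs ! j D < d u v"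
    if "labelled P d rs ks \<alpha> \<C> j" "D \<in> \<C>" "j D < m" "u \<in> D" "v \<in> P - D" for j D u v
  proof (rule ccontr)
    assume "\<not> ?thesis"
    moreover have "v \<in> P" using that by simp
    then obtain G where "G \<in> \<C>" "v \<in> G" using partition_onD1[OF part] by blast
    ultimately have "violation d \<alpha> \<C> j D G u v" using that by (auto simp: violation_def)
    from least[OF that(1) this] that(3) show False by (simp add: m_def)
  qed
  \<comment> \<open>The pair \<open>x\<close>, \<open>y\<close> shows that neither cluster is
    separated at radius \<rho>, so no labelling gives one of them a class below
    \<open>m\<close>.\<close>
  have large: "m \<le> j E" "m \<le> j F" if "labelled P d rs ks \<alpha> \<C> j" for j
  proof -
    have "\<rho> \<le> \<alpha> * rs ! j G" if "j G < m" for G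
      unfolding \<rho>_def using radius_mono[of "j G" m] m that \<alpha> by (intro mult_left_mono) auto
    moreover have "y \<in> P - E" "x \<in> P - F"
      using xy EF partition_inter[OF part EF(1,2)] by auto
    ultimately show "m \<le> j E" "m \<le> j F"
      using separated[OF that EF(1) _ EF(4), of y] separated[OF that EF(2) _ EF(5), of x] EF(6) commute[of x y]
      unfolding \<rho>_def m_def by (force simp: not_less[symmetric])+
  qed
  have unaffected: "v \<in> D \<and> d1 u v = d u v"
    if j: "labelled P d rs ks \<alpha> \<C> j" and D: "D \<in> \<C>" "j D < m" and uv: "u \<in> D" "v \<in> P" "d1 u v < \<alpha> * rs ! j D"
    for j D u v
    unfolding d1
  proof (rule perturb_separated)
    have D': "D \<noteq> E" "D \<noteq> F" using large[OF j] D by auto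
    then have disj: "D \<inter> (E \<union> F) = {}"
      using partition_inter[OF part D(1) EF(1)] partition_inter[OF part D(1) EF(2)] by blast
    show "M \<inter> D = {}" using M disj by blast
    \<comment> \<open>The point \<open>z\<close> may be a center outside \<open>E\<close>, but it is
      within \<rho> of a point of \<open>E\<close>; inside \<open>D\<close> it would contradict the
      separation of \<open>D\<close>.\<close>
    show "z \<notin> D"
    proof
      assume "z \<in> D"
      moreover have "e \<in> P - D" using z(2) disj subP[OF EF(1)] by auto
      ultimately have "\<alpha> * rs ! j D < d z e" using separated[OF j D] by blast
      moreover have "\<rho> \<le> \<alpha> * rs ! j D"
        unfolding \<rho>_def using radius_mono[of "j D" m] m D \<alpha> by (intro mult_left_mono) auto
      ultimately show False using z(3) by (simp add: \<rho>_def m_def)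
    qed
  qed (use separated[OF j D] uv subP[OF D(1)] d1 in auto)

  \<comment> \<open>\<open>J\<close> transports the perturbed labels to the old clusters.\<close>
  define J where "J D = j' (h D)" for D
  have hC: "h D \<in> \<C>'" if "D \<in> \<C>" for D using h(1) that by (auto simp: bij_betw_def)
  have J: "J D < length rs" if "D \<in> \<C>" for D using lab' hC[OF that] by (auto simp: labelled_def J_def)
  have count: "card {D \<in> \<C>. J D = i} = ks ! i" if "i < length rs" for i
  proof -
    have "h ` {D \<in> \<C>. J D = i} = {D \<in> \<C>'. j' D = i}"
      using h(1) unfolding J_def bij_betw_def by blast
    moreover have "inj_on h {D \<in> \<C>. J D = i}"
      using h(1) unfolding bij_betw_def by (auto intro: inj_on_subset)
    ultimately show ?thesis using lab' that card_image by (fastforce simp: labelled_def)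
  qed
  have "\<exists>j. labelled P d rs ks \<alpha> \<C> j \<and>
      (\<forall>i. labelled P d rs ks \<alpha> \<C> i \<longrightarrow> card {D \<in> \<C>. i D = J D} \<le> card {D \<in> \<C>. j D = J D})"
  proof -
    have "\<forall>i. labelled P d rs ks \<alpha> \<C> i \<longrightarrow> card {D \<in> \<C>. i D = J D} < card \<C> + 1"
      using fin by (auto intro!: card_mono simp: less_Suc_eq_le)
    from ex_has_greatest_nat[OF lab0 this] show ?thesis by blast
  qed
  then obtain j where j: "labelled P d rs ks \<alpha> \<C> j"
    and max: "\<And>i. labelled P d rs ks \<alpha> \<C> i \<Longrightarrow> card {D \<in> \<C>. i D = J D} \<le> card {D \<in> \<C>. j D = J D}"
    by blast
  have count_j: "card {D \<in> \<C>. j D = i} = ks ! i" if "i < length rs" for i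
    using j that by (simp add: labelled_def)

  have main: "J D = i \<and> h D = D \<and> (\<exists>c\<in>P. D \<subseteq> nball P d c (\<alpha>' * rs ! i))"
    if "i < m" "D \<in> \<C>" "j D = i" for i D
    using that
  proof (induction i arbitrary: D rule: less_induct)
    case (less i)
    note D = less.prems
    have i: "i < length rs" using D(1) m by simp
    \<comment> \<open>By induction all clusters with \<open>j\<close>-class \<open>J G\<close> also
      have this \<open>J\<close>-class. Both classes have the prescribed cardinality, so they
      coincide.\<close>
    have same: "j G = J G \<and> h G = G" if "G \<in> \<C>" "J G < i" for G
    proof -
      have JG: "J G < length rs" "J G < m" using that D(1) m by auto
      have "{H \<in> \<C>. j H = J G} \<subseteq> {H \<in> \<C>. J H = J G}"
        using less.IH[OF that(2) JG(2)] by auto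
      moreover have "card {H \<in> \<C>. j H = J G} = card {H \<in> \<C>. J H = J G}"
        using count count_j JG by simp
      ultimately have "{H \<in> \<C>. j H = J G} = {H \<in> \<C>. J H = J G}"
        using fin by (intro card_subset_eq) auto
      then have "j G = J G" using that(1) by blast
      then show ?thesis using less.IH[OF that(2) JG(2) that(1)] by simp
    qed
    have ri: "0 < rs ! i" using radius_mono[of i m] D(1) m pos by simp
    have radius: "\<alpha>' * rs ! k < \<alpha> * rs ! i" if "i \<le> k" "k < length rs" for k
    proof -
      have "\<alpha>' * rs ! k \<le> \<alpha>' * rs ! i" using radius_mono[OF that] \<alpha>' by (rule mult_left_mono)
      also have "\<dots> < \<alpha> * rs ! i" using \<open>\<alpha>' < \<alpha>\<close> ri by simp
      finally show ?thesis .
    qed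
    \<comment> \<open>At dilation \<alpha>' the ball of \<open>h G\<close> is smaller than the
      separation of \<open>D\<close>. Hence a common point traps first the center and then all of
      \<open>h G\<close> in \<open>D\<close>, and the distances involved are old ones.\<close>
    have inside: "h G \<subseteq> D \<and> (\<exists>c\<in>P. h G \<subseteq> nball P d c (\<alpha>' * rs ! J G))"
      if G: "G \<in> \<C>" "i \<le> J G" "h G \<inter> D \<noteq> {}" for G
    proof -
      obtain c where c: "c \<in> P" "h G \<subseteq> nball P d1 c (\<alpha>' * rs ! J G)"
        using lab' hC[OF G(1)] by (auto simp: labelled_def J_def)
      have r: "\<alpha>' * rs ! J G < \<alpha> * rs ! j D" using radius[OF G(2) J[OF G(1)]] D(3) by simp
      obtain u where u: "u \<in> D" "u \<in> h G" using G(3) by blast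
      have "d1 u c < \<alpha> * rs ! j D"
        using u(2) c(2) r unfolding d1 nball_def perturb_def by (auto simp: commute add.commute)
      then have cD: "c \<in> D" using unaffected[OF j D(2) _ u(1) c(1)] D by blast
      have "v \<in> D \<and> v \<in> nball P d c (\<alpha>' * rs ! J G)" if "v \<in> h G" for v
      proof -
        have v: "v \<in> P" "d1 c v \<le> \<alpha>' * rs ! J G" using c(2) that by (auto simp: nball_def)
        then have "v \<in> D \<and> d1 c v = d c v" using unaffected[OF j D(2) _ cD v(1)] D r by simp
        then show ?thesis using v by (simp add: nball_def)
      qed
      then show ?thesis using c(1) by blast
    qed
    have JD: "i \<le> J D" using same[OF D(2)] D(3) by (cases "J D < i") auto
    have meet: "h D \<inter> D \<noteq> {}" using h(2)[OF D(2)] by blast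
    \<comment> \<open>A point of \<open>D\<close> lies in some \<open>h G\<close>. If the class of
      \<open>G\<close> is below \<open>i\<close>, then \<open>h G = G\<close>; otherwise
      \<open>h G\<close> is inside \<open>D\<close> and \<open>G\<close> meets it. Either way
      \<open>G\<close> meets \<open>D\<close>, so they are equal.\<close>
    have "D \<subseteq> h D"
    proof
      fix v assume v: "v \<in> D"
      then have "v \<in> P" using subP[OF D(2)] by blast
      then obtain G' where "G' \<in> \<C>'" "v \<in> G'" using partition_onD1[OF part'] by blast
      then obtain G where G: "G \<in> \<C>" "v \<in> h G" using h(1) by (auto simp: bij_betw_def)
      have "G = D"
      proof (cases "J G < i")
        case True
        then show ?thesis using same[OF G(1)] G v partition_inter[OF part G(1) D(2)] by auto
      next
        case False
        then have "h G \<subseteq> D" using inside[OF G(1)] G(2) v by auto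
        then obtain w where "w \<in> G" "w \<in> D" using h(2)[OF G(1)] by blast
        then show ?thesis using partition_inter[OF part G(1) D(2)] by blast
      qed
      then show "v \<in> h D" using G(2) by simp
    qed
    then have hD: "h D = D" and cover: "\<exists>c\<in>P. D \<subseteq> nball P d c (\<alpha>' * rs ! J D)"
      using inside[OF D(2) JD meet] by auto
    have "J D = i"
    proof (rule ccontr)
      assume ne: "J D \<noteq> i"
      define \<mu> where "\<mu> = J D"
      have \<mu>: "\<mu> < length rs" "i < \<mu>" using J[OF D(2)] JD ne by (auto simp: \<mu>_def)
      have "\<exists>G\<in>\<C>. j G = \<mu> \<and> J G \<noteq> \<mu>"
      proof (rule ccontr)
        assume "\<not> ?thesis"
        then have "{G \<in> \<C>. j G = \<mu>} \<subseteq> {G \<in> \<C>. J G = \<mu>}" by blast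
        then have "{G \<in> \<C>. j G = \<mu>} = {G \<in> \<C>. J G = \<mu>}"
          using fin count[OF \<mu>(1)] count_j[OF \<mu>(1)] by (intro card_subset_eq) auto
        moreover have "D \<in> {G \<in> \<C>. J G = \<mu>}" using D(2) by (simp add: \<mu>_def)
        ultimately have "j D = \<mu>" by blast
        then show False using D(3) ne by (simp add: \<mu>_def)
      qed
      then obtain G where G: "G \<in> \<C>" "j G = \<mu>" "J G \<noteq> \<mu>" by blast
      have DG: "D \<noteq> G" using G D \<mu> by auto
      \<comment> \<open>Exchange of labels: \<open>D\<close> fits into a ball of class \<mu> even at
        dilation \<alpha>', and \<open>G\<close> moves to a larger radius. \<open>D\<close> now
        agrees with \<open>J\<close>, and at \<open>G\<close> there was no agreement to lose, which
        contradicts the choice of \<open>j\<close>.\<close>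
      define k where "k = j(D := \<mu>, G := i)"
      have "labelled P d rs ks \<alpha> \<C> k"
        unfolding labelled_def
      proof (intro conjI ballI allI impI)
        show "partition_on P \<C>" by fact
        fix X assume X: "X \<in> \<C>"
        show "k X < length rs" using j X i \<mu>(1) by (auto simp: labelled_def k_def)
        show "\<exists>c\<in>P. X \<subseteq> nball P d c (\<alpha> * rs ! k X)"
        proof -
          have grow: "nball P d c r \<subseteq> nball P d c r'" if "r \<le> r'" for c r r'
            using that by (auto simp: nball_def)
          consider "X = D" | "X = G" | "k X = j X" by (cases "X = D"; cases "X = G") (auto simp: k_def)
          then show ?thesis
          proof cases
            case 1
            have "\<alpha>' * rs ! \<mu> \<le> \<alpha> * rs ! \<mu>"
              using \<open>\<alpha>' < \<alpha>\<close> radius_nonneg[OF \<mu>(1)] by (intro mult_right_mono) auto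
            moreover have "k X = \<mu>" using 1 DG by (simp add: k_def)
            ultimately show ?thesis using cover grow 1 unfolding \<mu>_def[symmetric] by (metis subset_trans)
          next
            case 2
            have "\<alpha> * rs ! \<mu> \<le> \<alpha> * rs ! i"
              using radius_mono[of i \<mu>] \<mu> \<alpha> by (intro mult_left_mono) auto
            moreover obtain c where "c \<in> P" "G \<subseteq> nball P d c (\<alpha> * rs ! \<mu>)"
              using j G by (auto simp: labelled_def)
            moreover have "k X = i" using 2 by (simp add: k_def)
            ultimately show ?thesis using grow 2 by (metis subset_trans)
          next
            case 3
            then show ?thesis using j X by (simp add: labelled_def)
          qed
        qed
      next
        fix l assume l: "l < length rs"
        \<comment> \<open>The transposition of \<open>D\<close> and \<open>G\<close> maps the
          classes of \<open>j\<close> onto those of \<open>k\<close>, so the counts are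
          preserved.\<close>
        define t where "t X = (if X = D then G else if X = G then D else X)" for X
        have "{X \<in> \<C>. k X = l} = t ` {X \<in> \<C>. j X = l}"
        proof (intro set_eqI iffI)
          fix X assume "X \<in> {X \<in> \<C>. k X = l}"
          then have 1: "t X \<in> {X \<in> \<C>. j X = l}" and 2: "t (t X) = X"
            using D G DG by (auto simp: k_def t_def split: if_splits)
          show "X \<in> t ` {X \<in> \<C>. j X = l}" using imageI[OF 1, of t] unfolding 2 .
        next
          fix X assume "X \<in> t ` {X \<in> \<C>. j X = l}"
          then show "X \<in> {X \<in> \<C>. k X = l}"
            using D G DG by (auto simp: k_def t_def split: if_splits)
        qed
        moreover have "inj_on t {X \<in> \<C>. j X = l}"
          using DG by (auto simp: inj_on_def t_def split: if_splits)
        ultimately show "card {X \<in> \<C>. k X = l} = ks ! l"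
          using count_j[OF l] by (simp add: card_image)
      qed
      from max[OF this] have "card {X \<in> \<C>. k X = J X} \<le> card {X \<in> \<C>. j X = J X}" .
      moreover have "{X \<in> \<C>. j X = J X} \<subset> {X \<in> \<C>. k X = J X}"
      proof
        show "{X \<in> \<C>. j X = J X} \<subseteq> {X \<in> \<C>. k X = J X}"
          using G D ne by (auto simp: k_def \<mu>_def)
        have "D \<in> {X \<in> \<C>. k X = J X}" using D DG by (simp add: k_def \<mu>_def)
        moreover have "D \<notin> {X \<in> \<C>. j X = J X}" using D ne by simp
        ultimately show "{X \<in> \<C>. j X = J X} \<noteq> {X \<in> \<C>. k X = J X}" by blast
      qed
      ultimately show False
        using psubset_card_mono[of "{X \<in> \<C>. k X = J X}" "{X \<in> \<C>. j X = J X}"] fin by simp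
    qed
    then show ?case using hD cover by simp
  qed
  have "labelled P d rs ks \<alpha>' \<C>' j'"
    unfolding labelled_def
  proof (intro conjI)
    show "\<forall>C\<in>\<C>'. \<exists>c\<in>P. C \<subseteq> nball P d c (\<alpha>' * rs ! j' C)"
    proof
      fix C assume C: "C \<in> \<C>'"
      then obtain D where D: "D \<in> \<C>" "C = h D" using h(1) by (auto simp: bij_betw_def)
      show "\<exists>c\<in>P. C \<subseteq> nball P d c (\<alpha>' * rs ! j' C)"
      proof (cases "J D < m")
        case True
        have "{H \<in> \<C>. j H = J D} \<subseteq> {H \<in> \<C>. J H = J D}" using main[OF True] by auto
        moreover have "card {H \<in> \<C>. j H = J D} = card {H \<in> \<C>. J H = J D}"
          using count count_j J[OF D(1)] by simp
        ultimately have "{H \<in> \<C>. j H = J D} = {H \<in> \<C>. J H = J D}"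
          using fin by (intro card_subset_eq) auto
        then have "j D = J D" using D(1) by blast
        from main[OF True D(1) this] show ?thesis unfolding D(2) J_def by metis
      next
        case False
        obtain c where c: "c \<in> P" "C \<subseteq> nball P d1 c (\<alpha>' * rs ! j' C)"
          using lab' C by (auto simp: labelled_def)
        have "\<alpha>' * rs ! j' C \<le> \<alpha>' * rs ! m"
          using False radius_mono[of m "J D"] J[OF D(1)] D(2) \<alpha>' by (intro mult_left_mono) (auto simp: J_def)
        also have "\<dots> < \<rho>" unfolding \<rho>_def using less pos by simp
        finally have r: "\<alpha>' * rs ! j' C < \<rho>" .
        have "C \<subseteq> nball P d c (\<alpha>' * rs ! j' C)"
        proof
          fix v assume "v \<in> C"
          then have v: "v \<in> P" "d1 c v \<le> \<alpha>' * rs ! j' C" using c(2) by (auto simp: nball_def)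
          then show "v \<in> nball P d c (\<alpha>' * rs ! j' C)"
            using perturb_short[OF c(1) v(1)] r by (simp add: nball_def d1)
        qed
        then show ?thesis using c(1) by blast
      qed
    qed
  qed (use lab' in \<open>auto simp: labelled_def\<close>)
  from labelled_feasible[OF this \<alpha>'] have "\<alpha> \<le> \<alpha>'" using optimal_dilation_le[OF opt] by blast
  then show False using less by simp
qed

end

section \<open>Separation of the optimal clusters\<close>

text \<open>Serves the partition into singletons, where any assignment of classes with the right
  counts is a labelling.\<close>

lemma labelling_with_counts:
  assumes "finite S" "card S = sum_list ks"
  obtains j where "\<And>C. C \<in> S \<Longrightarrow> j C < length ks" "\<And>i. i < length ks \<Longrightarrow> card {C \<in> S. j C = i} = ks ! i"
proof -
  let ?B = "SIGMA i:{..<length ks}. {..<ks ! i}"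
  have "card ?B = sum_list ks" by (simp add: sum_list_sum_nth lessThan_atLeast0)
  then obtain g where g: "bij_betw g S ?B"
    using assms by (metis finite_SigmaI finite_lessThan finite_same_card_bij)
  have "card {C \<in> S. fst (g C) = i} = ks ! i" if "i < length ks" for i
  proof -
    have "g ` {C \<in> S. fst (g C) = i} = {b \<in> g ` S. fst b = i}" by blast
    also have "\<dots> = {i} \<times> {..<ks ! i}" using g that by (auto simp: bij_betw_def)
    finally have "card (g ` {C \<in> S. fst (g C) = i}) = ks ! i" by simp
    moreover have "inj_on g {C \<in> S. fst (g C) = i}"
      using g unfolding bij_betw_def by (auto intro: inj_on_subset)
    ultimately show ?thesis by (simp add: card_image)
  qed
  moreover have "fst (g C) < length ks" if "C \<in> S" for C
  proof -
    have "g C \<in> ?B" using g that by (auto simp: bij_betw_def)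
    then show ?thesis by auto
  qed
  ultimately show ?thesis by (rule that[rotated])
qed

lemma nball_perturb: "nball P d p r \<subseteq> nball P (perturb d z M \<rho>) p r"
proof
  fix q assume "q \<in> nball P d p r"
  then show "q \<in> nball P (perturb d z M \<rho>) p r"
    using perturb_le[of d z M \<rho> p q] by (simp add: nball_def)
qed

context radius_classes begin

definition separated where
  "separated d \<alpha> \<C> j \<longleftrightarrow> (\<forall>D\<in>\<C>. \<forall>u\<in>D. \<forall>v\<in>P - D. \<alpha> * rs ! j D < d u v)"

text \<open>Minimal counterexample: a least class index means a largest radius. The minimum runs
  over all labellings because the exchange in \<open>perturbed_dilation\<close> leads to another
  labelling.\<close>

lemma separatedI:
  assumes lab: "labelled P d rs ks \<alpha> \<C> j"
    and least: "\<And>j E F x y. labelled P d rs ks \<alpha> \<C> j \<Longrightarrow> violation d \<alpha> \<C> j E F x y \<Longrightarrow>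
      (\<And>j' E' F' x' y'. labelled P d rs ks \<alpha> \<C> j' \<Longrightarrow> violation d \<alpha> \<C> j' E' F' x' y' \<Longrightarrow> j E \<le> j' E') \<Longrightarrow> False"
  shows "separated d \<alpha> \<C> j"
proof (rule ccontr)
  assume "\<not> ?thesis"
  then obtain D u v where D: "D \<in> \<C>" "u \<in> D" "v \<in> P - D" "d u v \<le> \<alpha> * rs ! j D"
    by (auto simp: separated_def not_less)
  have part: "partition_on P \<C>" using lab by (simp add: labelled_def)
  have "v \<in> P" using D by simp
  then obtain G where G: "G \<in> \<C>" "v \<in> G" using partition_onD1[OF part] by blast
  define V where "V n \<longleftrightarrow> (\<exists>j E F x y. labelled P d rs ks \<alpha> \<C> j \<and> violation d \<alpha> \<C> j E F x y \<and> j E = n)" for n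
  have "violation d \<alpha> \<C> j D G u v" using D G by (auto simp: violation_def)
  with lab have "V (j D)" unfolding V_def by blast
  then have "V (LEAST n. V n)" by (rule LeastI)
  then obtain j' E F x y where *: "labelled P d rs ks \<alpha> \<C> j'" "violation d \<alpha> \<C> j' E F x y" "j' E = (LEAST n. V n)"
    unfolding V_def by blast
  show False
  proof (rule least[OF *(1,2)])
    fix j'' E' F' x' y'
    assume "labelled P d rs ks \<alpha> \<C> j''" "violation d \<alpha> \<C> j'' E' F' x' y'"
    then have "V (j'' E')" unfolding V_def by blast
    then show "j' E \<le> j'' E'" unfolding *(3) by (rule Least_le)
  qed
qed

lemma violation_perturbation:
  assumes met: "Metric_space P d" and lab: "labelled P d rs ks \<alpha> \<C> j" and opt: "optimal_dilation P d rs ks \<alpha>"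
    and viol: "violation d \<alpha> \<C> j E F x y" and "z \<in> P" "M \<subseteq> P"
  shows "perturbation P d z M (\<alpha> * rs ! j E)"
proof -
  interpret Metric_space P d by fact
  have part: "partition_on P \<C>" using lab by (simp add: labelled_def)
  have v: "E \<in> \<C>" "F \<in> \<C>" "E \<noteq> F" "x \<in> E" "y \<in> F" "d x y \<le> \<alpha> * rs ! j E"
    using viol by (auto simp: violation_def)
  have "x \<in> P" "y \<in> P" using v partition_onD1[OF part] by auto
  moreover have "x \<noteq> y" using v partition_inter[OF part v(1,2)] by auto
  ultimately have "0 < d x y" by simp
  with v(6) have "0 < \<alpha> * rs ! j E" by linarith
  then show ?thesis
    using assms(5,6) finite_points by unfold_locales (auto intro: finite_subset)
qed

lemma metric_perturbation_refl:
  assumes "Metric_space P d" "1 \<le> \<psi>" shows "metric_perturbation \<psi> P d d"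
proof -
  have "d p q / \<psi> \<le> d p q / 1" for p q
    using assms Metric_space.nonneg[OF assms(1), of p q] by (intro divide_left_mono) auto
  then show ?thesis using assms(1) by (simp add: metric_perturbation_def)
qed

lemma resilient_separated:
  assumes met: "Metric_space P d" and pr: "perturbation_resilient 2 P d rs ks"
  shows "\<exists>\<alpha> \<C> j. optimal_dilation P d rs ks \<alpha> \<and> labelled P d rs ks \<alpha> \<C> j \<and> separated d \<alpha> \<C> j"
proof -
  interpret Metric_space P d by fact
  from pr obtain \<C> where C: "\<forall>\<C>'. optimal_clustering P d rs ks \<C>' \<longleftrightarrow> \<C>' = \<C>"
    "\<forall>d1. metric_perturbation 2 P d d1 \<longrightarrow> (\<forall>\<C>'. optimal_clustering P d1 rs ks \<C>' \<longleftrightarrow> \<C>' = \<C>)"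
    unfolding perturbation_resilient_def by (elim exE conjE)
  have uniq: "optimal_clustering P d1 rs ks \<C>' \<longleftrightarrow> \<C>' = \<C>" if "metric_perturbation 2 P d d1" for d1 \<C>'
    using C(2)[rule_format, OF that] .
  have "optimal_clustering P d rs ks \<C>" using C(1)[rule_format, of \<C>] by simp
  then have part: "partition_on P \<C>" and card: "card \<C> = sum_list ks"
    by (auto simp: optimal_clustering_def induced_clustering_def)
  consider "card \<C> = card P" | "card \<C> < card P"
    using card_partition_le[OF finite_points part] by linarith
  then show ?thesis
  proof cases
    \<comment> \<open>With as many clusters as points, uniqueness of the clustering carries no
      information and shared balls cannot be excluded. But then dilation \<open>0\<close> suffices,
      and all distances between distinct points are positive.\<close>
    case 1
    let ?S = "(\<lambda>x. {x}) ` P"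
    have "card ?S = sum_list ks" using 1 card by (simp add: card_image)
    then obtain j where j: "\<And>C. C \<in> ?S \<Longrightarrow> j C < length ks" "\<And>i. i < length ks \<Longrightarrow> card {C \<in> ?S. j C = i} = ks ! i"
      using labelling_with_counts[of ?S ks] finite_points by blast
    have lab: "labelled P d rs ks 0 ?S j"
      unfolding labelled_def length_ks[symmetric]
    proof (intro conjI ballI)
      fix C assume "C \<in> ?S"
      then obtain x where "x \<in> P" "C = {x}" by blast
      then show "\<exists>c\<in>P. C \<subseteq> nball P d c (0 * rs ! j C)"
        by (intro bexI[of _ x]) (simp_all add: nball_def)
    qed (use j partition_on_singletons[of P] in auto)
    have "optimal_dilation P d rs ks 0"
      using labelled_feasible[OF lab] unfolding optimal_dilation_def optimal_placement_def feasible_placement_def by auto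
    moreover have "separated d 0 ?S j" by (auto simp: separated_def mdist_pos_less)
    ultimately show ?thesis using lab by blast
  next
    case 2
    have unshared: "\<not> shared_ball d1 \<alpha> A C C'"
      if pert: "metric_perturbation 2 P d d1" and A: "optimal_placement P d1 rs ks \<alpha> A"
        "induced_clustering P d1 rs ks \<alpha> A \<C>" and C: "C \<in> \<C>" "C' \<in> \<C>" for d1 \<alpha> A C C'
    proof
      assume "shared_ball d1 \<alpha> A C C'"
      from shared_ball_not_unique[OF A(2) C this 2] obtain \<D>
        where "induced_clustering P d1 rs ks \<alpha> A \<D>" "\<D> \<noteq> \<C>" by blast
      then show False using uniq[OF pert, of \<D>] A(1) unfolding optimal_clustering_def by blast
    qed
    have lab: "\<exists>\<alpha> j. optimal_dilation P d1 rs ks \<alpha> \<and> labelled P d1 rs ks \<alpha> \<C> j"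
      if pert: "metric_perturbation 2 P d d1" for d1
    proof -
      obtain \<alpha> A where A: "optimal_placement P d1 rs ks \<alpha> A" "induced_clustering P d1 rs ks \<alpha> A \<C>"
        using uniq[OF pert, of \<C>] unfolding optimal_clustering_def by blast
      then have "\<exists>j. labelled P d1 rs ks \<alpha> \<C> j"
        using induced_labelled[OF _ A(2) unshared[OF pert A]] by (simp add: optimal_placement_def)
      then show ?thesis using optimal_placement_dilation[OF A(1)] by blast
    qed
    obtain \<alpha> j where opt: "optimal_dilation P d rs ks \<alpha>" and labj: "labelled P d rs ks \<alpha> \<C> j"
      using lab[OF metric_perturbation_refl[OF met]] by auto
    have "separated d \<alpha> \<C> j"
    proof (rule separatedI[OF labj])
      fix j E F x y
      assume labj: "labelled P d rs ks \<alpha> \<C> j" and viol: "violation d \<alpha> \<C> j E F x y"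
        and least: "\<And>j' E' F' x' y'. labelled P d rs ks \<alpha> \<C> j' \<Longrightarrow> violation d \<alpha> \<C> j' E' F' x' y' \<Longrightarrow> j E \<le> j' E'"
      have v: "E \<in> \<C>" "F \<in> \<C>" "E \<noteq> F" "x \<in> E" "y \<in> F" "d x y \<le> \<alpha> * rs ! j E"
        using viol by (auto simp: violation_def)
      obtain c where c: "\<And>C. C \<in> \<C> \<Longrightarrow> c C \<in> P \<and> C \<subseteq> nball P d (c C) (\<alpha> * rs ! j C)"
        using labj unfolding labelled_def by metis
      have P: "x \<in> P" "y \<in> P" "c E \<in> P" using v c partition_onD1[OF part] by auto
      have cx: "d (c E) x \<le> \<alpha> * rs ! j E" using c[OF v(1)] v(4) by (auto simp: nball_def)
      define d1 where "d1 = perturb d (c E) {y} (\<alpha> * rs ! j E)"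
      interpret perturbation P d "c E" "{y}" "\<alpha> * rs ! j E"
        using P by (intro violation_perturbation[OF met labj opt viol]) auto
      have pert: "metric_perturbation 2 P d d1"
        unfolding d1_def
      proof (rule metric_perturbation_perturb)
        \<comment> \<open>The factor 2: from \<open>y\<close> through \<open>x\<close> to the
          center, with both distances at most \<open>\<alpha> * rs ! j E\<close>.\<close>
        show "d m (c E) \<le> 2 * (\<alpha> * rs ! j E)" if "m \<in> {y}" for m
          using that triangle[OF P(2) P(1) P(3)] v(6) cx commute[of x y] commute[of x "c E"] by simp
      qed simp
      obtain \<alpha>' j' where opt': "optimal_dilation P d1 rs ks \<alpha>'" and lab': "labelled P d1 rs ks \<alpha>' \<C> j'"
        using lab[OF pert] by blast
      have yEF: "{y} \<subseteq> E \<union> F" using v by simp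
      have "\<alpha>' = \<alpha>"
      proof (rule perturbed_dilation[OF met opt labj viol _ P(3) v(4) cx yEF d1_def opt' lab'])
        \<comment> \<open>By resilience the perturbed clustering is \<C> itself, so the identity
          matches the clusters.\<close>
        show "bij_betw (\<lambda>D. D) \<C> \<C>" by (simp add: bij_betw_def)
        show "D \<inter> D \<noteq> {}" if "D \<in> \<C>" for D using that partition_onD3[OF part] by auto
      qed (rule least)
      have lab1: "labelled P d1 rs ks \<alpha> \<C> j"
        unfolding d1_def using labj by (rule labelled_mono) (rule perturb_le)
      have ball: "nball P d p r \<subseteq> nball P d1 p r" for p r
        unfolding d1_def by (rule nball_perturb)
      have "c C \<in> P \<and> C \<subseteq> nball P d1 (c C) (\<alpha> * rs ! j C)" if "C \<in> \<C>" for C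
        using c[OF that] subset_trans[OF _ ball] by simp
      from labelled_placement[OF lab1 optimal_dilation_nonneg[OF opt] this] obtain A where
        A: "feasible_placement P d1 rs ks \<alpha> A" "induced_clustering P d1 rs ks \<alpha> A \<C>"
          "\<And>C. C \<in> \<C> \<Longrightarrow> c C \<in> A (j C)"
        by blast
      have optA: "optimal_placement P d1 rs ks \<alpha> A"
        using feasible_optimal[OF _ A(1)] opt' \<open>\<alpha>' = \<alpha>\<close> by simp
      have jE: "j E < length rs" using labj v by (simp add: labelled_def)
      have sub: "insert y E \<subseteq> nball P d1 (c E) (\<alpha> * rs ! j E)"
      proof -
        have "E \<subseteq> nball P d1 (c E) (\<alpha> * rs ! j E)" using c[OF v(1)] subset_trans[OF _ ball] by simp
        moreover have "y \<in> nball P d1 (c E) (\<alpha> * rs ! j E)"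
          using perturb_center[of y] P(2) by (simp add: d1_def nball_def)
        ultimately show ?thesis by simp
      qed
      show False
      proof (cases "F = {y}")
        \<comment> \<open>Moving \<open>y\<close> would leave \<open>F\<close> empty. Instead
          \<open>E\<close> and \<open>F\<close> now share a ball, which is already excluded.\<close>
        case True
        then have "shared_ball d1 \<alpha> A E F"
          using sub v jE A(3)[OF v(1)] unfolding shared_ball_def by auto
        then show False using unshared[OF pert optA A(2) v(1,2)] by blast
      next
        case False
        let ?S' = "{insert y E, F - {y}}"
        have disj: "E \<inter> F = {}" using partition_inter[OF part v(1,2)] v(3) by blast
        have "induced_clustering P d1 rs ks \<alpha> A (\<C> - {E, F} \<union> ?S')"
        proof (rule induced_repartition[OF A(2)])
          show "partition_on (\<Union>{E, F}) ?S'"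
            using False v disj by (auto simp: partition_on_def disjoint_def)
          have "insert y E \<noteq> F - {y}" by auto
          then show "card ?S' = card {E, F}" using v(3) by simp
          fix X assume "X \<in> ?S'"
          then consider "X = insert y E" | "X \<subseteq> F" by auto
          then show "\<exists>i<length rs. \<exists>p\<in>A i. X \<subseteq> nball P d1 p (\<alpha> * rs ! i)"
          proof cases
            case 1
            then show ?thesis using sub jE A(3)[OF v(1)] by blast
          next
            case 2
            moreover have "\<exists>i<length rs. \<exists>p\<in>A i. F \<subseteq> nball P d1 p (\<alpha> * rs ! i)"
              using A(2) v(2) by (simp add: induced_clustering_def)
            ultimately show ?thesis by (meson subset_trans)
          qed
        qed (use v in simp)
        then have "optimal_clustering P d1 rs ks (\<C> - {E, F} \<union> ?S')"
          using optA unfolding optimal_clustering_def by blast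
        then have "\<C> - {E, F} \<union> ?S' = \<C>" by (rule iffD1[OF uniq[OF pert]])
        moreover have "insert y E \<in> \<C> - {E, F} \<union> ?S'" by simp
        ultimately have "insert y E \<in> \<C>" by metis
        then have "insert y E = E" using partition_inter[OF part _ v(1), of "insert y E" x] v by simp
        then show False using disj v by blast
      qed
    qed
    then show ?thesis using opt labj by blast
  qed
qed

text \<open>Matched partitions of one set have equal total losses in both directions. So a cluster
  of \<C> misses at most \<open>\<epsilon> * card P\<close> points of its partner and, being larger
  by more than one, meets it in two points. One point would not suffice: two are what rules out
  singleton clusters in perturbed solutions.\<close>

lemma close_clusterings:
  assumes close: "eps_close \<epsilon> P \<C>1 \<C>" and part1: "partition_on P \<C>1" and part: "partition_on P \<C>"
    and large: "\<And>C. C \<in> \<C> \<Longrightarrow> real (card C) > \<epsilon> * real (card P) + 1"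
  obtains h where "bij_betw h \<C> \<C>1" "\<And>D. D \<in> \<C> \<Longrightarrow> 2 \<le> card (D \<inter> h D)"
proof -
  obtain f where f: "bij_betw f \<C>1 \<C>" and sum: "real (\<Sum>C\<in>\<C>1. card (C - f C)) \<le> \<epsilon> * real (card P)"
    using close unfolding eps_close_def by blast
  have fin1: "finite \<C>1" using part1 by (rule finite_parts)
  have finC: "finite C" if "C \<subseteq> P" for C using that finite_points by (rule finite_subset)
  have sub1: "C \<subseteq> P" if "C \<in> \<C>1" for C using partition_onD1[OF part1] that by auto
  have sub: "C \<subseteq> P" if "C \<in> \<C>" for C using partition_onD1[OF part] that by auto
  have fC: "f C \<in> \<C>" if "C \<in> \<C>1" for C using f that by (auto simp: bij_betw_def)
  have "(\<Sum>C\<in>\<C>1. card C) = (\<Sum>C\<in>\<C>1. card (f C))"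
  proof -
    have "(\<Sum>C\<in>\<C>1. card (f C)) = (\<Sum>C\<in>\<C>. card C)" using f by (rule sum.reindex_bij_betw)
    then show ?thesis
      using product_partition[OF part1 finC[OF sub1]] product_partition[OF part finC[OF sub]] by simp
  qed
  moreover have "card C = card (C - f C) + card (C \<inter> f C)" "card (f C) = card (f C - C) + card (C \<inter> f C)"
    if "C \<in> \<C>1" for C
    using card_Int_Diff[OF finC[OF sub1[OF that]], of "f C"] card_Int_Diff[OF finC[OF sub[OF fC[OF that]]], of C]
    by (simp_all add: Int_commute)
  ultimately have eq: "(\<Sum>C\<in>\<C>1. card (C - f C)) = (\<Sum>C\<in>\<C>1. card (f C - C))"
    by (simp add: sum.distrib)
  have two: "2 \<le> card (f C \<inter> C)" if C: "C \<in> \<C>1" for C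
  proof -
    have "card (f C - C) \<le> (\<Sum>C\<in>\<C>1. card (f C - C))"
      using C fin1 by (intro member_le_sum) auto
    then have "real (card (f C - C)) \<le> \<epsilon> * real (card P)" using sum eq by linarith
    moreover have "card (f C) = card (f C \<inter> C) + card (f C - C)"
      using finC[OF sub[OF fC[OF C]]] by (rule card_Int_Diff)
    ultimately show ?thesis using large[OF fC[OF C]] by linarith
  qed
  show ?thesis
  proof (rule that[of "inv_into \<C>1 f"])
    show bij: "bij_betw (inv_into \<C>1 f) \<C> \<C>1" using f by (rule bij_betw_inv_into)
    fix D assume D: "D \<in> \<C>"
    then have "inv_into \<C>1 f D \<in> \<C>1" "f (inv_into \<C>1 f D) = D"
      using f by (auto simp: bij_betw_def inv_into_into f_inv_into_f)
    then show "2 \<le> card (D \<inter> inv_into \<C>1 f D)" using two[of "inv_into \<C>1 f D"] by simp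
  qed
qed

lemma eps_resilient_separated:
  assumes met: "Metric_space P d" and pr: "eps_perturbation_resilient 3 \<epsilon> P d rs ks"
    and opt_C: "optimal_clustering P d rs ks \<C>"
    and large: "\<And>C. C \<in> \<C> \<Longrightarrow> real (card C) > \<epsilon> * real (card P) + 1"
  shows "\<exists>\<alpha> j. optimal_dilation P d rs ks \<alpha> \<and> labelled P d rs ks \<alpha> \<C> j \<and> separated d \<alpha> \<C> j"
proof -
  interpret Metric_space P d by fact
  obtain \<alpha> A0 where A0: "optimal_placement P d rs ks \<alpha> A0" "induced_clustering P d rs ks \<alpha> A0 \<C>"
    using opt_C by (auto simp: optimal_clustering_def)
  have part: "partition_on P \<C>" and card: "card \<C> = sum_list ks"
    using A0 by (auto simp: induced_clustering_def)
  have near: "\<exists>h. bij_betw h \<C> \<C>1 \<and> (\<forall>D\<in>\<C>. 2 \<le> card (D \<inter> h D))"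
    if "metric_perturbation 3 P d d1" "optimal_clustering P d1 rs ks \<C>1" for d1 \<C>1
  proof -
    have "eps_close \<epsilon> P \<C>1 \<C>" using pr that opt_C by (auto simp: eps_perturbation_resilient_def)
    moreover have "partition_on P \<C>1" using that by (auto simp: optimal_clustering_def induced_clustering_def)
    ultimately show ?thesis using close_clusterings[OF _ _ part large] by metis
  qed
  \<comment> \<open>A shared ball would allow an optimal clustering with a singleton, which cannot
    have two points in common with its partner.\<close>
  have unshared: "\<not> shared_ball d1 \<alpha> A C C'"
    if pert: "metric_perturbation 3 P d d1" and A: "optimal_placement P d1 rs ks \<alpha> A"
      "induced_clustering P d1 rs ks \<alpha> A \<C>1" and C: "C \<in> \<C>1" "C' \<in> \<C>1" for d1 \<alpha> A C C' \<C>1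
  proof
    assume shared: "shared_ball d1 \<alpha> A C C'"
    have "C \<noteq> {}" using A(2) C(1) partition_onD3 unfolding induced_clustering_def by blast
    then obtain w where "w \<in> C \<union> C'" by blast
    from shared_ball_singleton[OF A(2) C shared this] obtain \<D>
      where D: "induced_clustering P d1 rs ks \<alpha> A \<D>" "{w} \<in> \<D>" by blast
    then have "optimal_clustering P d1 rs ks \<D>" using A(1) unfolding optimal_clustering_def by blast
    from near[OF pert this] obtain h where h: "bij_betw h \<C> \<D>" "\<forall>D\<in>\<C>. 2 \<le> card (D \<inter> h D)" by blast
    then obtain D where "D \<in> \<C>" "h D = {w}" using D(2) unfolding bij_betw_def by blast
    then have "2 \<le> card (D \<inter> {w})" using h(2) by metis
    moreover have "card (D \<inter> {w}) \<le> card {w}" by (intro card_mono) auto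
    ultimately show False by simp
  qed
  note opt = optimal_placement_dilation[OF A0(1)]
  obtain j where labj: "labelled P d rs ks \<alpha> \<C> j"
    using induced_labelled[OF _ A0(2) unshared[OF metric_perturbation_refl[OF met] A0]] A0(1) by (auto simp: optimal_placement_def)
  have "separated d \<alpha> \<C> j"
  proof (rule separatedI[OF labj])
    fix j E F x y
    assume labj: "labelled P d rs ks \<alpha> \<C> j" and viol: "violation d \<alpha> \<C> j E F x y"
      and least: "\<And>j' E' F' x' y'. labelled P d rs ks \<alpha> \<C> j' \<Longrightarrow> violation d \<alpha> \<C> j' E' F' x' y' \<Longrightarrow> j E \<le> j' E'"
    have v: "E \<in> \<C>" "F \<in> \<C>" "E \<noteq> F" "x \<in> E" "y \<in> F" "d x y \<le> \<alpha> * rs ! j E"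
      using viol by (auto simp: violation_def)
    obtain c where c: "\<And>C. C \<in> \<C> \<Longrightarrow> c C \<in> P \<and> C \<subseteq> nball P d (c C) (\<alpha> * rs ! j C)"
      using labj unfolding labelled_def by metis
    have EF: "E \<subseteq> P" "F \<subseteq> P" using v partition_onD1[OF part] by auto
    then have P: "x \<in> P" "y \<in> P" using v by auto
    have \<alpha>: "0 \<le> \<alpha>" using opt by (rule optimal_dilation_nonneg)
    have jE: "j E < length rs" and jF: "j F < length rs" using labj v by (simp_all add: labelled_def)
    \<comment> \<open>Otherwise the same pair of points, read from \<open>F\<close>, would be a
      violation of smaller index. So the radius of \<open>F\<close> is at most that of
      \<open>E\<close>, as the factor 3 requires.\<close>
    have "j E \<le> j F"
    proof (rule ccontr)
      assume ne: "\<not> ?thesis"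
      then have "\<alpha> * rs ! j E \<le> \<alpha> * rs ! j F"
        using radius_mono[of "j F" "j E"] jE \<alpha> by (intro mult_left_mono) auto
      then have "violation d \<alpha> \<C> j F E y x" using v commute[of x y] by (auto simp: violation_def)
      from least[OF labj this] show False using ne by simp
    qed
    then have rF: "\<alpha> * rs ! j F \<le> \<alpha> * rs ! j E"
      using radius_mono[OF _ jF] \<alpha> by (intro mult_left_mono) auto
    have diam: "d u v \<le> 2 * (\<alpha> * rs ! j C)" if "C \<in> \<C>" "u \<in> C" "v \<in> C" for C u v
    proof -
      have "u \<in> nball P d (c C) (\<alpha> * rs ! j C)" "v \<in> nball P d (c C) (\<alpha> * rs ! j C)" "c C \<in> P"
        using c[OF that(1)] that(2,3) by auto
      then show ?thesis using triangle[of u "c C" v] commute[of u "c C"] by (simp add: nball_def)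
    qed
    define d1 where "d1 = perturb d x (E \<union> F) (\<alpha> * rs ! j E)"
    interpret perturbation P d x "E \<union> F" "\<alpha> * rs ! j E"
      using P EF by (intro violation_perturbation[OF met labj opt viol]) auto
    have pert: "metric_perturbation 3 P d d1"
      unfolding d1_def
    proof (rule metric_perturbation_perturb)
      \<comment> \<open>The factor 3: a point of \<open>F\<close> is within two radii of
        \<open>y\<close>, by the diameter of \<open>F\<close>, and \<open>y\<close> is within one
        radius of \<open>x\<close>. Points of \<open>E\<close> are within two radii of
        \<open>x\<close>.\<close>
      fix m assume "m \<in> E \<union> F"
      then show "d m x \<le> 3 * (\<alpha> * rs ! j E)"
      proof
        assume "m \<in> E"
        then show ?thesis using diam[OF v(1) _ v(4)] rho_pos by fastforce
      next
        assume m: "m \<in> F"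
        then have "d m x \<le> d m y + d y x" using triangle[of m y x] EF P by blast
        then show ?thesis using diam[OF v(2) m v(5)] v(6) rF commute[of x y] by linarith
      qed
    qed simp
    have lab1: "labelled P d1 rs ks \<alpha> \<C> j"
      unfolding d1_def using labj by (rule labelled_mono) (rule perturb_le)
    have met1: "Metric_space P d1" using pert by (simp add: metric_perturbation_def)
    obtain A1 where "feasible_placement P d1 rs ks \<alpha> A1"
      using labelled_feasible[OF lab1 \<alpha>] by blast
    \<comment> \<open>Closeness speaks only about clusterings that exist, so an optimal solution for
      the perturbed metric has to be constructed; exact resilience provides one by
      definition.\<close>
    from optimal_dilation_exists[OF met1 this] obtain \<alpha>' where opt': "optimal_dilation P d1 rs ks \<alpha>'" by blast
    then obtain A' where A': "optimal_placement P d1 rs ks \<alpha>' A'" by (auto simp: optimal_dilation_def)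
    have "sum_list ks \<le> card P" using card card_partition_le[OF finite_points part] by simp
    then obtain \<C>' where C': "induced_clustering P d1 rs ks \<alpha>' A' \<C>'"
      using feasible_induces[of d1 \<alpha>' A'] A' unfolding optimal_placement_def by blast
    then obtain j' where lab': "labelled P d1 rs ks \<alpha>' \<C>' j'"
      using induced_labelled[OF _ C' unshared[OF pert A' C']] A' by (auto simp: optimal_placement_def)
    have "optimal_clustering P d1 rs ks \<C>'" using A' C' by (auto simp: optimal_clustering_def)
    from near[OF pert this] obtain h where h: "bij_betw h \<C> \<C>'" "\<And>D. D \<in> \<C> \<Longrightarrow> 2 \<le> card (D \<inter> h D)" by blast
    have meet: "D \<inter> h D \<noteq> {}" if "D \<in> \<C>" for D using h(2)[OF that] by auto
    have xx: "d x x \<le> \<alpha> * rs ! j E" using P(1) rho_pos by simp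
    have "\<alpha>' = \<alpha>"
      by (rule perturbed_dilation[OF met opt labj viol _ P(1) v(4) xx order.refl d1_def opt' lab' h(1) meet])
        (rule least)
    have ball: "nball P d p r \<subseteq> nball P d1 p r" for p r
      unfolding d1_def by (rule nball_perturb)
    have sub: "E \<union> F \<subseteq> nball P d1 x (\<alpha> * rs ! j E)"
      using EF perturb_center unfolding d1_def nball_def by blast
    \<comment> \<open>After the perturbation \<open>x\<close> can replace the center of
      \<open>E\<close>, and its ball contains \<open>F\<close> as well.\<close>
    have "(c(E := x)) C \<in> P \<and> C \<subseteq> nball P d1 ((c(E := x)) C) (\<alpha> * rs ! j C)" if "C \<in> \<C>" for C
    proof (cases "C = E")
      case True
      then show ?thesis using sub P(1) by simp
    next
      case False
      then show ?thesis using c[OF that] subset_trans[OF _ ball] by simp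
    qed
    from labelled_placement[OF lab1 \<alpha> this] obtain A where
      A: "feasible_placement P d1 rs ks \<alpha> A" "induced_clustering P d1 rs ks \<alpha> A \<C>"
        "\<And>C. C \<in> \<C> \<Longrightarrow> (c(E := x)) C \<in> A (j C)"
      by blast
    have optA: "optimal_placement P d1 rs ks \<alpha> A"
      using feasible_optimal[OF _ A(1)] opt' \<open>\<alpha>' = \<alpha>\<close> by simp
    have "x \<in> A (j E)" using A(3)[OF v(1)] by simp
    then have "shared_ball d1 \<alpha> A E F" using sub v(3) jE unfolding shared_ball_def by blast
    then show False using unshared[OF pert optA A(2) v(1,2)] by blast
  qed
  then show ?thesis using opt labj by blast
qed

end

section \<open>Correctness of the algorithm\<close>

declare extend.simps(2) [simp del]

lemma foldr_funpow: "foldr (\<lambda>_. g) l s = (g ^^ length l) s"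
  by (induction l) auto

text \<open>The dilation is an arbitrary candidate, since soundness concerns all of them. Fractions
  enter the argument only through \<open>near_iff\<close>.\<close>

locale instance_at = radius_classes "{..<n}" rs ks + Metric_space "{..<n}" d
  for n :: nat and rs :: "real list" and ks :: "nat list" and d :: "nat \<Rightarrow> nat \<Rightarrow> real" +
  fixes c :: problem and \<alpha> :: real
  assumes length_matrix: "length (fst c) = n" and dilation_nonneg: "0 \<le> \<alpha>"
    and near_iff: "\<And>i u v. i < length rs \<Longrightarrow> u < n \<Longrightarrow> v < n \<Longrightarrow> near c i u v \<longleftrightarrow> d u v \<le> \<alpha> * rs ! i"
begin

abbreviation "t \<equiv> length rs"

section \<open>Components of the threshold graphs\<close>

definition edges where "edges i = {(u, v). u < n \<and> v < n \<and> near c i u v}"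

definition reach where "reach i u = (edges i)\<^sup>* `` {u}"

lemma edges_refl: "i < t \<Longrightarrow> u < n \<Longrightarrow> (u, u) \<in> edges i"
  using dilation_nonneg radius_nonneg[of i] by (simp add: edges_def near_iff)

lemma edges_antimono: "i \<le> k \<Longrightarrow> k < t \<Longrightarrow> edges k \<subseteq> edges i"
  using radius_mono[of i k] dilation_nonneg mult_left_mono[of "rs ! k" "rs ! i" \<alpha>]
  by (fastforce simp: edges_def near_iff)

lemma reach_self: "u \<in> reach i u"
  by (simp add: reach_def)

lemma reach_bounded: "u < n \<Longrightarrow> reach i u \<subseteq> {..<n}"
proof
  fix v assume "u < n" "v \<in> reach i u"
  then have "(u, v) \<in> (edges i)\<^sup>*" by (simp add: reach_def)
  then show "v \<in> {..<n}" using \<open>u < n\<close> by (induction rule: rtrancl_induct) (auto simp: edges_def)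
qed

lemma reach_eq:
  assumes "i < t" "v \<in> reach i u" shows "reach i v = reach i u"
proof -
  have "sym (edges i)" using assms(1) by (auto simp: sym_def edges_def near_iff commute)
  then have "sym ((edges i)\<^sup>*)" by (rule sym_rtrancl)
  moreover have "(u, v) \<in> (edges i)\<^sup>*" using assms(2) by (simp add: reach_def)
  ultimately have "(v, u) \<in> (edges i)\<^sup>*" "(u, v) \<in> (edges i)\<^sup>*" by (auto dest: symD)
  then show ?thesis unfolding reach_def by (auto intro: rtrancl_trans)
qed

lemma reach_antimono: "i \<le> k \<Longrightarrow> k < t \<Longrightarrow> reach k u \<subseteq> reach i u"
  unfolding reach_def using rtrancl_mono[OF edges_antimono] by blast

text \<open>The iterated neighbourhoods increase because edges are reflexive, and once two
  consecutive ones agree they stay constant. A strictly increasing chain of subsets of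
  \<open>{..<n}\<close> has at most \<open>n\<close> steps, so \<open>n\<close> rounds reach
  everything.\<close>

lemma set_component:
  assumes "i < t" "u < n" shows "set (component c i u) = reach i u"
proof -
  define g where "g S = filter (\<lambda>v. \<exists>w\<in>set S. near c i w v) (rev [0..<n])" for S
  let ?F = "\<lambda>k. (edges i ^^ k) `` {u}"
  have bound: "?F k \<subseteq> {..<n}" for k
  proof -
    have "?F k \<subseteq> reach i u" unfolding reach_def using relpow_imp_rtrancl by blast
    then show ?thesis using reach_bounded[OF assms(2)] by blast
  qed
  have Suc: "?F (Suc k) = edges i `` ?F k" for k by (simp add: relcomp_Image)
  have iter: "set ((g ^^ k) [u]) = ?F k" for k
  proof (induction k)
    case (Suc k)
    have "set ((g ^^ Suc k) [u]) = {v. v < n \<and> (\<exists>w\<in>?F k. near c i w v)}"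
      using Suc by (simp add: g_def[of "(g ^^ k) [u]"])
    also have "\<dots> = edges i `` ?F k" using bound[of k] by (auto simp: edges_def)
    finally show ?case using \<open>?F (Suc k) = _\<close> by simp
  qed simp
  have "?F (card {..<n}) = (\<Union>k. ?F k)"
  proof (rule finite_mono_strict_prefix_implies_finite_fixpoint[OF bound])
    have "?F k \<subseteq> ?F (Suc k)" for k
      using edges_refl[OF assms(1)] bound[of k] unfolding Suc by blast
    then have "mono ?F" by (rule mono_iff_le_Suc[THEN iffD2, rule_format])
    moreover have "range ?F \<subseteq> Pow {..<n}" using bound by blast
    then have "finite (range ?F)" by (rule finite_subset) simp
    ultimately show "\<exists>N. (\<forall>n\<le>N. \<forall>m\<le>N. m < n \<longrightarrow> ?F m \<subset> ?F n) \<and> (\<forall>n\<ge>N. ?F N = ?F n)"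
      by (intro finite_mono_remains_stable_implies_strict_prefix) (simp_all only: Suc, simp)
  qed simp
  also have "\<dots> = reach i u" unfolding reach_def by (auto simp: rtrancl_is_UN_relpow)
  finally have "?F n = reach i u" by simp
  moreover have "component c i u = (g ^^ n) [u]"
    unfolding component_def g_def[abs_def] by (simp add: foldr_funpow indices_eq length_matrix)
  ultimately show ?thesis using iter by simp
qed

lemma component_eq:
  assumes "i < t" "u < n" shows "component c i u = filter (\<lambda>v. v \<in> reach i u) (rev [0..<n])"
proof -
  have "fst c \<noteq> []" using assms(2) length_matrix by auto
  then obtain Q where Q: "component c i u = filter Q (rev [0..<n])"
    unfolding component_def using length_matrix by (cases "fst c") (auto simp: indices_eq)
  have "filter Q l = filter (\<lambda>v. v \<in> set (filter Q l)) l" for l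
    by (rule filter_cong) auto
  then show ?thesis using Q set_component[OF assms] by metis
qed

lemma distinct_component: "i < t \<Longrightarrow> u < n \<Longrightarrow> distinct (component c i u)"
  by (simp add: component_eq)

lemma component_nonempty: "i < t \<Longrightarrow> u < n \<Longrightarrow> component c i u \<noteq> []"
  using set_component reach_self by fastforce

text \<open>Equality of lists and not only of sets: this makes the head independent of the start and
  the representative unique.\<close>

lemma component_cong: "i < t \<Longrightarrow> u < n \<Longrightarrow> v < n \<Longrightarrow> v \<in> reach i u \<Longrightarrow> component c i v = component c i u"
  by (simp add: component_eq reach_eq)

lemma representative_unique:
  assumes "i < t" "u < n" "v < n" "v \<in> reach i u" "is_representative c i u" "is_representative c i v"
  shows "u = v"
  using component_cong[OF assms(1-4)] assms(5,6) by (simp add: is_representative_def)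

lemma representative_exists:
  assumes "i < t" "v < n"
  obtains u where "u < n" "is_representative c i u" "u \<in> reach i v"
proof -
  let ?u = "hd (component c i v)"
  have u: "?u \<in> reach i v" using component_nonempty[OF assms] set_component[OF assms] hd_in_set by blast
  then have "?u < n" using reach_bounded[OF assms(2)] by blast
  moreover have "is_representative c i ?u"
    unfolding is_representative_def component_cong[OF assms calculation u]
    using component_nonempty[OF assms] by simp
  ultimately show ?thesis using u by (rule that)
qed

text \<open>The part of the point set that a scan of \<open>X\<close> at class \<open>i\<close> has
  dealt with. In the middle of a scan it may differ from \<open>set X\<close>; the two agree when
  \<open>X\<close> is closed under reachability.\<close>

definition covered where "covered i X = (\<Union>u\<in>{u \<in> set X. is_representative c i u}. reach i u)"

lemma covered_Nil [simp]: "covered i [] = {}"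
  by (simp add: covered_def)

lemma covered_Cons:
  "covered i (u # X) = (if is_representative c i u then covered i X \<union> reach i u else covered i X)"
  by (auto simp: covered_def)

lemma covered_closed:
  assumes "i < t" "set X \<subseteq> {..<n}" "\<And>u. u \<in> set X \<Longrightarrow> reach i u \<subseteq> set X"
  shows "covered i X = set X"
proof
  show "covered i X \<subseteq> set X" using assms(3) by (auto simp: covered_def)
  show "set X \<subseteq> covered i X"
  proof
    fix v assume v: "v \<in> set X"
    then have "v < n" using assms(2) by auto
    with assms(1) obtain u where u: "u < n" "is_representative c i u" "u \<in> reach i v"
      by (rule representative_exists)
    then have "v \<in> reach i u" using reach_eq[OF assms(1) u(3)] reach_self by simp
    then show "v \<in> covered i X" using u assms(3)[OF v] by (auto simp: covered_def)
  qed
qed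

lemma covered_component:
  assumes "Suc i < t" "u < n" shows "covered (Suc i) (component c i u) = reach i u"
proof -
  have i: "i < t" using assms(1) by simp
  have "reach (Suc i) v \<subseteq> reach i u" if "v \<in> reach i u" for v
    using reach_antimono[of i "Suc i" v] assms(1) reach_eq[OF i that] by simp
  then show ?thesis
    using covered_closed[OF assms(1), of "component c i u"] reach_bounded[OF assms(2), of i]
    unfolding set_component[OF i assms(2)] by blast
qed

lemma covered_disjoint:
  assumes "i < t" "u < n" "set X \<subseteq> {..<n}" "u \<notin> set X" "is_representative c i u"
  shows "covered i X \<inter> reach i u = {}"
proof (rule ccontr)
  assume "\<not> ?thesis"
  then obtain w v where w: "w \<in> reach i u" "w \<in> reach i v" "v \<in> set X" "is_representative c i v"
    by (auto simp: covered_def)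
  then have "v \<in> reach i u"
    using reach_eq[OF assms(1) w(1)] reach_eq[OF assms(1) w(2)] reach_self[of v i] by simp
  with w assms have "u = v" by (intro representative_unique) auto
  then show False using w(3) assms(4) by simp
qed

subsection \<open>Soundness\<close>

text \<open>The meaning of an entry \<open>(v, css)\<close> in a table for the point set
  \<open>Z\<close>.\<close>

inductive partial :: "nat set \<Rightarrow> nat list \<Rightarrow> nat list list \<Rightarrow> bool" where
  empty: "partial {} (replicate t 0) []"
| add: "partial Z v css \<Longrightarrow> i < t \<Longrightarrow> has_center c i Y \<Longrightarrow> distinct Y \<Longrightarrow> set Y \<inter> Z = {} \<Longrightarrow>
    set Y \<subseteq> {..<n} \<Longrightarrow> partial (Z \<union> set Y) (increment i v) (Y # css)"

lemma has_center_nonempty: "has_center c i Y \<Longrightarrow> Y \<noteq> []"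
  by (auto simp: has_center_def)

lemma partial_length: "partial Z v css \<Longrightarrow> length v = t"
  by (induction rule: partial.induct) auto

lemma partial_subset: "partial Z v css \<Longrightarrow> Z \<subseteq> {..<n}"
  by (induction rule: partial.induct) auto

text \<open>Clusters are disjoint and, having a center, nonempty. This shows that the length test of
  \<open>add_cluster\<close> does not reject entries which completeness relies on.\<close>

lemma partial_card: "partial Z v css \<Longrightarrow> length css \<le> card Z"
proof (induction rule: partial.induct)
  case (add Z v css i Y)
  have "finite Z" using partial_subset[OF add.hyps(1)] finite_subset by blast
  moreover have "card (set Y) > 0" using has_center_nonempty[OF add.hyps(3)] by (simp add: card_gt_0_iff)
  ultimately show ?case using add by (simp add: card_Un_disjoint Int_commute)
qed simp

lemma partial_partition:
  "partial Z v css \<Longrightarrow> partition_on Z (set ` set css) \<and> distinct (map set css) \<and> (\<forall>cs\<in>set css. distinct cs)"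
proof (induction rule: partial.induct)
  case empty
  then show ?case by (simp add: partition_on_empty)
next
  case (add Z v css i Y)
  have ne: "set Y \<noteq> {}" using has_center_nonempty[OF add.hyps(3)] by simp
  have "partition_on (Z \<union> set Y) (set ` set css \<union> {set Y})"
    using add ne by (intro partition_on_union partition_on_space) auto
  moreover have "set Y \<notin> set ` set css"
  proof
    assume "set Y \<in> set ` set css"
    moreover have "Z = \<Union>(set ` set css)" using add.IH by (intro partition_onD1) simp
    ultimately have "set Y \<subseteq> Z" by (simp only:) (rule Union_upper)
    then show False using add.hyps(5) ne by (simp add: Int_absorb2)
  qed
  moreover have "set ` set (Y # css) = set ` set css \<union> {set Y}" by simp
  ultimately show ?case using add.IH add.hyps(4) by simp
qed

lemma partial_labelled:
  "partial Z v css \<Longrightarrow> \<exists>j. (\<forall>C\<in>set ` set css. j C < t \<and> (\<exists>p\<in>{..<n}. C \<subseteq> nball {..<n} d p (\<alpha> * rs ! j C))) \<and>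
     (\<forall>k<t. card {C \<in> set ` set css. j C = k} = v ! k)"
proof (induction rule: partial.induct)
  case empty
  then show ?case by simp
next
  case (add Z v css i Y)
  then obtain j where j: "\<And>C. C \<in> set ` set css \<Longrightarrow> j C < t \<and> (\<exists>p\<in>{..<n}. C \<subseteq> nball {..<n} d p (\<alpha> * rs ! j C))"
    "\<And>k. k < t \<Longrightarrow> card {C \<in> set ` set css. j C = k} = v ! k"
    by blast
  let ?j = "j(set Y := i)"
  have Y: "set Y \<notin> set ` set css"
    using partial_partition[OF partial.add[OF add.hyps]] by auto
  obtain z where z: "z \<in> set Y" "\<forall>w\<in>set Y. near c i z w" using add.hyps(3) by (auto simp: has_center_def)
  have "set Y \<subseteq> nball {..<n} d z (\<alpha> * rs ! i)"
  proof
    fix w assume w: "w \<in> set Y"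
    then have "z < n" "w < n" using z add.hyps(6) by auto
    then show "w \<in> nball {..<n} d z (\<alpha> * rs ! i)"
      using z(2) w near_iff[OF add.hyps(2), of z w] by (simp add: nball_def)
  qed
  moreover have "z \<in> {..<n}" using z add.hyps(6) by auto
  ultimately have A: "?j C < t \<and> (\<exists>p\<in>{..<n}. C \<subseteq> nball {..<n} d p (\<alpha> * rs ! ?j C))"
    if "C \<in> set ` set (Y # css)" for C
    using that j(1)[of C] add.hyps(2) by (cases "C = set Y") auto
  have B: "card {C \<in> set ` set (Y # css). ?j C = k} = increment i v ! k" if k: "k < t" for k
  proof -
    have "{C \<in> set ` set (Y # css). ?j C = k} =
        (if k = i then insert (set Y) {C \<in> set ` set css. j C = k} else {C \<in> set ` set css. j C = k})"
      using Y by auto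
    then show ?thesis
      using j(2)[OF k] Y add.hyps(2) k partial_length[OF add.hyps(1)]
      by (auto simp: increment_eq nth_list_update)
  qed
  show ?case
    by (rule exI[of _ ?j], rule conjI, rule ballI, erule A, intro allI impI, erule B)
qed

definition sound_table where "sound_table Z T \<longleftrightarrow> (\<forall>e\<in>set T. partial Z (fst e) (snd e))"

lemma sound_table_Nil [simp]: "sound_table Z []"
  by (simp add: sound_table_def)

lemma sound_table_merge: "sound_table Z T1 \<Longrightarrow> sound_table Z T2 \<Longrightarrow> sound_table Z (merge T1 T2)"
  using merge_subset[of T1 T2] unfolding sound_table_def by blast

lemma sound_table_add_cluster:
  assumes "sound_table Z T" "i < t" "has_center c i Y" "distinct Y" "set Y \<inter> Z = {}" "set Y \<subseteq> {..<n}"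
  shows "sound_table (Z \<union> set Y) (add_cluster n i Y T)"
  using assms unfolding sound_table_def add_cluster_def by (auto intro!: partial.add)

text \<open>Induction on the classes left and, inside, on the scanned list. At a representative both
  alternatives enlarge the covered set by exactly its component, which is disjoint from
  \<open>Z\<close> and from the components treated before.\<close>

lemma extend_sound:
  assumes "sound_table Z T" "i + m = t" "set X \<subseteq> {..<n}" "distinct X"
    and "i < t \<Longrightarrow> Z \<inter> (\<Union>u\<in>set X. reach i u) = {}"
  shows "sound_table (Z \<union> covered i X) (extend m c i X T)"
  using assms
proof (induction m arbitrary: i X T Z)
  case 0
  then show ?case by simp
next
  case (Suc m)
  note IH = Suc.IH
  have i: "i < t" using Suc.prems(2) by simp
  have disj: "Z \<inter> (\<Union>u\<in>set X. reach i u) = {}" by (rule Suc.prems(5)[OF i])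
  show ?case
    using Suc.prems(3,4) disj
  proof (induction X)
    case Nil
    then show ?case using Suc.prems(1) by (simp add: extend_Nil)
  next
    case (Cons u X)
    let ?T = "extend (Suc m) c i X T" and ?Z = "Z \<union> covered i X" and ?Y = "component c i u"
    have T: "sound_table ?Z ?T" using Cons by auto
    show ?case
    proof (cases "is_representative c i u")
      case True
      have u: "u < n" using Cons.prems by simp
      have Y: "set ?Y = reach i u" by (rule set_component[OF i u])
      have cov: "Z \<union> covered i (u # X) = ?Z \<union> set ?Y" using True Y by (auto simp: covered_Cons)
      have dis: "?Z \<inter> reach i u = {}"
        using Cons.prems covered_disjoint[OF i u _ _ True, of X] by auto
      have add: "sound_table (?Z \<union> set ?Y) (if has_center c i ?Y then add_cluster n i ?Y ?T else [])"
        using sound_table_add_cluster[OF T i _ distinct_component[OF i u]] dis Y reach_bounded[OF u, of i] by auto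
      have rec: "sound_table (?Z \<union> set ?Y) (extend m c (Suc i) ?Y ?T)"
      proof (cases "m = 0")
        \<comment> \<open>No class is left for a nonempty component, so this alternative contributes
          no entries.\<close>
        case True
        then show ?thesis using component_nonempty[OF i u] by simp
      next
        case False
        then have i': "Suc i < t" using Suc.prems(2) by simp
        have "reach (Suc i) v \<subseteq> reach i u" if "v \<in> reach i u" for v
          using reach_antimono[of i "Suc i" v] i' reach_eq[OF i that] by simp
        then have "sound_table (?Z \<union> covered (Suc i) ?Y) (extend m c (Suc i) ?Y ?T)"
          using dis Y reach_bounded[OF u, of i] Suc.prems(2)
          by (intro IH[OF T]) (auto simp: distinct_component[OF i u])
        then show ?thesis using covered_component[OF i' u] Y by simp
      qed
      show ?thesis
        unfolding cov extend_Cons length_matrix using True sound_table_merge[OF add rec] by simp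
    next
      case False
      then show ?thesis using T by (simp add: covered_Cons extend_Cons)
    qed
  qed
qed

lemma hits_sound:
  assumes "e \<in> set (hits t c ks)"
  shows "partial {..<n} ks (snd e)"
proof -
  let ?X = "indices (fst c)"
  have X: "?X = rev [0..<n]" by (simp add: indices_eq length_matrix)
  have "sound_table ({} \<union> covered 0 ?X) (extend t c 0 ?X [(replicate t 0, [])])"
    by (rule extend_sound) (auto simp: X sound_table_def intro: partial.empty)
  then have "partial (covered 0 ?X) ks (snd e)"
    using assms by (auto simp: hits_def sound_table_def)
  moreover have "covered 0 ?X = {..<n}"
  proof (cases "t = 0")
    case True
    then have Nil: "?X = []" using assms by (auto simp: hits_def split: if_splits)
    then have "n = 0" using X by simp
    then show ?thesis unfolding Nil covered_Nil by simp
  next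
    case False
    moreover have "set ?X = {..<n}" by (auto simp: X)
    ultimately show ?thesis using covered_closed[of 0 ?X] reach_bounded[of _ 0] by simp
  qed
  ultimately show ?thesis by simp
qed

lemma hits_labelled:
  assumes "e \<in> set (hits t c ks)"
  shows "\<exists>j. labelled {..<n} d rs ks \<alpha> (set ` set (snd e)) j"
    "distinct (map set (snd e))" "\<forall>cs\<in>set (snd e). distinct cs"
  using partial_partition[OF hits_sound[OF assms]] partial_labelled[OF hits_sound[OF assms]]
  by (auto simp: labelled_def)

subsection \<open>Completeness\<close>

context
  fixes \<C> j
  assumes lab: "labelled {..<n} d rs ks \<alpha> \<C> j" and sep: "separated d \<alpha> \<C> j"
begin

lemma part: "partition_on {..<n} \<C>"
  using lab by (simp add: labelled_def)

lemma cluster_class: "D \<in> \<C> \<Longrightarrow> j D < t"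
  using lab by (simp add: labelled_def)

lemma cluster_subset: "D \<in> \<C> \<Longrightarrow> D \<subseteq> {..<n}"
  using partition_onD1[OF part] by auto

text \<open>By separation no path leaves the cluster. The center of its ball is adjacent to all its
  points, so it lies in the component and hence in the cluster; looking for centers only inside a
  component, as \<open>has_center\<close> does, therefore finds it.\<close>

lemma cluster_reach:
  assumes D: "D \<in> \<C>" "u \<in> D"
  shows "reach (j D) u = D" and "\<exists>p\<in>D. \<forall>w\<in>D. near c (j D) p w"
proof -
  have jD: "j D < t" using D by (simp add: cluster_class)
  have sub: "reach (j D) u \<subseteq> D"
  proof
    fix v assume "v \<in> reach (j D) u"
    then have "(u, v) \<in> (edges (j D))\<^sup>*" by (simp add: reach_def)
    then show "v \<in> D"
    proof (induction rule: rtrancl_induct)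
      case base
      then show ?case by (rule D(2))
    next
      case (step v w)
      then have "w < n" "d v w \<le> \<alpha> * rs ! j D" using near_iff[OF jD] by (auto simp: edges_def)
      then show ?case using sep D(1) step.IH unfolding separated_def by force
    qed
  qed
  obtain p where p: "p < n" "D \<subseteq> nball {..<n} d p (\<alpha> * rs ! j D)"
    using lab D(1) unfolding labelled_def by blast
  have edge: "(p, w) \<in> edges (j D)" "(w, p) \<in> edges (j D)" if "w \<in> D" for w
    using that p near_iff[OF jD] commute[of p w] by (auto simp: edges_def nball_def)
  have "p \<in> reach (j D) u" using edge(2)[OF D(2)] by (auto simp: reach_def)
  then have "p \<in> D" using sub by blast
  moreover have "\<forall>w\<in>D. near c (j D) p w" using edge(1) by (auto simp: edges_def)
  ultimately show "\<exists>p\<in>D. \<forall>w\<in>D. near c (j D) p w" by blast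
  have "D \<subseteq> reach (j D) u"
  proof
    fix w assume "w \<in> D"
    then have "(u, p) \<in> edges (j D)" "(p, w) \<in> edges (j D)" using edge D(2) by blast+
    then show "w \<in> reach (j D) u" unfolding reach_def by auto
  qed
  with sub show "reach (j D) u = D" by blast
qed

text \<open>The vector of counts that the table must contain after the points of \<open>S\<close>
  have been partitioned as in \<C>.\<close>

definition plus_clusters where
  "plus_clusters v S = map (\<lambda>k. v ! k + card {D \<in> \<C>. D \<subseteq> S \<and> j D = k}) [0..<t]"

lemma plus_clusters_empty: "length v = t \<Longrightarrow> plus_clusters v {} = v"
proof -
  assume "length v = t"
  moreover have "{D \<in> \<C>. D \<subseteq> {} \<and> j D = k} = {}" for k using partition_onD3[OF part] by auto
  ultimately show ?thesis
    unfolding plus_clusters_def by (simp only: card.empty add_0_right) (metis map_nth)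
qed

lemma plus_clusters_union:
  assumes "S \<inter> Y = {}" "\<And>D. D \<in> \<C> \<Longrightarrow> D \<inter> Y \<noteq> {} \<Longrightarrow> D \<subseteq> Y"
  shows "plus_clusters (plus_clusters v S) Y = plus_clusters v (S \<union> Y)"
proof -
  have "card {D \<in> \<C>. D \<subseteq> S \<union> Y \<and> j D = k} = card {D \<in> \<C>. D \<subseteq> S \<and> j D = k} + card {D \<in> \<C>. D \<subseteq> Y \<and> j D = k}" for k
  proof -
    have "{D \<in> \<C>. D \<subseteq> S \<union> Y \<and> j D = k} = {D \<in> \<C>. D \<subseteq> S \<and> j D = k} \<union> {D \<in> \<C>. D \<subseteq> Y \<and> j D = k}"
      using assms(2) by auto
    moreover have "{D \<in> \<C>. D \<subseteq> S \<and> j D = k} \<inter> {D \<in> \<C>. D \<subseteq> Y \<and> j D = k} = {}"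
      using assms(1) partition_onD3[OF part] by (auto, metis Int_greatest subset_empty)
    ultimately show ?thesis using finite_parts[OF part] by (simp add: card_Un_disjoint)
  qed
  then show ?thesis by (simp add: plus_clusters_def)
qed

text \<open>The condition on classes says that no cluster met so far belongs to an earlier class.
  For the cluster \<open>D\<close> of a representative there are two cases: it has class
  \<open>i\<close> and is the whole component, or every cluster that meets the component is
  contained in it and has a later class, so the recursive call applies. The stored solution may
  differ from \<C>, only its counts are followed.\<close>

lemma extend_complete:
  assumes "sound_table Z T" "i + m = t" "set X \<subseteq> {..<n}" "distinct X"
    and "i < t \<Longrightarrow> Z \<inter> (\<Union>u\<in>set X. reach i u) = {}"
    and "\<And>u D. u \<in> set X \<Longrightarrow> D \<in> \<C> \<Longrightarrow> D \<inter> reach i u \<noteq> {} \<Longrightarrow> i \<le> j D"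
    and "v \<in> fst ` set T"
  shows "plus_clusters v (covered i X) \<in> fst ` set (extend m c i X T)"
  using assms
proof (induction m arbitrary: i X T Z v)
  case 0
  have len: "length v = t" using 0 partial_length by (auto simp: sound_table_def)
  \<comment> \<open>All classes are used up, whereas a point of \<open>X\<close> would lie in a
    cluster of class at least \<open>t\<close>.\<close>
  have "X = []"
  proof (rule ccontr)
    assume "X \<noteq> []"
    then obtain u where u: "u \<in> set X" "u < n" using 0(3) by (cases X) auto
    then have "u \<in> \<Union>\<C>" using partition_onD1[OF part] by auto
    then obtain D where D: "D \<in> \<C>" "u \<in> D" by blast
    then have "i \<le> j D" using 0(6)[OF u(1) D(1)] reach_self[of u i] by blast
    then show False using cluster_class[OF D(1)] 0(2) by simp
  qed
  then show ?case using 0(7) len by (simp add: plus_clusters_empty)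
next
  case (Suc m)
  note IH = Suc.IH
  have i: "i < t" using Suc.prems(2) by simp
  have disj: "Z \<inter> (\<Union>u\<in>set X. reach i u) = {}" by (rule Suc.prems(5)[OF i])
  show ?case
    using Suc.prems(3,4) disj Suc.prems(6)
  proof (induction X)
    case Nil
    have "length v = t" using Suc.prems partial_length by (auto simp: sound_table_def)
    then show ?case using Suc.prems(7) by (simp add: plus_clusters_empty extend_Nil)
  next
    case (Cons u X)
    let ?T = "extend (Suc m) c i X T" and ?Z = "Z \<union> covered i X" and ?Y = "component c i u"
    let ?v = "plus_clusters v (covered i X)"
    have disX: "Z \<inter> (\<Union>u\<in>set X. reach i u) = {}" using Cons.prems(3) by auto
    have v: "?v \<in> fst ` set ?T" using Cons.IH Cons.prems(1,2,4) disX by auto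
    show ?case
    proof (cases "is_representative c i u")
      case True
      have u: "u < n" using Cons.prems by simp
      have Y: "set ?Y = reach i u" by (rule set_component[OF i u])
      have T: "sound_table ?Z ?T"
        using Suc.prems(1,2) Cons.prems(1,2) disX by (intro extend_sound) auto
      have dis: "covered i X \<inter> reach i u = {}"
        using Cons.prems covered_disjoint[OF i u _ _ True, of X] by auto
      have disZ: "?Z \<inter> reach i u = {}" using dis Cons.prems(3) by auto
      obtain D where D: "D \<in> \<C>" "u \<in> D" using partition_onD1[OF part] u by auto
      have class_le: "i \<le> j D'" if "D' \<in> \<C>" "D' \<inter> reach i u \<noteq> {}" for D'
        using Cons.prems(4)[of u D'] that by simp
      have inside: "D' \<subseteq> reach i u" if D': "D' \<in> \<C>" "D' \<inter> reach i u \<noteq> {}" for D'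
      proof -
        obtain w where w: "w \<in> D'" "w \<in> reach i u" using D'(2) by blast
        have "D' = reach (j D') w" using cluster_reach(1)[OF D'(1) w(1)] by simp
        also have "\<dots> \<subseteq> reach i w" using class_le[OF D'] cluster_class[OF D'(1)] by (rule reach_antimono)
        finally show ?thesis using reach_eq[OF i w(2)] by simp
      qed
      have union: "plus_clusters ?v (reach i u) = plus_clusters v (covered i (u # X))"
        using plus_clusters_union[OF dis inside] True by (simp add: covered_Cons)
      have "plus_clusters ?v (reach i u) \<in> fst ` set (merge
          (if has_center c i ?Y then add_cluster n i ?Y ?T else []) (extend m c (Suc i) ?Y ?T))"
      proof (cases "j D = i")
        case True
        then have DY: "D = reach i u" using cluster_reach(1)[OF D] by simp
        have center: "has_center c i ?Y"
          using cluster_reach(2)[OF D] True unfolding has_center_def Y DY by simp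
        obtain e where e: "e \<in> set ?T" "fst e = ?v" using v by force
        have p: "partial ?Z ?v (snd e)" using T e by (auto simp: sound_table_def)
        \<comment> \<open>The point \<open>u\<close> is still uncovered, so at most
          \<open>n - 1\<close> points and hence clusters have been used.\<close>
        have "length (snd e) < n"
        proof -
          have "length (snd e) \<le> card ?Z" by (rule partial_card[OF p])
          also have "\<dots> < card {..<n}"
          proof (rule psubset_card_mono)
            show "?Z \<subset> {..<n}" using partial_subset[OF p] disZ reach_self[of u i] u by blast
          qed simp
          finally show ?thesis by simp
        qed
        then have "increment i ?v \<in> fst ` set (add_cluster n i ?Y ?T)"
          using e by (force simp: add_cluster_def)
        moreover have "increment i ?v = plus_clusters ?v (reach i u)"
        proof (rule nth_equalityI)
          have len: "length ?v = t" by (rule partial_length[OF p])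
          then show "length (increment i ?v) = length (plus_clusters ?v (reach i u))"
            by (simp add: plus_clusters_def)
          fix k assume "k < length (increment i ?v)"
          then have k: "k < t" using len by simp
          have "{D' \<in> \<C>. D' \<subseteq> reach i u \<and> j D' = k} = (if k = i then {D} else {})"
          proof -
            have "D' = D" if "D' \<in> \<C>" "D' \<subseteq> reach i u" for D'
            proof -
              have "D' \<noteq> {}" using partition_onD3[OF part] that(1) by metis
              then obtain w where "w \<in> D'" by blast
              then show ?thesis using partition_inter[OF part that(1) D(1)] that(2) DY by blast
            qed
            then show ?thesis using D DY True by auto
          qed
          then have "plus_clusters ?v (reach i u) ! k = ?v ! k + (if k = i then 1 else 0)"
            using k by (simp add: plus_clusters_def[of ?v])
          then show "increment i ?v ! k = plus_clusters ?v (reach i u) ! k"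
            using k i len by (simp add: increment_eq nth_list_update)
        qed
        ultimately show ?thesis using center by (simp add: merge_keys)
      next
        case False
        \<comment> \<open>A cluster of class \<open>i\<close> that meets the component would be all
          of it; it would contain \<open>u\<close> and be \<open>D\<close>, whose class is not
          \<open>i\<close>.\<close>
        have class_less: "Suc i \<le> j D'" if D': "D' \<in> \<C>" "D' \<inter> reach i u \<noteq> {}" for D'
        proof -
          have "j D' \<noteq> i"
          proof
            assume "j D' = i"
            obtain w where w: "w \<in> D'" "w \<in> reach i u" using D'(2) by blast
            have "D' = reach i u"
              using cluster_reach(1)[OF D'(1) w(1)] \<open>j D' = i\<close> reach_eq[OF i w(2)] by simp
            then have "D' = D" using partition_inter[OF part D'(1) D(1), of u] D(2) reach_self[of u i] by blast
            then show False using \<open>j D' = i\<close> False by simp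
          qed
          then show ?thesis using class_le[OF D'] by simp
        qed
        have "D \<inter> reach i u \<noteq> {}" using D(2) reach_self[of u i] by blast
        then have i': "Suc i < t" using class_less[OF D(1)] cluster_class[OF D(1)] by simp
        have sub: "reach (Suc i) w \<subseteq> reach i u" if "w \<in> reach i u" for w
          using reach_antimono[of i "Suc i" w] i' reach_eq[OF i that] by simp
        have "plus_clusters ?v (covered (Suc i) ?Y) \<in> fst ` set (extend m c (Suc i) ?Y ?T)"
        proof (rule IH[OF T])
          show "?Z \<inter> (\<Union>w\<in>set ?Y. reach (Suc i) w) = {}" using sub disZ Y by blast
          show "Suc i \<le> j D'" if "w \<in> set ?Y" "D' \<in> \<C>" "D' \<inter> reach (Suc i) w \<noteq> {}" for w D'
            using class_less[OF that(2)] sub[of w] that(1,3) Y by blast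
        qed (use Suc.prems(2) Y reach_bounded[OF u, of i] distinct_component[OF i u] v in auto)
        then show ?thesis using covered_component[OF i' u] by (simp add: merge_keys)
      qed
      then show ?thesis unfolding union extend_Cons length_matrix using True by simp
    next
      case False
      then show ?thesis using v by (simp add: covered_Cons extend_Cons)
    qed
  qed
qed

lemma hits_complete: "hits t c ks \<noteq> []"
proof -
  let ?X = "indices (fst c)" and ?T = "[(replicate t 0, [])] :: entry list"
  have X: "?X = rev [0..<n]" by (simp add: indices_eq length_matrix)
  have "plus_clusters (replicate t 0) (covered 0 ?X) \<in> fst ` set (extend t c 0 ?X ?T)"
    by (rule extend_complete[where Z = "{}"]) (auto simp: X sound_table_def intro: partial.empty)
  moreover have "covered 0 ?X = {..<n}"
  proof (cases "t = 0")
    case True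
    then have "\<C> = {}" using cluster_class by fastforce
    then have empty: "{..<n} = {}" using partition_onD1[OF part] by simp
    have "n = 0" using arg_cong[OF empty, of card] by simp
    then have Nil: "?X = []" using X by simp
    show ?thesis unfolding Nil covered_Nil empty ..
  next
    case False
    moreover have "set ?X = {..<n}" by (auto simp: X)
    ultimately show ?thesis using covered_closed[of 0 ?X] reach_bounded[of _ 0] by simp
  qed
  moreover have "plus_clusters (replicate t 0) {..<n} = ks"
  proof (rule nth_equalityI)
    fix k assume "k < length (plus_clusters (replicate t 0) {..<n})"
    then have k: "k < t" by (simp add: plus_clusters_def)
    have "{D \<in> \<C>. D \<subseteq> {..<n} \<and> j D = k} = {D \<in> \<C>. j D = k}" using cluster_subset by blast
    then show "plus_clusters (replicate t 0) {..<n} ! k = ks ! k"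
      using lab k by (simp add: plus_clusters_def labelled_def)
  qed (simp add: plus_clusters_def length_ks)
  ultimately have "ks \<in> fst ` set (extend t c 0 ?X ?T)" by simp
  then obtain e where "e \<in> set (extend t c 0 ?X ?T)" "fst e = ks" by blast
  then have "e \<in> set (hits t c ks)" by (simp add: hits_def)
  then show ?thesis by auto
qed

end

end

subsection \<open>Encoded instances\<close>

definition frac_of :: "rat \<Rightarrow> frac" where
  "frac_of q = (nat (fst (quotient_of q)), nat (snd (quotient_of q)))"

lemma enc_rat_frac: "enc_rat q = enc_frac (frac_of q)"
  by (simp add: enc_rat_def frac_of_def)

lemma frac_of:
  assumes "0 \<le> q"
  shows "0 < snd (frac_of q)" "of_rat q = real (fst (frac_of q)) / real (snd (frac_of q))"
proof -
  obtain a b where ab: "quotient_of q = (a, b)" by (cases "quotient_of q")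
  then have b: "0 < b" by (rule quotient_of_denom_pos)
  have q: "q = of_int a / of_int b" using ab by (rule quotient_of_div)
  then have a: "0 \<le> a" using assms b by (simp add: zero_le_divide_iff)
  show "0 < snd (frac_of q)" using ab b by (simp add: frac_of_def)
  show "of_rat q = real (fst (frac_of q)) / real (snd (frac_of q))"
    using ab a b by (simp add: frac_of_def q of_rat_divide)
qed

definition matrix_of :: "instance_data \<Rightarrow> frac list list" where
  "matrix_of I = map (\<lambda>p. map (\<lambda>q. frac_of (distance I p q)) [0..<npoints I]) [0..<npoints I]"

definition input_of :: "instance_data \<Rightarrow> frac list list \<times> frac list \<times> nat list" where
  "input_of I = (matrix_of I, map frac_of (radii I), mults I)"

lemma enc_list_map: "enc_list f (map g l) = enc_list (\<lambda>x. f (g x)) l"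
  by (induction l) auto

lemma enc_input_of: "enc_input (input_of I) = enc_instance I"
  by (simp add: input_of_def matrix_of_def enc_instance_def enc_list_map enc_rat_frac[abs_def])

lemma best_minimum:
  assumes "l \<noteq> []" "\<And>s. s \<in> set l \<Longrightarrow> 0 < snd (fst s)"
  shows "\<exists>s\<in>set l. best l = [s] \<and> (\<forall>s'\<in>set l. real (fst (fst s)) / real (snd (fst s)) \<le> real (fst (fst s')) / real (snd (fst s')))"
  using assms
proof (induction l)
  case (Cons x l)
  let ?f = "\<lambda>s. real (fst (fst s)) / real (snd (fst s))"
  show ?case
  proof (cases "l = []")
    case True
    then show ?thesis by (simp add: best_def)
  next
    case False
    with Cons obtain s where s: "s \<in> set l" "best l = [s]" "\<forall>s'\<in>set l. ?f s \<le> ?f s'" by auto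
    have pos: "0 < snd (fst x)" "0 < snd (fst s)" using Cons.prems s by auto
    have "best (x # l) = (if fst (fst x) * snd (fst s) \<le> fst (fst s) * snd (fst x) then [x] else [s])"
      using s(2) by (simp add: best_def)
    moreover have "fst (fst x) * snd (fst s) \<le> fst (fst s) * snd (fst x) \<longleftrightarrow> ?f x \<le> ?f s"
    proof -
      have "?f x \<le> ?f s \<longleftrightarrow> real (fst (fst x)) * real (snd (fst s)) \<le> real (fst (fst s)) * real (snd (fst x))"
        using pos by (simp add: divide_le_eq pos_le_divide_eq mult.commute)
      then show ?thesis by (simp only: of_nat_mult[symmetric] of_nat_le_iff)
    qed
    ultimately show ?thesis using s by (cases "?f x \<le> ?f s") force+
  qed
qed simp

lemma candidatesI:
  assumes "e \<in> set (concat M)" "r \<in> set rs" "fst r \<noteq> 0"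
  shows "(fst e * snd r, snd e * fst r) \<in> set (candidates M rs)"
proof -
  let ?row = "\<lambda>r. if fst r = 0 then [] else map (\<lambda>d. (fst d * snd r, snd d * fst r)) (concat M)"
  have "(fst e * snd r, snd e * fst r) \<in> set (?row r)"
    using assms(1,3) by (simp del: set_concat) (erule image_eqI[rotated], simp)
  moreover have "set (?row r) \<subseteq> set (concat (map ?row rs))"
    unfolding set_concat set_map image_image using assms(2) by (rule UN_upper)
  ultimately show ?thesis unfolding candidates_def by (simp del: set_concat) blast
qed

locale nukc =
  fixes t :: nat and I :: instance_data
  assumes nukc: "nukc_instance t I"
begin

lemma metric: "Metric_space {..<npoints I} (dst I)"
  using nukc by (simp add: nukc_instance_def pts_def)

lemma distance_nonneg: "0 \<le> distance I p q"
  using Metric_space.nonneg[OF metric, of p q] by (simp add: dst_def)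

lemma radius_rat_nonneg: "r \<in> set (radii I) \<Longrightarrow> 0 \<le> r"
  using nukc by (auto simp: nukc_instance_def)

lemma length_radii: "length (radii I) = t" "length (rds I) = t" "length (mults I) = t"
  using nukc by (auto simp: nukc_instance_def rds_def)

lemma radius_classes: "radius_classes {..<npoints I} (rds I) (mults I)"
proof
  show "sorted_wrt (>) (rds I)"
    using nukc by (simp add: nukc_instance_def rds_def sorted_wrt_map of_rat_less)
qed (auto simp: length_radii rds_def radius_rat_nonneg)

lemma instance_at:
  assumes "0 < b"
  shows "instance_at (npoints I) (rds I) (mults I) (dst I) (matrix_of I, map frac_of (radii I), a, b) (real a / real b)"
proof (intro instance_at.intro instance_at_axioms.intro radius_classes metric)
  show "length (fst (matrix_of I, map frac_of (radii I), a, b)) = npoints I" by (simp add: matrix_of_def)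
  show "0 \<le> real a / real b" by simp
  fix i u v assume i: "i < length (rds I)" and u: "u < npoints I" and v: "v < npoints I"
  let ?d = "frac_of (distance I u v)" and ?r = "frac_of (radii I ! i)"
  have i': "i < length (radii I)" using i by (simp add: length_radii)
  have "nth_or (0, 1) (map frac_of (radii I)) i = ?r" "nth_or (0, 1) (nth_or [] (matrix_of I) u) v = ?d"
    using i' u v by (simp_all add: nth_or_eq matrix_of_def)
  then have "near (matrix_of I, map frac_of (radii I), a, b) i u v \<longleftrightarrow>
      fst ?d * (b * snd ?r) \<le> a * fst ?r * snd ?d"
    by (simp add: near_def)
  also have "\<dots> \<longleftrightarrow> real (fst ?d) * (real b * real (snd ?r)) \<le> real a * real (fst ?r) * real (snd ?d)"
    by (simp only: of_nat_mult[symmetric] of_nat_le_iff)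
  also have "\<dots> \<longleftrightarrow> real (fst ?d) / real (snd ?d) \<le> (real a / real b) * (real (fst ?r) / real (snd ?r))"
  proof -
    have "0 < snd ?d" "0 < snd ?r"
      using frac_of(1)[OF distance_nonneg] frac_of(1)[OF radius_rat_nonneg] i' by auto
    then show ?thesis using assms by (simp add: divide_le_eq pos_le_divide_eq mult_ac)
  qed
  also have "\<dots> \<longleftrightarrow> dst I u v \<le> real a / real b * rds I ! i"
    using frac_of(2)[OF distance_nonneg, of u v] frac_of(2)[OF radius_rat_nonneg, of "radii I ! i"] i'
    by (simp add: dst_def rds_def)
  finally show "near (matrix_of I, map frac_of (radii I), a, b) i u v \<longleftrightarrow> dst I u v \<le> real a / real b * rds I ! i" .
qed

lemma candidates_pos:
  assumes "s \<in> set (candidates (matrix_of I) (map frac_of (radii I)))" shows "0 < snd s"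
proof -
  have pos: "0 < snd x" if "y \<in> set (matrix_of I)" "x \<in> set y" for x y
    using that frac_of(1)[OF distance_nonneg] by (auto simp: matrix_of_def)
  show ?thesis using assms by (fastforce simp: candidates_def split: if_splits dest: pos)
qed

lemma critical_candidate:
  assumes "\<alpha> \<in> radius_classes.critical {..<npoints I} (rds I) (dst I)"
  obtains a b where "(a, b) \<in> set (candidates (matrix_of I) (map frac_of (radii I)))" "\<alpha> = real a / real b"
proof -
  consider "\<alpha> = 0" | p q i where "p < npoints I" "q < npoints I" "i < t" "0 < rds I ! i" "\<alpha> = dst I p q / rds I ! i"
    using assms unfolding radius_classes.critical_def[OF radius_classes] by (auto simp: length_radii)
  then show ?thesis
  proof cases
    case 1
    have "(0, 1) \<in> set (candidates (matrix_of I) (map frac_of (radii I)))" by (simp add: candidates_def)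
    then show ?thesis using 1 by (intro that) auto
  next
    case 2
    let ?d = "frac_of (distance I p q)" and ?r = "frac_of (radii I ! i)"
    have i: "radii I ! i \<in> set (radii I)" "rds I ! i = of_rat (radii I ! i)"
      using 2(3) by (auto simp: length_radii rds_def)
    note r = frac_of[OF radius_rat_nonneg[OF i(1)]]
    have pos: "fst ?r \<noteq> 0" using 2(4) unfolding i(2) r(2) by (cases "fst ?r = 0") auto
    let ?row = "map (\<lambda>q. frac_of (distance I p q)) [0..<npoints I]"
    have "?row \<in> set (matrix_of I)"
      unfolding matrix_of_def set_map using 2(1) by (intro image_eqI[of _ _ p]) simp_all
    moreover have "?d \<in> set ?row" using 2(2) by simp
    ultimately have "?d \<in> set (concat (matrix_of I))" unfolding set_concat by (rule UN_I)
    moreover have "?r \<in> set (map frac_of (radii I))" using i(1) by simp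
    ultimately have "(fst ?d * snd ?r, snd ?d * fst ?r) \<in> set (candidates (matrix_of I) (map frac_of (radii I)))"
      using pos by (rule candidatesI)
    moreover have "\<alpha> = real (fst ?d * snd ?r) / real (snd ?d * fst ?r)"
      unfolding 2(5) i(2) dst_def r(2) frac_of(2)[OF distance_nonneg] by simp
    ultimately show ?thesis by (rule that)
  qed
qed

lemma solve_solution:
  assumes opt: "optimal_dilation {..<npoints I} (dst I) (rds I) (mults I) \<alpha>"
    and lab: "labelled {..<npoints I} (dst I) (rds I) (mults I) \<alpha> \<C> j"
    and sep: "radius_classes.separated {..<npoints I} (rds I) (dst I) \<alpha> \<C> j"
  shows "is_solution I (epair enc_frac (enc_list (enc_list enc_nat)) (solve t (matrix_of I) (map frac_of (radii I)) (mults I)))"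
proof -
  interpret R: radius_classes "{..<npoints I}" "rds I" "mults I" by (rule radius_classes)
  let ?M = "matrix_of I" and ?R = "map frac_of (radii I)"
  let ?sols = "solutions t ?M ?R (mults I)"
  have mem: "s \<in> set ?sols \<longleftrightarrow> fst s \<in> set (candidates ?M ?R) \<and>
      (\<exists>e\<in>set (hits t (?M, ?R, fst s) (mults I)). snd e = snd s)" for s
    by (cases s) (force simp: solutions_def)
  obtain a b where ab: "(a, b) \<in> set (candidates ?M ?R)" "\<alpha> = real a / real b"
    using critical_candidate R.optimal_dilation_critical[OF metric opt] by blast
  have b: "0 < b" using candidates_pos[OF ab(1)] by simp
  have "hits t (?M, ?R, a, b) (mults I) \<noteq> []"
    using instance_at.hits_complete[OF instance_at[OF b] lab[unfolded ab(2)] sep[unfolded ab(2)]]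
    by (simp add: length_radii)
  then obtain e where e: "e \<in> set (hits t (?M, ?R, a, b) (mults I))" by (meson list.set_sel(1))
  then have s0: "((a, b), snd e) \<in> set ?sols" using ab(1) by (auto simp: mem)
  then have "?sols \<noteq> []" by auto
  then obtain s where s: "s \<in> set ?sols" "best ?sols = [s]"
    "\<forall>s'\<in>set ?sols. real (fst (fst s)) / real (snd (fst s)) \<le> real (fst (fst s')) / real (snd (fst s'))"
    using best_minimum[of ?sols] candidates_pos mem by blast
  obtain a' b' css where s': "s = ((a', b'), css)" by (metis surj_pair)
  have b': "0 < b'" using s(1) s' mem[of s] candidates_pos[of "(a', b')"] by simp
  obtain e' where e': "e' \<in> set (hits t (?M, ?R, a', b') (mults I))" "snd e' = css"
    using s(1) s' mem[of s] by auto
  have le: "real a' / real b' \<le> \<alpha>" using s(3) s0 s' ab(2) by force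
  note hit = instance_at.hits_labelled[OF instance_at[OF b', of a'], unfolded length_radii, OF e'(1), unfolded e'(2)]
  obtain j' where "labelled {..<npoints I} (dst I) (rds I) (mults I) (real a' / real b') (set ` set css) j'"
    using hit(1) by blast
  then obtain A where A: "feasible_placement {..<npoints I} (dst I) (rds I) (mults I) (real a' / real b') A"
    "induced_clustering {..<npoints I} (dst I) (rds I) (mults I) (real a' / real b') A (set ` set css)"
    using R.labelled_feasible by fastforce
  \<comment> \<open>Only the values agree: the fraction found may differ from \<open>(a, b)\<close>,
    and its clustering from \<C>.\<close>
  have eq: "real a' / real b' = \<alpha>" using le R.optimal_dilation_le[OF opt A(1)] by simp
  have optA: "optimal_placement {..<npoints I} (dst I) (rds I) (mults I) (real a' / real b') A"
    using R.feasible_optimal[OF opt] A(1) eq by simp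
  have "solve t ?M ?R (mults I) = ((a', b'), css)" using s(2) s' by (simp add: solve_def)
  moreover have "optimal_clustering {..<npoints I} (dst I) (rds I) (mults I) (set ` set css)"
    using optA A(2) unfolding optimal_clustering_def by blast
  ultimately have "epair enc_frac (enc_list (enc_list enc_nat)) (solve t ?M ?R (mults I)) =
      Node (Node (enc_nat a') (enc_nat b')) (enc_list (enc_list enc_nat) css) \<and> 0 < b' \<and>
      optimal_dilation (pts I) (dst I) (rds I) (mults I) (real a' / real b') \<and>
      distinct (map set css) \<and> (\<forall>cs\<in>set css. distinct cs) \<and>
      optimal_clustering (pts I) (dst I) (rds I) (mults I) (set ` set css)"
    using b' hit(2,3) R.optimal_placement_dilation[OF optA] by (simp add: pts_def)
  then show ?thesis unfolding is_solution_def by blast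
qed

end

text \<open>The time bound holds on all instances; membership in \<open>S\<close> enters through
  correctness alone.\<close>

lemma poly_time_solvableI:
  assumes "\<And>I. nukc_instance t I \<Longrightarrow> I \<in> S \<Longrightarrow> \<exists>\<alpha> \<C> j.
      optimal_dilation {..<npoints I} (dst I) (rds I) (mults I) \<alpha> \<and>
      labelled {..<npoints I} (dst I) (rds I) (mults I) \<alpha> \<C> j \<and>
      radius_classes.separated {..<npoints I} (rds I) (dst I) \<alpha> \<C> j"
  shows "poly_time_solvable t S"
proof -
  let ?solve = "\<lambda>x. solve t (fst x) (fst (snd x)) (snd (snd x))"
  let ?out = "\<lambda>x. epair enc_frac (enc_list (enc_list enc_nat)) (?solve x)"
  obtain prog p where run: "\<And>x. x \<in> UNIV \<Longrightarrow> \<exists>n \<le> poly p (size (enc_input x)). runs prog (enc_input x) (?out x) n"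
    using ptime_runs[OF ptime_solve[of t]] by blast
  show ?thesis
    unfolding poly_time_solvable_def
  proof (rule exI[of _ prog], rule exI[of _ p], intro allI impI)
    fix I assume I: "nukc_instance t I"
    then interpret nukc t I by unfold_locales
    obtain n where "n \<le> poly p (size (enc_instance I))" "runs prog (enc_instance I) (?out (input_of I)) n"
      using run[of "input_of I"] by (auto simp: enc_input_of)
    moreover have "is_solution I (?out (input_of I))" if "I \<in> S"
      using assms[OF I that] solve_solution by (auto simp: input_of_def)
    ultimately show "\<exists>out n. runs prog (enc_instance I) out n \<and> n \<le> poly p (size (enc_instance I)) \<and>
        (I \<in> S \<longrightarrow> is_solution I out)"
      by blast
  qed
qed

text \<open>In the second family \<epsilon> may depend on the instance, and the algorithm does not
  receive it. Existence of an optimal clustering is demanded because with more balls than points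
  there is no partition into that many parts, and the conditions on optimal clusterings would hold
  vacuously.\<close>

theorem theorem10:
  fixes t :: nat
  shows
    "poly_time_solvable t {I. perturbation_resilient 2 (pts I) (dst I) (rds I) (mults I)} \<and>
     poly_time_solvable t {I. \<exists>\<epsilon>::real.
        eps_perturbation_resilient 3 \<epsilon> (pts I) (dst I) (rds I) (mults I) \<and>
        (\<exists>\<C>. optimal_clustering (pts I) (dst I) (rds I) (mults I) \<C>) \<and>
        (\<forall>\<C>. optimal_clustering (pts I) (dst I) (rds I) (mults I) \<C> \<longrightarrow>
           (\<forall>C \<in> \<C>. real (card C) > \<epsilon> * real (npoints I) + 1))}"
proof (intro conjI poly_time_solvableI)
  fix I :: instance_data
  assume "nukc_instance t I"
  then interpret nukc t I by unfold_locales
  interpret radius_classes "{..<npoints I}" "rds I" "mults I" by (rule radius_classes)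
  assume "I \<in> {I. perturbation_resilient 2 (pts I) (dst I) (rds I) (mults I)}"
  then show "\<exists>\<alpha> \<C> j. optimal_dilation {..<npoints I} (dst I) (rds I) (mults I) \<alpha> \<and>
      labelled {..<npoints I} (dst I) (rds I) (mults I) \<alpha> \<C> j \<and>
      radius_classes.separated {..<npoints I} (rds I) (dst I) \<alpha> \<C> j"
    by (intro resilient_separated[OF metric]) (simp add: pts_def)
next
  fix I :: instance_data
  assume "nukc_instance t I"
  then interpret nukc t I by unfold_locales
  interpret radius_classes "{..<npoints I}" "rds I" "mults I" by (rule radius_classes)
  assume "I \<in> {I. \<exists>\<epsilon>::real.
        eps_perturbation_resilient 3 \<epsilon> (pts I) (dst I) (rds I) (mults I) \<and>
        (\<exists>\<C>. optimal_clustering (pts I) (dst I) (rds I) (mults I) \<C>) \<and>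
        (\<forall>\<C>. optimal_clustering (pts I) (dst I) (rds I) (mults I) \<C> \<longrightarrow>
           (\<forall>C \<in> \<C>. real (card C) > \<epsilon> * real (npoints I) + 1))}"
  then obtain \<epsilon> \<C> where "eps_perturbation_resilient 3 \<epsilon> {..<npoints I} (dst I) (rds I) (mults I)"
    "optimal_clustering {..<npoints I} (dst I) (rds I) (mults I) \<C>"
    "\<And>C. C \<in> \<C> \<Longrightarrow> real (card C) > \<epsilon> * real (card {..<npoints I}) + 1"
    unfolding pts_def by auto
  from eps_resilient_separated[OF metric this]
  show "\<exists>\<alpha> \<C> j. optimal_dilation {..<npoints I} (dst I) (rds I) (mults I) \<alpha> \<and>
      labelled {..<npoints I} (dst I) (rds I) (mults I) \<alpha> \<C> j \<and>
      radius_classes.separated {..<npoints I} (rds I) (dst I) \<alpha> \<C> j"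
    by blast
qed

end
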